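(* Let $\lambda\in\mathbb{R}\setminus\{0\}$, $a>0$, $\Omega=(-a,a)$, and let $\varphi\in\mathcal{D}\cap H^3(\Omega)$. Let $u\in\mathcal{C}(\mathbb{R};D_{\mathrm{Neu}}(\Delta))$ be the unique solution of $$ i\partial_t u+\partial_x^2u=\lambda u\log|u|^2 \ \text{ on } \mathbb{R}\times\Omega,\qquad \partial_xu(t,\pm a)=0,\qquad u(0)=\varphi. $$ Then there exists a time $T>0$ such that $u(t)\in\mathcal{D}\cap H^3(\Omega)$ for all $t\in(-T,T)$.
   Context: Functions are complex-valued; $z\log|z|^2$ is understood as $0$ at $z=0$. $D_{\mathrm{Neu}}(\Delta)=\{\phi\in H^2(\Omega):\partial_x\phi(\pm a)=0\}$. $\mathcal{D}=\{\phi\in D_{\mathrm{Neu}}(\Delta) : \phi\text{ odd},\ \phi(x)\neq0\text{ for all }x\in[-a,a]\setminus\{0\},\ \partial_x\phi(0)\neq0\}$. It is known that for every $\varphi\in D_{\mathrm{Neu}}(\Delta)$ the Neumann problem $i\partial_t u+\partial_x^2u=\lambda u\log|u|^2$ on $\mathbb{R}\times\Omega$, $\partial_xu(t,\pm a)=0$ for all $t\in\mathbb{R}$, $u(0)=\varphi$, has a unique solution $u\in\mathcal{C}(\mathbb{R};D_{\mathrm{Neu}}(\Delta))\cap W^{1,\infty}_{\rm loc}(\mathbb{R};L^2(\Omega))$, the equation holding in $L^2(\Omega)$ for all $t\in\mathbb{R}$. *)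

theory Defs
  imports "HOL-Analysis.Analysis"
begin

definition L2 :: "real set \<Rightarrow> (real \<Rightarrow> complex) set" where
  "L2 \<Omega> = {f. f \<in> borel_measurable (lebesgue_on \<Omega>) \<and>
              integrable (lebesgue_on \<Omega>) (\<lambda>x. (cmod (f x))\<^sup>2)}"

definition L2_norm :: "real set \<Rightarrow> (real \<Rightarrow> complex) \<Rightarrow> real" where
  "L2_norm \<Omega> f = sqrt (LINT x|lebesgue_on \<Omega>. (cmod (f x))\<^sup>2)"

definition L2_inner :: "real set \<Rightarrow> (real \<Rightarrow> complex) \<Rightarrow> (real \<Rightarrow> complex) \<Rightarrow> complex" where
  "L2_inner \<Omega> f g = (LINT x|lebesgue_on \<Omega>. f x * cnj (g x))"

text \<open>Test functions may be taken real-valued, since the weak derivative identities are linear in them.\<close>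

definition test_fun :: "real set \<Rightarrow> (real \<Rightarrow> real) \<Rightarrow> bool" where
  "test_fun \<Omega> \<eta> \<longleftrightarrow>
     (\<forall>k x. ((deriv ^^ k) \<eta>) differentiable (at x)) \<and>
     compact (closure {x. \<eta> x \<noteq> 0}) \<and> closure {x. \<eta> x \<noteq> 0} \<subseteq> \<Omega>"

definition has_weak_deriv ::
  "real set \<Rightarrow> nat \<Rightarrow> (real \<Rightarrow> complex) \<Rightarrow> (real \<Rightarrow> complex) \<Rightarrow> bool" where
  "has_weak_deriv \<Omega> k f g \<longleftrightarrow> f \<in> L2 \<Omega> \<and> g \<in> L2 \<Omega> \<and>
     (\<forall>\<eta>. test_fun \<Omega> \<eta> \<longrightarrow>
        (LINT x|lebesgue_on \<Omega>. (deriv ^^ k) \<eta> x *\<^sub>R f x) =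
        (- 1) ^ k * (LINT x|lebesgue_on \<Omega>. \<eta> x *\<^sub>R g x))"

text \<open>A representative of the weak derivative; for open \<open>\<Omega>\<close> it is unique up to null sets, and
  below it only occurs under integrals or almost everywhere.\<close>

definition weak_deriv :: "real set \<Rightarrow> nat \<Rightarrow> (real \<Rightarrow> complex) \<Rightarrow> real \<Rightarrow> complex" where
  "weak_deriv \<Omega> k f = (SOME g. has_weak_deriv \<Omega> k f g)"

definition Sobolev_H :: "nat \<Rightarrow> real set \<Rightarrow> (real \<Rightarrow> complex) set" where
  "Sobolev_H m \<Omega> = {f \<in> L2 \<Omega>. \<forall>k\<le>m. \<exists>g. has_weak_deriv \<Omega> k f g}"

definition Sobolev_norm :: "nat \<Rightarrow> real set \<Rightarrow> (real \<Rightarrow> complex) \<Rightarrow> real" where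
  "Sobolev_norm m \<Omega> f = sqrt (\<Sum>k\<le>m. (L2_norm \<Omega> (weak_deriv \<Omega> k f))\<^sup>2)"

text \<open>Elements of \<open>H\<^sup>2(-a,a)\<close> are represented by their continuous representative on the closed
  interval, which is continuously differentiable there; hence pointwise values and the one-sided
  derivatives at the end points make sense. Values outside \<open>[-a,a]\<close> are irrelevant.\<close>

definition D_Neu :: "real \<Rightarrow> (real \<Rightarrow> complex) set" where
  "D_Neu a = {\<phi> \<in> Sobolev_H 2 {-a<..<a}. continuous_on {-a..a} \<phi> \<and>
     (\<phi> has_vector_derivative 0) (at (-a) within {-a..a}) \<and>
     (\<phi> has_vector_derivative 0) (at a within {-a..a})}"

definition D_odd :: "real \<Rightarrow> (real \<Rightarrow> complex) set" where
  "D_odd a = {\<phi> \<in> D_Neu a.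
     (\<forall>x\<in>{-a..a}. \<phi> (-x) = - \<phi> x) \<and>
     (\<forall>x\<in>{-a..a} - {0}. \<phi> x \<noteq> 0) \<and>
     vector_derivative \<phi> (at 0 within {-a..a}) \<noteq> 0}"

definition C_D_Neu :: "real \<Rightarrow> (real \<Rightarrow> real \<Rightarrow> complex) \<Rightarrow> bool" where
  "C_D_Neu a u \<longleftrightarrow> (\<forall>t. u t \<in> D_Neu a) \<and>
     (\<forall>t. ((\<lambda>s. Sobolev_norm 2 {-a<..<a} (\<lambda>x. u s x - u t x)) \<longlongrightarrow> 0) (at t))"

text \<open>\<open>L\<^sup>\<infinity>\<close>-loc and weak time derivatives for \<open>L\<^sup>2(\<Omega>)\<close>-valued functions. As \<open>L\<^sup>2(\<Omega>)\<close> is a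
  separable Hilbert space, strong measurability and identities between Bochner integrals
  may be tested by pairing with arbitrary \<open>w \<in> L\<^sup>2(\<Omega>)\<close> (Pettis).\<close>

definition Linf_loc_L2 :: "real set \<Rightarrow> (real \<Rightarrow> real \<Rightarrow> complex) \<Rightarrow> bool" where
  "Linf_loc_L2 \<Omega> v \<longleftrightarrow> (\<forall>t. v t \<in> L2 \<Omega>) \<and>
     (\<forall>w\<in>L2 \<Omega>. (\<lambda>t. L2_inner \<Omega> (v t) w) \<in> borel_measurable lebesgue) \<and>
     (\<forall>R. \<exists>M. AE t in lebesgue. \<bar>t\<bar> \<le> R \<longrightarrow> L2_norm \<Omega> (v t) \<le> M)"

definition has_weak_time_deriv ::
  "real set \<Rightarrow> (real \<Rightarrow> real \<Rightarrow> complex) \<Rightarrow> (real \<Rightarrow> real \<Rightarrow> complex) \<Rightarrow> bool" where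
  "has_weak_time_deriv \<Omega> u v \<longleftrightarrow>
     (\<forall>\<eta>. test_fun UNIV \<eta> \<longrightarrow> (\<forall>w\<in>L2 \<Omega>.
        (LINT t|lebesgue. deriv \<eta> t *\<^sub>R L2_inner \<Omega> (u t) w) =
        - (LINT t|lebesgue. \<eta> t *\<^sub>R L2_inner \<Omega> (v t) w)))"

text \<open>The value at \<open>0\<close> is \<open>0\<close>, because of the factor \<open>z\<close>.\<close>

definition log_nl :: "complex \<Rightarrow> complex" where
  "log_nl z = z * complex_of_real (ln ((cmod z)\<^sup>2))"

text \<open>\<open>u\<close> is continuous in time with values in \<open>D_Neu a\<close> (which contains the Neumann condition)
  and locally \<open>W\<close>-\<open>(1,\<infinity>)\<close> with values in \<open>L\<^sup>2\<close>; \<open>v\<close> is the version of the time derivative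
  for which the equation holds in \<open>L\<^sup>2\<close> at every time, not just almost every time.\<close>

definition logNLS_solution ::
  "real \<Rightarrow> real \<Rightarrow> (real \<Rightarrow> complex) \<Rightarrow> (real \<Rightarrow> real \<Rightarrow> complex) \<Rightarrow> bool" where
  "logNLS_solution lam a \<phi> u \<longleftrightarrow>
     C_D_Neu a u \<and>
     (\<exists>v. Linf_loc_L2 {-a<..<a} u \<and> Linf_loc_L2 {-a<..<a} v \<and>
          has_weak_time_deriv {-a<..<a} u v \<and>
          (\<forall>t. AE x in lebesgue_on {-a<..<a}.
             \<i> * v t x + weak_deriv {-a<..<a} 2 (u t) x = complex_of_real lam * log_nl (u t x))) \<and>
     (\<forall>x\<in>{-a..a}. u 0 x = \<phi> x)"

end

theory Submission
  imports Defs
begin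

text \<open>
  Oddness and the non-vanishing conditions persist for a short time because the flow is continuous in
  \<open>H\<^sup>2\<close>, hence in \<open>C\<^sup>1\<close>, and because \<open>x \<mapsto> - u t (- x)\<close> solves the same equation; uniqueness follows from
  \<open>\<bar>Im (cnj (z - w) * (F z - F w))\<bar> \<le> 2 \<bar>z - w\<bar>\<^sup>2\<close> for \<open>F z = z ln \<bar>z\<bar>\<^sup>2\<close>. In particular \<open>\<bar>u t x\<bar> \<ge> c \<bar>x\<bar>\<close>
  uniformly for small \<open>t\<close>.

  For the \<open>H\<^sup>3\<close> regularity, time increments \<open>w = u (t + h) - u t\<close> are compared in the energy norm. In the
  derivative of \<open>F (u (t + h)) - F (u t)\<close> the logarithm only multiplies \<open>w'\<close> by a real factor and drops
  out of the imaginary part; the remaining terms are bounded by \<open>\<bar>w'\<bar> + \<bar>w\<bar> / \<bar>x\<bar>\<close>, and since \<open>w\<close> vanishes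
  at \<open>0\<close>, Hardy's inequality bounds them by the norm of \<open>w'\<close>. Gronwall's lemma, with the increment
  at time \<open>0\<close> controlled through \<open>\<phi> \<in> H\<^sup>3\<close>, shows that \<open>t \<mapsto> u t\<close> is locally Lipschitz into \<open>H\<^sup>1\<close>. Hence
  the time derivative of \<open>u\<close> lies in \<open>H\<^sup>1\<close>, and the equation gives \<open>\<partial>\<^sub>x\<^sup>2 u \<in> H\<^sup>1\<close>.
\<close>

section \<open>Smooth functions and test functions\<close>

text \<open>The equation cannot be differentiated in time: \<open>log_nl\<close> is not
  differentiable at 0, a value that \<open>u t\<close> takes at \<open>x = 0\<close>, and the
  velocity \<open>V t\<close> is known to lie in \<open>L2\<close> only. Hence increments are used,
  and of their gradients only the norms are differentiated in time. In space, the derivative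
  \<open>p\<close> that vanishes at both ends absorbs all boundary terms, so the nonlinear factor
  needs no boundary condition. The hypothesis on \<open>\<phi>\<close> enters as a weak derivative
  of \<open>V 0\<close>, so that one derivative can be moved off \<open>g\<close> in the pairing
  with that source. Young's inequality with weight \<open>|h|\<close> then leads to the Gronwall
  rate \<open>K + 1 / |h|\<close> on an interval of length \<open>|h|\<close>, which costs a factor
  \<open>exp 1\<close> and leaves a bound of order \<open>|h|\<close> squared. A bound on increments
  controls \<open>V t\<close> only through test functions; its weak derivative therefore comes from
  duality, by the Riesz representation.\<close>

definition smooth :: "(real \<Rightarrow> real) \<Rightarrow> bool" where
  "smooth \<eta> \<longleftrightarrow> (\<forall>k x. ((deriv ^^ k) \<eta>) differentiable (at x))"

text \<open>Induction on the order keeps every iterated derivative in \<open>C\<close>. Smoothness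
  thus reduces to exhibiting a class closed under differentiation, without formulas for higher
  derivatives.\<close>

lemma smooth_coinduct:
  assumes "f \<in> C"
    and step: "\<And>f. f \<in> C \<Longrightarrow> \<exists>f'\<in>C. \<forall>x. (f has_real_derivative f' x) (at x)"
  shows "smooth f"
proof -
  have "(deriv ^^ k) f \<in> C" for k
  proof (induction k)
    case 0
    then show ?case using assms by simp
  next
    case (Suc k)
    obtain f' where f': "f' \<in> C" "\<forall>x. ((deriv ^^ k) f has_real_derivative f' x) (at x)"
      using step[OF Suc] by blast
    have "deriv ((deriv ^^ k) f) = f'"
      using f'(2) by (intro ext DERIV_imp_deriv) auto
    then show ?case using f'(1) by simp
  qed
  then show ?thesis unfolding smooth_def
    by (meson step real_differentiable_def)
qed

lemma smooth_DERIV: "smooth f \<Longrightarrow> (f has_real_derivative deriv f x) (at x)"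
  unfolding smooth_def by (metis DERIV_deriv_iff_real_differentiable funpow_0)

lemma smooth_deriv: "smooth f \<Longrightarrow> smooth (deriv f)"
  unfolding smooth_def by (metis comp_apply funpow_Suc_right)

lemma smooth_continuous: "smooth f \<Longrightarrow> continuous_on S f"
  by (meson DERIV_isCont continuous_at_imp_continuous_on smooth_DERIV)

lemma smooth_primitive:
  assumes "\<And>x. (f has_real_derivative g x) (at x)" "smooth g"
  shows "smooth f"
proof (rule smooth_coinduct[where C = "insert f {g. smooth g}"])
  fix h assume "h \<in> insert f {g. smooth g}"
  then show "\<exists>f'\<in>insert f {g. smooth g}. \<forall>x. (h has_real_derivative f' x) (at x)"
    using assms smooth_DERIV smooth_deriv by blast
qed auto

lemma smooth_affine:
  assumes "smooth f" shows "smooth (\<lambda>x. f (m * x + b))"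
\<comment> \<open>The prefactor \<open>r\<close> closes the class: each differentiation contributes
  another factor \<open>m\<close>.\<close>
proof (rule smooth_coinduct[where C = "{\<lambda>x. r * g (m * x + b) | r g. smooth g}"])
  show "(\<lambda>x. f (m * x + b)) \<in> {\<lambda>x. r * g (m * x + b) | r g. smooth g}"
    using assms by (auto intro!: exI[of _ 1] exI[of _ f])
next
  fix h assume "h \<in> {\<lambda>x. r * g (m * x + b) | r g. smooth g}"
  then obtain r g where h: "h = (\<lambda>x. r * g (m * x + b))" "smooth g" by blast
  have "(h has_real_derivative (r * m) * deriv g (m * x + b)) (at x)" for x
    unfolding h(1)
    by (rule derivative_eq_intros DERIV_chain'[OF _ smooth_DERIV[OF h(2)]] refl | simp)+
  then show "\<exists>f'\<in>{\<lambda>x. r * g (m * x + b) | r g. smooth g}. \<forall>x. (h has_real_derivative f' x) (at x)"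
    using smooth_deriv[OF h(2)] by (intro bexI[of _ "\<lambda>x. (r * m) * deriv g (m * x + b)"]) auto
qed

text \<open>Products alone are not closed under differentiation, since the product rule creates
  sums; the generated algebra is, and this makes it a valid class for
  \<open>smooth_coinduct\<close>.\<close>

inductive_set smooth_alg :: "(real \<Rightarrow> real) set" where
  base: "smooth f \<Longrightarrow> f \<in> smooth_alg"
| add: "f \<in> smooth_alg \<Longrightarrow> g \<in> smooth_alg \<Longrightarrow> (\<lambda>x. f x + g x) \<in> smooth_alg"
| mult: "f \<in> smooth_alg \<Longrightarrow> g \<in> smooth_alg \<Longrightarrow> (\<lambda>x. f x * g x) \<in> smooth_alg"

lemma smooth_alg_smooth:
  assumes "f \<in> smooth_alg" shows "smooth f"
proof (rule smooth_coinduct[OF assms])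
  fix f assume "f \<in> smooth_alg"
  then show "\<exists>f'\<in>smooth_alg. \<forall>x. (f has_real_derivative f' x) (at x)"
  proof induction
    case (base f)
    then show ?case by (meson smooth_alg.base smooth_DERIV smooth_deriv)
  next
    case (add f g)
    then obtain f' g' where "f' \<in> smooth_alg" "g' \<in> smooth_alg"
      "\<forall>x. (f has_real_derivative f' x) (at x)" "\<forall>x. (g has_real_derivative g' x) (at x)" by blast
    then show ?case
      by (intro bexI[of _ "\<lambda>x. f' x + g' x"]) (auto intro!: DERIV_add smooth_alg.add)
  next
    case (mult f g)
    then obtain f' g' where "f' \<in> smooth_alg" "g' \<in> smooth_alg"
      "\<forall>x. (f has_real_derivative f' x) (at x)" "\<forall>x. (g has_real_derivative g' x) (at x)" by blast
    then show ?case using mult.hyps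
      by (intro bexI[of _ "\<lambda>x. f' x * g x + g' x * f x"])
        (auto intro!: DERIV_mult smooth_alg.add smooth_alg.mult)
  qed
qed

lemma smooth_add: "smooth f \<Longrightarrow> smooth g \<Longrightarrow> smooth (\<lambda>x. f x + g x)"
  by (simp add: smooth_alg_smooth smooth_alg.intros)

lemma smooth_mult: "smooth f \<Longrightarrow> smooth g \<Longrightarrow> smooth (\<lambda>x. f x * g x)"
  by (simp add: smooth_alg_smooth smooth_alg.intros)

lemma smooth_const: "smooth (\<lambda>x. c)"
  by (rule smooth_coinduct[where C = "range (\<lambda>c x. c)"]) (auto intro!: exI[of _ 0])

text \<open>The functions \<open>exp_flat p\<close> form a family closed under differentiation, hence are smooth.\<close>

definition exp_flat :: "real poly \<Rightarrow> real \<Rightarrow> real" where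
  "exp_flat p x = (if x > 0 then poly p (1 / x) * exp (- (1 / x)) else 0)"

lemma poly_exp_decay: "((\<lambda>y::real. poly p y * exp (- y)) \<longlongrightarrow> 0) at_top"
proof -
  have "((\<lambda>y. \<Sum>i\<le>degree p. coeff p i * (y ^ i / exp y)) \<longlongrightarrow> (\<Sum>i\<le>degree p. coeff p i * 0)) at_top"
    by (intro tendsto_sum tendsto_mult tendsto_const tendsto_power_div_exp_0)
  moreover have "poly p y * exp (- y) = (\<Sum>i\<le>degree p. coeff p i * (y ^ i / exp y))" for y :: real
    by (simp add: poly_altdef exp_minus sum_distrib_right divide_inverse mult.assoc)
  ultimately show ?thesis by simp
qed

text \<open>With y = 1 / x, the derivative of p(y) exp(-y) is y^2 (p(y) - p'(y)) exp(-y), which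
  explains the factor \<open>[:0, 0, 1:]\<close>. At 0 the right difference quotient is y p(y)
  exp(-y), and exponential decay beats the polynomial.\<close>

lemma DERIV_exp_flat:
  "(exp_flat p has_real_derivative exp_flat ([:0, 0, 1:] * (p - pderiv p)) x) (at x)"
proof (cases "x > 0")
  case True
  have "((\<lambda>x. poly p (1 / x) * exp (- (1 / x))) has_real_derivative
      exp_flat ([:0, 0, 1:] * (p - pderiv p)) x) (at x)"
    using True unfolding exp_flat_def
    by (auto intro!: derivative_eq_intros simp: field_simps power2_eq_square)
  then show ?thesis
    by (rule has_field_derivative_transform_within_open[where S = "{0<..}"])
      (use True in \<open>auto simp: exp_flat_def\<close>)
next
  case False
  show ?thesis
  proof (cases "x = 0")
    case True
    have "((\<lambda>h. (exp_flat p (0 + h) - exp_flat p 0) / h) \<longlongrightarrow> 0) (at_left 0)"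
      by (rule tendsto_eventually) (auto simp: exp_flat_def eventually_at intro!: exI[of _ 1])
    moreover have "((\<lambda>h. (exp_flat p (0 + h) - exp_flat p 0) / h) \<longlongrightarrow> 0) (at_right 0)"
    proof (rule Lim_transform_eventually)
      show "((\<lambda>h. poly ([:0, 1:] * p) (inverse h) * exp (- inverse h)) \<longlongrightarrow> 0) (at_right 0)"
        by (rule filterlim_compose[OF poly_exp_decay filterlim_inverse_at_top_right])
      show "\<forall>\<^sub>F h in at_right 0. poly ([:0, 1:] * p) (inverse h) * exp (- inverse h) =
          (exp_flat p (0 + h) - exp_flat p 0) / h"
        by (auto simp: exp_flat_def eventually_at field_simps intro!: exI[of _ 1])
    qed
    ultimately show ?thesis
      unfolding DERIV_def True by (simp add: filterlim_split_at_real exp_flat_def)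
  next
    case xneg: False
    have "((\<lambda>x. 0) has_real_derivative exp_flat ([:0, 0, 1:] * (p - pderiv p)) x) (at x)"
      using False by (simp add: exp_flat_def)
    then show ?thesis
      by (rule has_field_derivative_transform_within_open[where S = "{..<0}"])
        (use False xneg in \<open>auto simp: exp_flat_def\<close>)
  qed
qed

lemma smooth_exp_flat: "smooth (exp_flat p)"
  by (rule smooth_coinduct[where C = "range exp_flat"]) (use DERIV_exp_flat in blast)+

section \<open>Test functions and smooth cutoffs\<close>

lemma test_fun_smooth: "test_fun \<Omega> \<eta> \<Longrightarrow> smooth \<eta>"
  by (simp add: test_fun_def smooth_def)

lemma test_funI:
  assumes "smooth \<eta>" "compact K" "K \<subseteq> \<Omega>" "\<And>x. x \<notin> K \<Longrightarrow> \<eta> x = 0"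
  shows "test_fun \<Omega> \<eta>"
proof -
  have "closure {x. \<eta> x \<noteq> 0} \<subseteq> K"
    using assms by (intro closure_minimal compact_imp_closed) auto
  moreover from this have "compact (closure {x. \<eta> x \<noteq> 0})"
    by (meson assms(2) bounded_subset closed_closure compact_eq_bounded_closed)
  ultimately show ?thesis using assms by (auto simp: test_fun_def smooth_def)
qed

lemma test_fun_support:
  assumes "test_fun \<Omega> \<eta>"
  obtains K where "compact K" "K \<subseteq> \<Omega>" "\<And>x. x \<notin> K \<Longrightarrow> \<eta> x = 0"
proof (rule that[of "closure {x. \<eta> x \<noteq> 0}"])
  fix x assume "x \<notin> closure {x. \<eta> x \<noteq> 0}"
  then show "\<eta> x = 0" using closure_subset[of "{x. \<eta> x \<noteq> 0}"] by auto
qed (use assms in \<open>auto simp: test_fun_def\<close>)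

lemma test_fun_outside: "test_fun \<Omega> \<eta> \<Longrightarrow> x \<notin> \<Omega> \<Longrightarrow> \<eta> x = 0"
  by (metis subsetD test_fun_support)

lemma test_fun_add:
  assumes "test_fun \<Omega> \<eta>" "test_fun \<Omega> \<psi>"
  shows "test_fun \<Omega> (\<lambda>x. \<eta> x + \<psi> x)"
proof -
  obtain K where K: "compact K" "K \<subseteq> \<Omega>" "\<And>x. x \<notin> K \<Longrightarrow> \<eta> x = 0" using test_fun_support[OF assms(1)] by blast
  obtain L where L: "compact L" "L \<subseteq> \<Omega>" "\<And>x. x \<notin> L \<Longrightarrow> \<psi> x = 0" using test_fun_support[OF assms(2)] by blast
  show ?thesis
    by (rule test_funI[of _ "K \<union> L"])
      (use K L assms in \<open>auto intro!: smooth_add intro: test_fun_smooth\<close>)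
qed

lemma test_fun_mult_smooth:
  assumes "test_fun \<Omega> \<eta>" "smooth \<psi>"
  shows "test_fun \<Omega> (\<lambda>x. \<psi> x * \<eta> x)"
proof -
  obtain K where K: "compact K" "K \<subseteq> \<Omega>" "\<And>x. x \<notin> K \<Longrightarrow> \<eta> x = 0" using test_fun_support[OF assms(1)] by blast
  show ?thesis
    by (rule test_funI[of _ K])
      (use K assms in \<open>auto intro!: smooth_mult intro: test_fun_smooth\<close>)
qed

lemma test_fun_scale: "test_fun \<Omega> \<eta> \<Longrightarrow> test_fun \<Omega> (\<lambda>x. r * \<eta> x)"
  by (rule test_fun_mult_smooth) (simp_all add: smooth_const)

lemma test_fun_mono: "test_fun \<Omega> \<eta> \<Longrightarrow> \<Omega> \<subseteq> \<Omega>' \<Longrightarrow> test_fun \<Omega>' \<eta>"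
  by (auto simp: test_fun_def)

lemma test_fun_DERIV: "test_fun \<Omega> \<eta> \<Longrightarrow> (\<eta> has_real_derivative deriv \<eta> x) (at x)"
  by (simp add: smooth_DERIV test_fun_smooth)

lemma test_fun_deriv:
  assumes "test_fun \<Omega> \<eta>" shows "test_fun \<Omega> (deriv \<eta>)"
proof -
  obtain K where K: "compact K" "K \<subseteq> \<Omega>" "\<And>x. x \<notin> K \<Longrightarrow> \<eta> x = 0" using test_fun_support[OF assms(1)] by blast
  show ?thesis
  proof (rule test_funI[of _ K])
    fix x assume x: "x \<notin> K"
    have "((\<lambda>x. 0) has_real_derivative 0) (at x)" by simp
    then have "(\<eta> has_real_derivative 0) (at x)"
      by (rule has_field_derivative_transform_within_open[where S = "- K"])
        (use K x in \<open>auto simp: compact_imp_closed open_Compl\<close>)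
    then show "deriv \<eta> x = 0" by (rule DERIV_imp_deriv)
  qed (use K assms in \<open>auto intro!: smooth_deriv intro: test_fun_smooth\<close>)
qed

text \<open>A smooth substitute for the indicator of \<open>{p<..<q}\<close>. The shift by 1 makes
  it vanish within distance \<open>1 / n\<close> of the end points, so its support is compact in the
  open interval; as \<open>n\<close> grows both factors tend to 1 inside.\<close>

definition plateau :: "real \<Rightarrow> real \<Rightarrow> nat \<Rightarrow> real \<Rightarrow> real" where
  "plateau p q n x = exp_flat 1 (real n * (x - p) - 1) * exp_flat 1 (real n * (q - x) - 1)"

lemma exp_flat_1_bounds: "0 \<le> exp_flat 1 x" "exp_flat 1 x \<le> 1"
  by (auto simp: exp_flat_def)

lemma plateau_bounds: "0 \<le> plateau p q n x" "plateau p q n x \<le> 1"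
  by (auto simp: plateau_def exp_flat_1_bounds mult_le_one)

lemma test_fun_plateau: "n > 0 \<Longrightarrow> test_fun {p<..<q} (plateau p q n)"
proof (rule test_funI[of _ "{p + 1 / n .. q - 1 / n}"])
  have "smooth (\<lambda>x. exp_flat 1 (real n * x + (- real n * p - 1)) * exp_flat 1 ((- real n) * x + (real n * q - 1)))"
    by (intro smooth_mult smooth_affine smooth_exp_flat)
  then show "smooth (plateau p q n)" by (simp add: plateau_def[abs_def] algebra_simps)
  assume n: "n > 0"
  fix x assume "x \<notin> {p + 1 / real n..q - 1 / real n}"
  then have "real n * (x - p) - 1 \<le> 0 \<or> real n * (q - x) - 1 \<le> 0"
    using n by (auto simp: field_simps not_le)
  then show "plateau p q n x = 0" by (auto simp: plateau_def exp_flat_def)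
next
  assume n: "n > 0"
  then have "1 / real n > 0" by simp
  then show "{p + 1 / real n..q - 1 / real n} \<subseteq> {p<..<q}"
    by (intro subsetI; simp only: atLeastAtMost_iff greaterThanLessThan_iff; linarith)
qed auto

lemma exp_flat_1_tendsto:
  assumes "x > 0" shows "(\<lambda>n. exp_flat 1 (real n * x - 1)) \<longlonglongrightarrow> 1"
proof (rule Lim_transform_eventually)
  have lim: "filterlim (\<lambda>n. real n * x - 1) at_top sequentially"
    using filterlim_tendsto_add_at_top[OF tendsto_const[of "-1"]
        filterlim_at_top_mult_tendsto_pos[OF tendsto_const assms filterlim_real_sequentially]]
    by simp
  have "(\<lambda>n. exp (- inverse (real n * x - 1))) \<longlonglongrightarrow> exp (- 0)"
    by (intro tendsto_intros tendsto_inverse_0_at_top lim)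
  then show "(\<lambda>n. exp (- (1 / (real n * x - 1)))) \<longlonglongrightarrow> 1"
    by (simp add: inverse_eq_divide)
  show "\<forall>\<^sub>F n in sequentially. exp (- (1 / (real n * x - 1))) = exp_flat 1 (real n * x - 1)"
    using filterlim_at_top_dense[THEN iffD1, OF lim, rule_format, of 0]
    by eventually_elim (simp add: exp_flat_def)
qed

lemma plateau_tendsto: "(\<lambda>n. plateau p q n x) \<longlonglongrightarrow> indicator {p<..<q} x"
proof (cases "x \<in> {p<..<q}")
  case True
  then have "(\<lambda>n. plateau p q n x) \<longlonglongrightarrow> 1 * 1"
    unfolding plateau_def by (intro tendsto_mult exp_flat_1_tendsto) auto
  with True show ?thesis by simp
next
  case False
  have "real n * (x - p) - 1 \<le> 0 \<or> real n * (q - x) - 1 \<le> 0" for n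
  proof (cases "x \<le> p")
    case True
    then have "real n * (x - p) \<le> 0" by (simp add: mult_nonneg_nonpos)
    then show ?thesis by linarith
  next
    case False
    with \<open>x \<notin> {p<..<q}\<close> have "real n * (q - x) \<le> 0" by (simp add: mult_nonneg_nonpos)
    then show ?thesis by linarith
  qed
  then have "plateau p q n x = 0" for n
    using exp_flat_def plateau_def by (metis mult_eq_0_iff not_less)
  with False show ?thesis by simp
qed

text \<open>Open intervals are an intersection-stable generator of the Borel sets, so a Dynkin
  argument extends the vanishing of the integral to every Borel set, and completion extends it to
  every Lebesgue set. A function with all these integrals zero is null.\<close>

lemma interval_null_imp_AE_null:
  fixes f :: "real \<Rightarrow> complex"
  assumes f: "integrable lebesgue f" and supp: "\<And>x. x \<notin> {c<..<d} \<Longrightarrow> f x = 0"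
    and null: "\<And>p q. (LINT x|lebesgue. indicator {p<..<q} x *\<^sub>R f x) = 0"
  shows "AE x in lebesgue. f x = 0"
proof (rule sigma_finite_measure.density_zero[OF _ f])
  show "sigma_finite_measure (lebesgue :: real measure)"
  proof
    from sigma_finite_measure.sigma_finite_countable[OF sigma_finite_lborel]
    obtain \<A> where "countable \<A> \<and> \<A> \<subseteq> sets (lborel :: real measure) \<and> \<Union>\<A> = space lborel \<and>
      (\<forall>a\<in>\<A>. emeasure lborel a \<noteq> \<infinity>)" ..
    then show "\<exists>A. countable A \<and> A \<subseteq> sets (lebesgue :: real measure) \<and> \<Union> A = space lebesgue \<and>
        (\<forall>a\<in>A. emeasure lebesgue a \<noteq> \<infinity>)"
      by (intro exI[of _ \<A>] conjI ballI) (auto dest: subsetD)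
  qed
next
  \<comment> \<open>The complement step of the Dynkin argument needs the integral over the whole
    line; bounded support makes it an interval integral.\<close>
  have total: "(LINT x|lebesgue. f x) = 0"
  proof -
    have "indicator {c<..<d} x *\<^sub>R f x = f x" for x
      using supp[of x] by (simp split: split_indicator)
    then show ?thesis using null[of c d] by simp
  qed
  have borel_case: "set_lebesgue_integral lebesgue A f = 0" if "A \<in> sets borel" for A
  proof -
  note that
  moreover have "sets (borel :: real measure) = sigma_sets UNIV (range (\<lambda>(p, q). {p<..<q}))"
  proof -
    have "box = (\<lambda>p q. {p<..<q::real})" by (intro ext) (simp add: box_real)
    then show ?thesis by (subst borel_eq_box) simp
  qed
  ultimately have "A \<in> sigma_sets UNIV (range (\<lambda>(p, q). {p<..<q}))"
    by simp
  then have "A \<in> sets borel \<and> set_lebesgue_integral lebesgue A f = 0"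
  proof (rule sigma_sets_induct_disjoint[rotated 2])
    show "Int_stable (range (\<lambda>(p, q). {p<..<q::real}))"
      by (auto simp: Int_stable_def image_iff Int_greaterThanLessThan)
    fix A :: "real set" assume "A \<in> range (\<lambda>(p, q). {p<..<q})"
    then show "A \<in> sets borel \<and> set_lebesgue_integral lebesgue A f = 0"
      using null by (auto simp: set_lebesgue_integral_def)
  next
    show "{} \<in> sets borel \<and> set_lebesgue_integral lebesgue {} f = 0"
      by (simp add: set_lebesgue_integral_def)
  next
    fix A assume A: "A \<in> sets borel \<and> set_lebesgue_integral lebesgue A f = 0"
    have *: "indicator (UNIV - A) x *\<^sub>R f x = f x - indicator A x *\<^sub>R f x" for x
      by (simp split: split_indicator)
    have "set_lebesgue_integral lebesgue (UNIV - A) f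
        = (LINT x|lebesgue. f x) - (LINT x|lebesgue. indicator A x *\<^sub>R f x)"
      unfolding set_lebesgue_integral_def * using A f
      by (intro Bochner_Integration.integral_diff integrable_mult_indicator) auto
    then show "UNIV - A \<in> sets borel \<and> set_lebesgue_integral lebesgue (UNIV - A) f = 0"
      using A total by (auto simp: set_lebesgue_integral_def)
  next
    fix A :: "nat \<Rightarrow> real set"
    assume A: "disjoint_family A" "range A \<subseteq> sigma_sets UNIV (range (\<lambda>(p, q). {p<..<q}))"
      "\<And>i. A i \<in> sets borel \<and> set_lebesgue_integral lebesgue (A i) f = 0"
    have "set_lebesgue_integral lebesgue (\<Union>i. A i) f = (\<Sum>i. set_lebesgue_integral lebesgue (A i) f)"
    proof (rule lebesgue_integral_countable_add)
      have "integrable lebesgue (\<lambda>x. indicator (\<Union>i. A i) x *\<^sub>R f x)"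
        using A f by (intro integrable_mult_indicator) auto
      then show "set_integrable lebesgue (\<Union>i. A i) f" by (simp add: set_integrable_def)
    qed (use A in \<open>auto simp: disjoint_family_on_def\<close>)
    then show "(\<Union>i. A i) \<in> sets borel \<and> set_lebesgue_integral lebesgue (\<Union>i. A i) f = 0"
      using A by auto
  qed auto
  then show "set_lebesgue_integral lebesgue A f = 0" by simp
  qed
  fix A :: "real set" assume A: "A \<in> sets lebesgue"
  then obtain S N N' where S: "A = S \<union> N" "N \<subseteq> N'" "N' \<in> null_sets lborel" "S \<in> sets lborel"
    by (rule sets_completionE)
  have "AE x in lebesgue. x \<notin> N'"
    by (intro AE_completion AE_not_in S(3))
  then have "AE x in lebesgue. indicator A x *\<^sub>R f x = indicator S x *\<^sub>R f x"
    by eventually_elim (use S in \<open>auto simp: indicator_def\<close>)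
  then have "set_lebesgue_integral lebesgue A f = set_lebesgue_integral lebesgue S f"
    unfolding set_lebesgue_integral_def using S A f
    by (intro integral_cong_AE borel_measurable_scaleR borel_measurable_indicator) auto
  then show "set_lebesgue_integral lebesgue A f = 0"
    using borel_case S by simp
qed

section \<open>The lemma of du Bois-Reymond\<close>

text \<open>End points are null. This allows passing between Bochner integrals on the open interval,
  where Sobolev notions live, and gauge integrals on the closed one, where the fundamental theorem
  of calculus is stated.\<close>

lemma integrable_Ioo_iff:
  fixes f :: "real \<Rightarrow> 'b::euclidean_space"
  shows "integrable (lebesgue_on {c<..<d}) f \<longleftrightarrow> f absolutely_integrable_on {c..d}"
  unfolding absolutely_integrable_on_Icc_iff_Ioo
  by (simp add: set_integrable_def integrable_restrict_space)

lemma LINT_Ioo_eq_integral: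
  fixes f :: "real \<Rightarrow> 'b::euclidean_space"
  assumes "integrable (lebesgue_on {c<..<d}) f"
  shows "(LINT x|lebesgue_on {c<..<d}. f x) = integral {c..d} f"
  using lebesgue_integral_eq_integral[OF assms] integral_open_interval_real[of c d f] by simp

lemma integrable_Ioo_continuous:
  fixes f :: "real \<Rightarrow> 'b::euclidean_space"
  assumes "continuous_on {c..d} f"
  shows "integrable (lebesgue_on {c<..<d}) f"
  by (simp add: assms integrable_Ioo_iff absolutely_integrable_continuous_real)

lemma borel_measurable_Ioo_continuous:
  fixes f :: "real \<Rightarrow> 'b::{second_countable_topology, t2_space, topological_space}"
  assumes "continuous_on {c..d} f"
  shows "f \<in> borel_measurable (lebesgue_on {c<..<d})"
  by (rule continuous_imp_measurable_on_sets_lebesgue)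
    (auto intro: continuous_on_subset[OF assms])

lemma continuous_Icc_bounded:
  fixes f :: "real \<Rightarrow> complex"
  assumes "continuous_on {c..d} f"
  obtains B where "B > 0" "\<And>x. x \<in> {c..d} \<Longrightarrow> cmod (f x) \<le> B"
  using compact_imp_bounded[OF compact_continuous_image[OF assms compact_Icc]]
  unfolding bounded_pos by (meson imageI)

lemma integrable_Ioo_mult_continuous:
  fixes f h :: "real \<Rightarrow> complex"
  assumes f: "integrable (lebesgue_on {c<..<d}) f" and h: "continuous_on {c..d} h"
  shows "integrable (lebesgue_on {c<..<d}) (\<lambda>x. h x * f x)"
proof -
  obtain B where B: "\<And>x. x \<in> {c..d} \<Longrightarrow> norm (h x) \<le> B"
    using continuous_Icc_bounded[OF h] by blast
  show ?thesis
  proof (rule Bochner_Integration.integrable_bound[where f = "\<lambda>x. complex_of_real B * f x"])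
    show "integrable (lebesgue_on {c<..<d}) (\<lambda>x. complex_of_real B * f x)"
      using f by simp
    show "(\<lambda>x. h x * f x) \<in> borel_measurable (lebesgue_on {c<..<d})"
      by (intro borel_measurable_times borel_measurable_Ioo_continuous h borel_measurable_integrable f)
    have "norm (h x * f x) \<le> norm (complex_of_real B * f x)" if "x \<in> {c<..<d}" for x
      using B[of x] that by (auto simp: norm_mult intro!: mult_right_mono)
    then show "AE x in lebesgue_on {c<..<d}. norm (h x * f x) \<le> norm (complex_of_real B * f x)"
      by (intro AE_I2) simp
  qed
qed

lemma integrable_Ioo_test_fun:
  fixes f :: "real \<Rightarrow> complex"
  assumes f: "integrable (lebesgue_on {c<..<d}) f" and \<eta>: "test_fun \<Omega> \<eta>"
  shows "integrable (lebesgue_on {c<..<d}) (\<lambda>x. \<eta> x *\<^sub>R f x)"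
  unfolding scaleR_conv_of_real using f
  by (rule integrable_Ioo_mult_continuous)
    (intro continuous_on_of_real smooth_continuous test_fun_smooth[OF \<eta>])

lemma integrable_Ioo_indicator:
  fixes g :: "real \<Rightarrow> complex"
  assumes g: "integrable (lebesgue_on {c<..<d}) g" and A: "A \<in> sets borel"
  shows "integrable (lebesgue_on {c<..<d}) (\<lambda>y. indicator A y *\<^sub>R g y)"
proof -
  have "A \<inter> {c<..<d} \<in> sets (lebesgue_on {c<..<d})"
    using A by (auto simp: sets_restrict_space)
  then have "integrable (lebesgue_on {c<..<d}) (\<lambda>y. indicator (A \<inter> {c<..<d}) y *\<^sub>R g y)"
    using g by (rule integrable_mult_indicator)
  then show ?thesis
    by (rule Bochner_Integration.integrable_cong[THEN iffD1, rotated 2]) (auto simp: indicator_def)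
qed

lemma integral_upto_eq_LINT:
  fixes g :: "real \<Rightarrow> complex"
  assumes g: "integrable (lebesgue_on {c<..<d}) g" and x: "x \<in> {c..d}"
  shows "integral {c..x} g = (LINT y|lebesgue_on {c<..<d}. indicator {..<x} y *\<^sub>R g y)"
proof -
  have "integrable (lebesgue_on {c<..<d}) (\<lambda>y. indicator {..<x} y *\<^sub>R g y)"
    using g by (rule integrable_Ioo_indicator) simp
  then have "(LINT y|lebesgue_on {c<..<d}. indicator {..<x} y *\<^sub>R g y)
      = integral {c..d} (\<lambda>y. indicator {..<x} y *\<^sub>R g y)"
    by (rule LINT_Ioo_eq_integral)
  also have "\<dots> = integral {c..d} (\<lambda>y. if y \<in> {..x} then g y else 0)"
    by (rule integral_spike[of "{x}"]) (auto simp: indicator_def)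
  also have "\<dots> = integral ({..x} \<inter> {c..d}) g"
    by (rule Henstock_Kurzweil_Integration.integral_restrict_Int)
  also have "{..x} \<inter> {c..d} = {c..x}" using x by auto
  finally show ?thesis by simp
qed

lemma integral_from_eq_LINT:
  fixes g :: "real \<Rightarrow> complex"
  assumes g: "integrable (lebesgue_on {c<..<d}) g" and x: "x \<in> {c..d}"
  shows "integral {x..d} g = (LINT y|lebesgue_on {c<..<d}. indicator {x<..} y *\<^sub>R g y)"
proof -
  have "integrable (lebesgue_on {c<..<d}) (\<lambda>y. indicator {x<..} y *\<^sub>R g y)"
    using g by (rule integrable_Ioo_indicator) simp
  then have "(LINT y|lebesgue_on {c<..<d}. indicator {x<..} y *\<^sub>R g y)
      = integral {c..d} (\<lambda>y. indicator {x<..} y *\<^sub>R g y)"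
    by (rule LINT_Ioo_eq_integral)
  also have "\<dots> = integral {c..d} (\<lambda>y. if y \<in> {x..} then g y else 0)"
    by (rule integral_spike[of "{x}"]) (auto simp: indicator_def)
  also have "\<dots> = integral ({x..} \<inter> {c..d}) g"
    by (rule Henstock_Kurzweil_Integration.integral_restrict_Int)
  also have "{x..} \<inter> {c..d} = {x..d}" using x by auto
  finally show ?thesis by simp
qed

lemma integrable_Ioo_integrable_on:
  fixes g :: "real \<Rightarrow> complex"
  shows "integrable (lebesgue_on {c<..<d}) g \<Longrightarrow> g integrable_on {c..d}"
  by (simp add: integrable_Ioo_iff set_lebesgue_integral_eq_integral(1))

text \<open>Fubini on a triangle: both sides integrate g(y) h(x) over y < x. All integrations by
  parts against merely integrable functions rest on this.\<close>

lemma integral_primitive_swap: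
  fixes g h :: "real \<Rightarrow> complex"
  assumes g: "integrable (lebesgue_on {c<..<d}) g" and h: "integrable (lebesgue_on {c<..<d}) h"
  shows "(LINT x|lebesgue_on {c<..<d}. integral {c..x} g * h x) =
    (LINT y|lebesgue_on {c<..<d}. g y * integral {y..d} h)"
proof -
  let ?M = "lebesgue_on {c<..<d}"
  interpret finite_measure ?M by (rule finite_measure_lebesgue_on) simp
  interpret pair_sigma_finite ?M ?M ..
  have id: "(\<lambda>x. x) \<in> borel_measurable ?M"
    using id_borel_measurable_lebesgue_on[of "{c<..<d}"] by (simp add: id_def)
  have [measurable]: "g \<in> borel_measurable ?M" "h \<in> borel_measurable ?M"
    using g h by auto
  have [measurable]: "(\<lambda>p. fst p) \<in> borel_measurable (?M \<Otimes>\<^sub>M ?M)" "(\<lambda>p. snd p) \<in> borel_measurable (?M \<Otimes>\<^sub>M ?M)"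
    using measurable_compose[OF measurable_fst id] measurable_compose[OF measurable_snd id] by auto
  define A where "A = {p \<in> space (?M \<Otimes>\<^sub>M ?M). snd p < fst p}"
  have A: "A \<in> sets (?M \<Otimes>\<^sub>M ?M)" unfolding A_def by measurable
  have "integrable (?M \<Otimes>\<^sub>M ?M) (\<lambda>p. g (snd p) * h (fst p))"
  proof (rule Fubini_integrable)
    show "integrable ?M (\<lambda>x. LINT y|?M. norm (g (snd (x, y)) * h (fst (x, y))))"
      using h by (simp add: norm_mult)
    show "AE x in ?M. integrable ?M (\<lambda>y. g (snd (x, y)) * h (fst (x, y)))"
      using g by simp
  qed measurable
  then have "integrable (?M \<Otimes>\<^sub>M ?M) (\<lambda>p. indicator A p *\<^sub>R (g (snd p) * h (fst p)))"
    by (rule integrable_mult_indicator[OF A])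
  then have swap: "(LINT y|?M. LINT x|?M. indicator A (x, y) *\<^sub>R (g y * h x)) =
      (LINT x|?M. LINT y|?M. indicator A (x, y) *\<^sub>R (g y * h x))"
    by (intro Fubini_integral[where f = "\<lambda>x y. indicator A (x, y) *\<^sub>R (g y * h x)"])
      (simp add: case_prod_unfold)
  have inner1: "(LINT y|?M. indicator A (x, y) *\<^sub>R (g y * h x)) = integral {c..x} g * h x"
    if x: "x \<in> {c<..<d}" for x
  proof -
    have "(LINT y|?M. indicator A (x, y) *\<^sub>R (g y * h x)) =
        (LINT y|?M. (indicator {..<x} y *\<^sub>R g y) * h x)"
      by (rule Bochner_Integration.integral_cong)
        (use x in \<open>auto simp: A_def space_pair_measure indicator_def\<close>)
    also have "\<dots> = (LINT y|?M. (indicator {..<x} y *\<^sub>R g y)) * h x"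
      by (rule integral_mult_left_zero)
    finally show ?thesis using integral_upto_eq_LINT[OF g, of x] x by simp
  qed
  have inner2: "(LINT x|?M. indicator A (x, y) *\<^sub>R (g y * h x)) = g y * integral {y..d} h"
    if y: "y \<in> {c<..<d}" for y
  proof -
    have "(LINT x|?M. indicator A (x, y) *\<^sub>R (g y * h x)) =
        (LINT x|?M. g y * (indicator {y<..} x *\<^sub>R h x))"
      by (rule Bochner_Integration.integral_cong)
        (use y in \<open>auto simp: A_def space_pair_measure indicator_def\<close>)
    also have "\<dots> = g y * (LINT x|?M. (indicator {y<..} x *\<^sub>R h x))"
      by (rule integral_mult_right_zero)
    finally show ?thesis using integral_from_eq_LINT[OF h, of y] y by simp
  qed
  have "(LINT x|?M. integral {c..x} g * h x) = (LINT x|?M. LINT y|?M. indicator A (x, y) *\<^sub>R (g y * h x))"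
    by (rule Bochner_Integration.integral_cong[OF refl inner1[symmetric]]) simp
  also have "\<dots> = (LINT y|?M. g y * integral {y..d} h)"
    unfolding swap[symmetric] by (rule Bochner_Integration.integral_cong[OF refl inner2]) simp
  finally show ?thesis .
qed

text \<open>Plateaus converge pointwise to indicators and are bounded by 1, so dominated convergence
  with majorant |f| passes from test functions to intervals.\<close>

lemma AE_null_if_test_null:
  fixes f :: "real \<Rightarrow> complex"
  assumes f: "integrable (lebesgue_on {c<..<d}) f"
    and null: "\<And>\<eta>. test_fun {c<..<d} \<eta> \<Longrightarrow> (LINT x|lebesgue_on {c<..<d}. \<eta> x *\<^sub>R f x) = 0"
  shows "AE x in lebesgue_on {c<..<d}. f x = 0"
proof -
  let ?M = "lebesgue_on {c<..<d}"
  define F where "F x = indicator {c<..<d} x *\<^sub>R f x" for x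
  have F: "integrable lebesgue F"
    using f by (simp add: integrable_restrict_space F_def[abs_def])
  have "AE x in lebesgue. F x = 0"
  proof (rule interval_null_imp_AE_null[OF F])
    show "F x = 0" if "x \<notin> {c<..<d}" for x using that by (simp add: F_def)
    fix p q
    \<comment> \<open>The interval is cut down to \<open>{c<..<d}\<close> so that its plateaus are
      admissible test functions.\<close>
    define p' q' where "p' = max p c" and "q' = min q d"
    have sub: "{p'<..<q'} \<subseteq> {c<..<d}" by (auto simp: p'_def q'_def)
    have "(\<lambda>n. LINT x|?M. plateau p' q' (Suc n) x *\<^sub>R f x) \<longlonglongrightarrow>
        (LINT x|?M. indicator {p'<..<q'} x *\<^sub>R f x)"
    proof (rule integral_dominated_convergence[where w = "\<lambda>x. norm (f x)"])
      show "(\<lambda>x. plateau p' q' (Suc n) x *\<^sub>R f x) \<in> borel_measurable ?M" for n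
        using integrable_Ioo_test_fun[OF f test_fun_plateau[of "Suc n" p' q']] by auto
      show "(\<lambda>x. indicator {p'<..<q'} x *\<^sub>R f x) \<in> borel_measurable ?M"
        by (intro borel_measurable_integrable integrable_Ioo_indicator f) simp
      show "AE x in ?M. (\<lambda>n. plateau p' q' (Suc n) x *\<^sub>R f x) \<longlonglongrightarrow> indicator {p'<..<q'} x *\<^sub>R f x"
        by (intro AE_I2 tendsto_scaleR tendsto_const LIMSEQ_Suc[OF plateau_tendsto])
      show "AE x in ?M. norm (plateau p' q' (Suc n) x *\<^sub>R f x) \<le> norm (f x)" for n
        by (intro AE_I2) (simp add: plateau_bounds mult_left_le_one_le)
    qed (use f in auto)
    moreover have "(LINT x|?M. plateau p' q' (Suc n) x *\<^sub>R f x) = 0" for n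
      by (rule null[OF test_fun_mono[OF test_fun_plateau sub]]) simp
    ultimately have "(LINT x|?M. indicator {p'<..<q'} x *\<^sub>R f x) = 0"
      using LIMSEQ_unique[OF _ tendsto_const] by fastforce
    also have "(LINT x|?M. indicator {p'<..<q'} x *\<^sub>R f x) =
        (LINT x|lebesgue. indicator {c<..<d} x *\<^sub>R (indicator {p'<..<q'} x *\<^sub>R f x))"
      by (rule integral_restrict_space) simp
    also have "\<dots> = (LINT x|lebesgue. indicator {p<..<q} x *\<^sub>R F x)"
      by (rule Bochner_Integration.integral_cong)
        (auto simp: F_def indicator_def p'_def q'_def)
    finally show "(LINT x|lebesgue. indicator {p<..<q} x *\<^sub>R F x) = 0" .
  qed
  then show ?thesis
    by (simp add: AE_restrict_space_iff F_def) (auto elim: eventually_mono)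
qed

lemma compact_subset_Ioo:
  fixes K :: "real set"
  assumes K: "compact K" "K \<subseteq> {c<..<d}" and "c < d"
  obtains s t where "c < s" "s < t" "t < d" "K \<subseteq> {s<..<t}"
proof (cases "K = {}")
  case True
  show ?thesis
    by (rule that[of "c + (d - c) / 3" "d - (d - c) / 3"]) (use True \<open>c < d\<close> in \<open>auto simp: field_simps\<close>)
next
  case False
  obtain i where i: "i \<in> K" "\<And>x. x \<in> K \<Longrightarrow> i \<le> x"
    using compact_attains_inf[OF K(1) False] by blast
  obtain j where j: "j \<in> K" "\<And>x. x \<in> K \<Longrightarrow> x \<le> j"
    using compact_attains_sup[OF K(1) False] by blast
  have "c < i" "i \<le> j" "j < d" using i j K(2) by auto
  show ?thesis
  proof (rule that[of "(c + i) / 2" "(j + d) / 2"])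
    show "K \<subseteq> {(c + i) / 2<..<(j + d) / 2}"
    proof
      fix x assume "x \<in> K"
      from i(2)[OF this] j(2)[OF this] show "x \<in> {(c + i) / 2<..<(j + d) / 2}"
        using \<open>c < i\<close> \<open>j < d\<close> by simp
    qed
  qed (use \<open>c < i\<close> \<open>i \<le> j\<close> \<open>j < d\<close> in auto)
qed

text \<open>A primitive is constant to the left and to the right of the support of
  \<open>\<rho>\<close>. Mean zero says that the two constants agree, and subtracting their common
  value gives compact support.\<close>

lemma test_fun_mean_zero_primitive:
  assumes \<rho>: "test_fun {c<..<d} \<rho>" and "c < d" and zero: "integral {c..d} \<rho> = 0"
  obtains \<eta> where "test_fun {c<..<d} \<eta>" "deriv \<eta> = \<rho>"
proof -
  obtain K where K: "compact K" "K \<subseteq> {c<..<d}" "\<And>x. x \<notin> K \<Longrightarrow> \<rho> x = 0"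
    using test_fun_support[OF \<rho>] by blast
  obtain s t where st: "c < s" "s < t" "t < d" "K \<subseteq> {s<..<t}"
    using compact_subset_Ioo[OF K(1,2) \<open>c < d\<close>] by blast
  have "\<exists>F. \<forall>x::real. -\<infinity> < ereal x \<longrightarrow> ereal x < \<infinity> \<longrightarrow> (F has_vector_derivative \<rho> x) (at x)"
    by (rule einterval_antiderivative)
      (use smooth_continuous[OF test_fun_smooth[OF \<rho>], of UNIV] in \<open>auto simp: continuous_on_eq_continuous_at\<close>)
  then obtain F where F0: "\<forall>x::real. -\<infinity> < ereal x \<longrightarrow> ereal x < \<infinity> \<longrightarrow> (F has_vector_derivative \<rho> x) (at x)" ..
  have F: "(F has_real_derivative \<rho> x) (at x)" for x
    using F0 by (simp add: has_real_derivative_iff_has_vector_derivative)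
  have low: "F x = F c" if "x \<le> s" for x
  proof -
    have "\<exists>k. \<forall>x\<in>{..s}. F x = k"
    proof (rule has_field_derivative_zero_constant)
      fix x assume "x \<in> {..s}"
      then have "x \<notin> {s<..<t}" by simp
      then have "\<rho> x = 0" using K(3) st(4) by blast
      then show "(F has_field_derivative 0) (at x within {..s})"
        using has_field_derivative_at_within[OF F[of x]] by simp
    qed simp
    then show ?thesis using that st by auto
  qed
  have high: "F x = F d" if "x \<ge> t" for x
  proof -
    have "\<exists>k. \<forall>x\<in>{t..}. F x = k"
    proof (rule has_field_derivative_zero_constant)
      fix x assume "x \<in> {t..}"
      then have "x \<notin> {s<..<t}" by simp
      then have "\<rho> x = 0" using K(3) st(4) by blast
      then show "(F has_field_derivative 0) (at x within {t..})"
        using has_field_derivative_at_within[OF F[of x]] by simp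
    qed simp
    then show ?thesis using that st by auto
  qed
  have "(\<rho> has_integral (F d - F c)) {c..d}"
  proof (rule fundamental_theorem_of_calculus)
    show "(F has_vector_derivative \<rho> x) (at x within {c..d})" for x
      using has_vector_derivative_at_within[OF F[of x, unfolded has_real_derivative_iff_has_vector_derivative]] .
  qed (use \<open>c < d\<close> in simp)
  then have cd: "F d = F c" using zero by (simp add: has_integral_iff)
  have D: "((\<lambda>x. F x - F c) has_real_derivative \<rho> x) (at x)" for x
    using F by (auto intro!: derivative_eq_intros)
  show ?thesis
  proof
    show "test_fun {c<..<d} (\<lambda>x. F x - F c)"
    proof (rule test_funI[of _ "{s..t}"])
      show "smooth (\<lambda>x. F x - F c)"
        using D test_fun_smooth[OF \<rho>] by (rule smooth_primitive)
      show "F x - F c = 0" if "x \<notin> {s..t}" for x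
        using low[of x] high[of x] cd that by (cases "x \<le> s") auto
    qed (use st in auto)
    show "deriv (\<lambda>x. F x - F c) = \<rho>"
      using D by (intro ext DERIV_imp_deriv)
  qed
qed

lemma exists_test_fun_mean_one:
  assumes "c < d"
  obtains \<psi> where "test_fun {c<..<d} \<psi>" "integral {c..d} \<psi> = 1"
proof -
  \<comment> \<open>At the midpoint both arguments of the cutoff equal n (d - c) / 2 - 1, which is
    then at least 1/2, so the plateau is positive there.\<close>
  obtain n where n: "real n > 3 / (d - c)" using reals_Archimedean2 by blast
  have "3 / (d - c) > 0" using assms by simp
  with n have n0: "n > 0" by (cases n) auto
  note test = test_fun_plateau[OF n0, of c d]
  have cont: "continuous_on {c..d} (plateau c d n)"
    by (intro smooth_continuous test_fun_smooth[OF test])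
  have "integral {c..d} (plateau c d n) \<noteq> 0"
  proof
    assume "integral {c..d} (plateau c d n) = 0"
    then have "plateau c d n ((c + d) / 2) = 0"
      using integral_eq_0_iff[OF cont assms] plateau_bounds assms by auto
    moreover have "real n * ((c + d) / 2 - c) - 1 > 0" "real n * (d - (c + d) / 2) - 1 > 0"
      using n assms by (auto simp: field_simps)
    ultimately show False by (simp add: plateau_def exp_flat_def)
  qed
  moreover have "integral {c..d} (\<lambda>x. inverse (integral {c..d} (plateau c d n)) * plateau c d n x) =
     inverse (integral {c..d} (plateau c d n)) * integral {c..d} (plateau c d n)"
    by simp
  ultimately show ?thesis
    by (intro that[of "\<lambda>x. inverse (integral {c..d} (plateau c d n)) * plateau c d n x"]
        test_fun_scale[OF test]) simp
qed

lemma test_fun_primitive_parts: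
  fixes g :: "real \<Rightarrow> complex"
  assumes g: "integrable (lebesgue_on {c<..<d}) g" and \<eta>: "test_fun {c<..<d} \<eta>"
  shows "(LINT x|lebesgue_on {c<..<d}. deriv \<eta> x *\<^sub>R integral {c..x} g) =
    - (LINT x|lebesgue_on {c<..<d}. \<eta> x *\<^sub>R g x)"
proof -
  let ?M = "lebesgue_on {c<..<d}"
  have cont: "continuous_on {c..d} (\<lambda>x. complex_of_real (deriv \<eta> x))"
    by (intro continuous_on_of_real smooth_continuous test_fun_smooth[OF test_fun_deriv[OF \<eta>]])
  have inner: "integral {y..d} (\<lambda>x. complex_of_real (deriv \<eta> x)) = - complex_of_real (\<eta> y)"
    if "y \<in> {c<..<d}" for y
  proof -
    have "((\<lambda>x. complex_of_real (deriv \<eta> x)) has_integral (complex_of_real (\<eta> d) - complex_of_real (\<eta> y))) {y..d}"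
    proof (rule fundamental_theorem_of_calculus)
      show "((\<lambda>x. complex_of_real (\<eta> x)) has_vector_derivative complex_of_real (deriv \<eta> x)) (at x within {y..d})" for x
        by (rule has_vector_derivative_at_within[OF has_vector_derivative_of_real[OF test_fun_DERIV[OF \<eta>]]])
    qed (use that in simp)
    moreover have "\<eta> d = 0" using test_fun_outside[OF \<eta>, of d] by simp
    ultimately show ?thesis by (simp add: has_integral_iff)
  qed
  have "(LINT x|?M. deriv \<eta> x *\<^sub>R integral {c..x} g) = (LINT x|?M. integral {c..x} g * complex_of_real (deriv \<eta> x))"
    by (simp add: scaleR_conv_of_real mult.commute)
  also have "\<dots> = (LINT y|?M. g y * integral {y..d} (\<lambda>x. complex_of_real (deriv \<eta> x)))"
    by (rule integral_primitive_swap[OF g integrable_Ioo_continuous[OF cont]])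
  also have "\<dots> = (LINT y|?M. - (\<eta> y *\<^sub>R g y))"
    by (rule Bochner_Integration.integral_cong) (simp_all add: inner scaleR_conv_of_real)
  finally show ?thesis by simp
qed

text \<open>The difference \<open>q\<close> of \<open>f\<close> and the primitive of
  \<open>g\<close> integrates to zero against every derivative of a test function. Subtracting from
  a test function its mean times a fixed \<open>\<psi>0\<close> of mean one turns it into such a
  derivative, which identifies \<open>q\<close> with the constant given by its pairing with
  \<open>\<psi>0\<close>.\<close>

lemma du_Bois_Reymond:
  fixes f g :: "real \<Rightarrow> complex"
  assumes "c < d" and f: "integrable (lebesgue_on {c<..<d}) f" and g: "integrable (lebesgue_on {c<..<d}) g"
    and weak: "\<And>\<eta>. test_fun {c<..<d} \<eta> \<Longrightarrow>
      (LINT x|lebesgue_on {c<..<d}. deriv \<eta> x *\<^sub>R f x) = - (LINT x|lebesgue_on {c<..<d}. \<eta> x *\<^sub>R g x)"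
  shows "\<exists>C. AE x in lebesgue_on {c<..<d}. f x = C + integral {c..x} g"
proof -
  let ?M = "lebesgue_on {c<..<d}"
  define P where "P x = integral {c..x} g" for x
  have P: "continuous_on {c..d} P"
    unfolding P_def using g by (intro indefinite_integral_continuous_1 integrable_Ioo_integrable_on)
  have Pint: "integrable ?M P" using P by (rule integrable_Ioo_continuous)
  have parts: "(LINT x|?M. deriv \<eta> x *\<^sub>R P x) = - (LINT x|?M. \<eta> x *\<^sub>R g x)"
    if \<eta>: "test_fun {c<..<d} \<eta>" for \<eta>
    unfolding P_def by (rule test_fun_primitive_parts[OF g \<eta>])
  define q where "q x = f x - P x" for x
  have q: "integrable ?M q" unfolding q_def using f Pint by simp
  have qnull: "(LINT x|?M. deriv \<eta> x *\<^sub>R q x) = 0" if \<eta>: "test_fun {c<..<d} \<eta>" for \<eta>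
    using weak[OF \<eta>] parts[OF \<eta>] integrable_Ioo_test_fun[OF f test_fun_deriv[OF \<eta>]]
      integrable_Ioo_test_fun[OF Pint test_fun_deriv[OF \<eta>]]
    by (simp add: q_def scaleR_diff_right)
  obtain \<psi>0 where \<psi>0: "test_fun {c<..<d} \<psi>0" "integral {c..d} \<psi>0 = 1"
    by (rule exists_test_fun_mean_one[OF \<open>c < d\<close>])
  define C where "C = (LINT x|?M. \<psi>0 x *\<^sub>R q x)"
  have "AE x in ?M. q x - C = 0"
  proof (rule AE_null_if_test_null)
    show "integrable ?M (\<lambda>x. q x - C)"
      by (rule Bochner_Integration.integrable_diff[OF q integrable_Ioo_continuous[OF continuous_on_const]])
    fix \<psi> assume \<psi>: "test_fun {c<..<d} \<psi>"
    define I where "I = integral {c..d} \<psi>"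
    have int: "\<psi> integrable_on {c..d}" "\<psi>0 integrable_on {c..d}"
      using \<psi> \<psi>0 by (auto intro!: integrable_continuous_interval smooth_continuous intro: test_fun_smooth)
    have \<rho>: "test_fun {c<..<d} (\<lambda>x. \<psi> x + (- I) * \<psi>0 x)"
      by (intro test_fun_add test_fun_scale \<psi> \<psi>0)
    have "integral {c..d} (\<lambda>x. \<psi> x + (- I) * \<psi>0 x) = integral {c..d} \<psi> + integral {c..d} (\<lambda>x. (- I) * \<psi>0 x)"
      using int by (intro Henstock_Kurzweil_Integration.integral_add integrable_on_mult_right)
    also have "\<dots> = 0" using \<psi>0 by (simp add: I_def)
    finally obtain \<eta> where \<eta>: "test_fun {c<..<d} \<eta>" "deriv \<eta> = (\<lambda>x. \<psi> x + (- I) * \<psi>0 x)"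
      using test_fun_mean_zero_primitive[OF \<rho> \<open>c < d\<close>] by blast
    note i1 = integrable_Ioo_test_fun[OF q \<psi>] and i2 = integrable_Ioo_test_fun[OF q \<psi>0(1)]
    have "0 = (LINT x|?M. (\<psi> x + (- I) * \<psi>0 x) *\<^sub>R q x)"
      using qnull[OF \<eta>(1)] \<eta>(2) by simp
    also have "\<dots> = (LINT x|?M. \<psi> x *\<^sub>R q x) - I *\<^sub>R C"
    proof -
      have "(LINT x|?M. (\<psi> x + (- I) * \<psi>0 x) *\<^sub>R q x) = (LINT x|?M. \<psi> x *\<^sub>R q x - I *\<^sub>R (\<psi>0 x *\<^sub>R q x))"
        by (rule Bochner_Integration.integral_cong) (simp_all add: algebra_simps)
      also have "\<dots> = (LINT x|?M. \<psi> x *\<^sub>R q x) - (LINT x|?M. I *\<^sub>R (\<psi>0 x *\<^sub>R q x))"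
        by (intro Bochner_Integration.integral_diff integrable_scaleR_right i1 i2)
      finally show ?thesis unfolding C_def integral_scaleR_right .
    qed
    finally have 1: "(LINT x|?M. \<psi> x *\<^sub>R q x) = I *\<^sub>R C" by simp
    have ic: "integrable ?M (\<lambda>x. \<psi> x *\<^sub>R C)"
      by (rule integrable_Ioo_test_fun[OF _ \<psi>]) (intro integrable_Ioo_continuous continuous_on_const)
    have "(LINT x|?M. \<psi> x *\<^sub>R C) = integral {c..d} (\<lambda>x. \<psi> x *\<^sub>R C)"
      by (rule LINT_Ioo_eq_integral[OF ic])
    also have "\<dots> = I *\<^sub>R C"
      unfolding I_def using has_integral_scaleR_left[OF integrable_integral[OF int(1)], of C] by blast
    finally have 2: "(LINT x|?M. \<psi> x *\<^sub>R C) = I *\<^sub>R C" .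
    have "(LINT x|?M. \<psi> x *\<^sub>R (q x - C)) = (LINT x|?M. \<psi> x *\<^sub>R q x) - (LINT x|?M. \<psi> x *\<^sub>R C)"
      unfolding scaleR_diff_right by (rule Bochner_Integration.integral_diff[OF i1 ic])
    then show "(LINT x|?M. \<psi> x *\<^sub>R (q x - C)) = 0" using 1 2 by simp
  qed
  then have "AE x in ?M. f x = C + integral {c..x} g"
    by eventually_elim (simp add: q_def P_def algebra_simps)
  then show ?thesis ..
qed

section \<open>The space of square integrable functions\<close>

lemma L2_measurable: "f \<in> L2 S \<Longrightarrow> f \<in> borel_measurable (lebesgue_on S)"
  and L2_square_integrable: "f \<in> L2 S \<Longrightarrow> integrable (lebesgue_on S) (\<lambda>x. (cmod (f x))\<^sup>2)"
  by (auto simp: L2_def)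

lemma L2_dominated:
  assumes "f \<in> L2 S" "g \<in> borel_measurable (lebesgue_on S)"
    and "AE x in lebesgue_on S. cmod (g x) \<le> cmod (f x)"
  shows "g \<in> L2 S" "L2_norm S g \<le> L2_norm S f"
proof -
  have le: "AE x in lebesgue_on S. (cmod (g x))\<^sup>2 \<le> (cmod (f x))\<^sup>2"
    using assms(3) by eventually_elim (simp add: power_mono)
  have "integrable (lebesgue_on S) (\<lambda>x. (cmod (g x))\<^sup>2)"
    by (rule Bochner_Integration.integrable_bound[OF L2_square_integrable[OF assms(1)]])
      (use assms(2) le in auto)
  then show "g \<in> L2 S" "L2_norm S g \<le> L2_norm S f"
    using assms le by (auto simp: L2_def L2_norm_def intro!: integral_mono_AE)
qed

lemma L2_norm_cong_AE:
  assumes "AE x in lebesgue_on S. g x = f x" "f \<in> borel_measurable (lebesgue_on S)" "g \<in> borel_measurable (lebesgue_on S)"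
  shows "L2_norm S g = L2_norm S f"
  unfolding L2_norm_def
  by (rule arg_cong[where f = sqrt], rule integral_cong_AE) (use assms in auto)

lemma L2_norm_nonneg: "0 \<le> L2_norm S f"
  by (simp add: L2_norm_def integral_nonneg_AE)

lemma L2_norm_power2: "(L2_norm S f)\<^sup>2 = (LINT x|lebesgue_on S. (cmod (f x))\<^sup>2)"
  by (simp add: L2_norm_def integral_nonneg_AE)

lemma L2_mult_integrable:
  assumes f: "f \<in> L2 S" and g: "g \<in> L2 S"
  shows "integrable (lebesgue_on S) (\<lambda>x. f x * g x)"
proof (rule Bochner_Integration.integrable_bound)
  show "integrable (lebesgue_on S) (\<lambda>x. (cmod (f x))\<^sup>2 + (cmod (g x))\<^sup>2)"
    using assms by (intro Bochner_Integration.integrable_add L2_square_integrable)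
  show "(\<lambda>x. f x * g x) \<in> borel_measurable (lebesgue_on S)"
    using assms by (intro borel_measurable_times L2_measurable)
  show "AE x in lebesgue_on S. norm (f x * g x) \<le> norm ((cmod (f x))\<^sup>2 + (cmod (g x))\<^sup>2)"
  proof (rule AE_I2)
    fix x
    have "cmod (f x) * cmod (g x) \<le> (cmod (f x))\<^sup>2 + (cmod (g x))\<^sup>2"
      using sum_squares_bound[of "cmod (f x)" "cmod (g x)"]
        mult_nonneg_nonneg[OF norm_ge_zero norm_ge_zero, of "f x" "g x"] by (simp only: mult.assoc)
    then show "norm (f x * g x) \<le> norm ((cmod (f x))\<^sup>2 + (cmod (g x))\<^sup>2)"
      by (simp add: norm_mult)
  qed
qed

lemma L2_cnj: "f \<in> L2 S \<Longrightarrow> (\<lambda>x. cnj (f x)) \<in> L2 S"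
  by (rule L2_dominated[of f])
    (auto intro: L2_measurable borel_measurable_continuous_onI[THEN measurable_compose_rev] intro!: continuous_intros)

lemma L2_norm_cnj: "L2_norm S (\<lambda>x. cnj (f x)) = L2_norm S f"
  by (simp add: L2_norm_def)

lemma L2_inner_integrable:
  "f \<in> L2 S \<Longrightarrow> g \<in> L2 S \<Longrightarrow> integrable (lebesgue_on S) (\<lambda>x. f x * cnj (g x))"
  by (intro L2_mult_integrable L2_cnj)

lemma L2_scale: "f \<in> L2 S \<Longrightarrow> (\<lambda>x. c * f x) \<in> L2 S"
  by (auto simp: L2_def norm_mult power_mult_distrib)

lemma L2_norm_scale: "L2_norm S (\<lambda>x. c * f x) = cmod c * L2_norm S f"
  by (simp add: L2_norm_def norm_mult power_mult_distrib real_sqrt_mult)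

lemma cmod_add_power2: "(cmod (z + w))\<^sup>2 = (cmod z)\<^sup>2 + (cmod w)\<^sup>2 + 2 * Re (z * cnj w)"
  unfolding cmod_power2 by (simp add: power2_eq_square algebra_simps)

lemma L2_add: assumes "f \<in> L2 S" "g \<in> L2 S" shows "(\<lambda>x. f x + g x) \<in> L2 S"
proof -
  have "integrable (lebesgue_on S) (\<lambda>x. (cmod (f x))\<^sup>2 + (cmod (g x))\<^sup>2 + 2 * Re (f x * cnj (g x)))"
    using assms
    by (intro Bochner_Integration.integrable_add L2_square_integrable integrable_mult_right
        integrable_Re L2_inner_integrable)
  then show ?thesis
    using assms unfolding cmod_add_power2[symmetric] by (auto simp: L2_def)
qed

lemma L2_minus: "f \<in> L2 S \<Longrightarrow> (\<lambda>x. - f x) \<in> L2 S"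
  using L2_scale[of f S "-1"] by simp

lemma L2_diff: "f \<in> L2 S \<Longrightarrow> g \<in> L2 S \<Longrightarrow> (\<lambda>x. f x - g x) \<in> L2 S"
  using L2_add[OF _ L2_minus, of f S g] by simp

lemma L2_norm_add_power2:
  assumes "f \<in> L2 S" "g \<in> L2 S"
  shows "(L2_norm S (\<lambda>x. f x + g x))\<^sup>2 = (L2_norm S f)\<^sup>2 + (L2_norm S g)\<^sup>2 + 2 * Re (L2_inner S f g)"
proof -
  have "(L2_norm S (\<lambda>x. f x + g x))\<^sup>2 =
      (LINT x|lebesgue_on S. (cmod (f x))\<^sup>2 + (cmod (g x))\<^sup>2 + 2 * Re (f x * cnj (g x)))"
    unfolding L2_norm_power2 cmod_add_power2 ..
  also have "\<dots> = (L2_norm S f)\<^sup>2 + (L2_norm S g)\<^sup>2 + 2 * Re (L2_inner S f g)"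
    using assms L2_square_integrable[of f S] L2_square_integrable[of g S] L2_inner_integrable[of f S g]
    by (simp add: L2_norm_power2 L2_inner_def del: times_complex.sel)
  finally show ?thesis .
qed

text \<open>Cauchy-Schwarz for the moduli, from the nonnegativity of the quadratic polynomial t |->
  || t |f| - |g| ||^2.\<close>

lemma L2_abs_mult_le:
  assumes f: "f \<in> L2 S" and g: "g \<in> L2 S"
  shows "(LINT x|lebesgue_on S. cmod (f x) * cmod (g x)) \<le> L2_norm S f * L2_norm S g"
proof -
  let ?I = "LINT x|lebesgue_on S. cmod (f x) * cmod (g x)"
  let ?F = "(L2_norm S f)\<^sup>2" and ?G = "(L2_norm S g)\<^sup>2"
  have int: "integrable (lebesgue_on S) (\<lambda>x. cmod (f x) * cmod (g x))"
    using integrable_norm[OF L2_mult_integrable[OF f g]] by (simp add: norm_mult)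
  have quad: "0 \<le> t\<^sup>2 * ?F - 2 * t * ?I + ?G" for t
  proof -
    have "0 \<le> (LINT x|lebesgue_on S. (t * cmod (f x) - cmod (g x))\<^sup>2)"
      by (simp add: integral_nonneg_AE)
    also have "\<dots> = (LINT x|lebesgue_on S. t\<^sup>2 * (cmod (f x))\<^sup>2 - 2 * t * (cmod (f x) * cmod (g x)) + (cmod (g x))\<^sup>2)"
      by (intro Bochner_Integration.integral_cong) (simp_all add: power2_eq_square algebra_simps)
    also have "\<dots> = t\<^sup>2 * ?F - 2 * t * ?I + ?G"
      using int L2_square_integrable[OF f] L2_square_integrable[OF g]
      by (simp add: L2_norm_power2)
    finally show ?thesis .
  qed
  have "?I\<^sup>2 \<le> ?F * ?G"
  proof (cases "?F = 0")
    case True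
    have "?I = 0"
    proof (rule ccontr)
      assume "?I \<noteq> 0"
      then show False
        \<comment> \<open>In the degenerate case the polynomial is affine in t, and this t gives it
          the value -1.\<close>
        using quad[of "(?G + 1) / (2 * ?I)"] True by (simp add: power2_eq_square)
    qed
    with True show ?thesis by simp
  next
    case False
    then have "0 \<le> ?F * ((?I / ?F)\<^sup>2 * ?F - 2 * (?I / ?F) * ?I + ?G)"
      using quad[of "?I / ?F"] by (intro mult_nonneg_nonneg) auto
    also have "\<dots> = ?F * ?G - ?I\<^sup>2"
      using False by (simp add: field_simps power2_eq_square)
    finally show ?thesis by simp
  qed
  then have "?I\<^sup>2 \<le> (L2_norm S f * L2_norm S g)\<^sup>2" by (simp add: power_mult_distrib)
  then show ?thesis
    by (rule power2_le_imp_le) (simp add: L2_norm_nonneg)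
qed

lemma L2_mult_le:
  assumes f: "f \<in> L2 S" and g: "g \<in> L2 S"
  shows "cmod (LINT x|lebesgue_on S. f x * g x) \<le> L2_norm S f * L2_norm S g"
proof -
  have "cmod (LINT x|lebesgue_on S. f x * g x) \<le> (LINT x|lebesgue_on S. cmod (f x * g x))"
    by (rule integral_norm_bound)
  also have "\<dots> \<le> L2_norm S f * L2_norm S g"
    using L2_abs_mult_le[OF f g] by (simp add: norm_mult)
  finally show ?thesis .
qed

lemma L2_inner_le:
  assumes f: "f \<in> L2 S" and g: "g \<in> L2 S"
  shows "cmod (L2_inner S f g) \<le> L2_norm S f * L2_norm S g"
  using L2_mult_le[OF f L2_cnj[OF g]] by (simp add: L2_inner_def L2_norm_cnj)

lemma L2_norm_triangle:
  assumes f: "f \<in> L2 S" and g: "g \<in> L2 S"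
  shows "L2_norm S (\<lambda>x. f x + g x) \<le> L2_norm S f + L2_norm S g"
proof (rule power2_le_imp_le)
  have "Re (L2_inner S f g) \<le> L2_norm S f * L2_norm S g"
    using L2_inner_le[OF f g] complex_Re_le_cmod order_trans by blast
  then show "(L2_norm S (\<lambda>x. f x + g x))\<^sup>2 \<le> (L2_norm S f + L2_norm S g)\<^sup>2"
    by (simp add: L2_norm_add_power2[OF f g] power2_sum)
qed (simp add: L2_norm_nonneg)

lemma L2_norm_minus: "L2_norm S (\<lambda>x. - f x) = L2_norm S f"
  by (simp add: L2_norm_def)

lemma L2_norm_triangle_le:
  assumes "f \<in> L2 S" "g \<in> L2 S"
  shows "L2_norm S f \<le> L2_norm S g + L2_norm S (\<lambda>x. f x - g x)"
  using L2_norm_triangle[OF assms(2) L2_diff[OF assms]] by simp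

lemma L2_inner_self: "f \<in> L2 S \<Longrightarrow> L2_inner S f f = complex_of_real ((L2_norm S f)\<^sup>2)"
  by (simp add: L2_inner_def L2_norm_power2 complex_norm_square[symmetric] flip: integral_complex_of_real of_real_power)

lemma L2_inner_add_left:
  "f \<in> L2 S \<Longrightarrow> g \<in> L2 S \<Longrightarrow> h \<in> L2 S \<Longrightarrow> L2_inner S (\<lambda>x. f x + g x) h = L2_inner S f h + L2_inner S g h"
  using L2_inner_integrable[of f S h] L2_inner_integrable[of g S h]
  by (simp add: L2_inner_def distrib_right)

lemma L2_inner_diff_left:
  "f \<in> L2 S \<Longrightarrow> g \<in> L2 S \<Longrightarrow> h \<in> L2 S \<Longrightarrow> L2_inner S (\<lambda>x. f x - g x) h = L2_inner S f h - L2_inner S g h"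
  using L2_inner_integrable[of f S h] L2_inner_integrable[of g S h]
  by (simp add: L2_inner_def left_diff_distrib)

lemma L2_inner_scale_left: "L2_inner S (\<lambda>x. c * f x) h = c * L2_inner S f h"
  by (simp add: L2_inner_def mult.assoc)

lemma L2_inner_scale_right: "L2_inner S f (\<lambda>x. c * h x) = cnj c * L2_inner S f h"
  by (simp add: L2_inner_def mult.left_commute)

lemma L2_inner_commute: "L2_inner S f g = cnj (L2_inner S g f)"
  by (simp add: L2_inner_def mult.commute flip: Bochner_Integration.integral_cnj)

lemma L2_inner_diff_right:
  "f \<in> L2 S \<Longrightarrow> g \<in> L2 S \<Longrightarrow> h \<in> L2 S \<Longrightarrow> L2_inner S h (\<lambda>x. f x - g x) = L2_inner S h f - L2_inner S h g"
  using L2_inner_diff_left[of f S g h] by (metis L2_inner_commute complex_cnj_diff)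

lemma L2_inner_add_right:
  "f \<in> L2 S \<Longrightarrow> g \<in> L2 S \<Longrightarrow> h \<in> L2 S \<Longrightarrow> L2_inner S h (\<lambda>x. f x + g x) = L2_inner S h f + L2_inner S h g"
  using L2_inner_add_left[of f S g h] by (metis L2_inner_commute complex_cnj_add)

lemma L2_inner_cong_AE:
  assumes "AE x in lebesgue_on S. f x = g x"
    "f \<in> borel_measurable (lebesgue_on S)" "g \<in> borel_measurable (lebesgue_on S)" "h \<in> L2 S"
  shows "L2_inner S f h = L2_inner S g h"
  unfolding L2_inner_def
proof (rule integral_cong_AE)
  show "AE x in lebesgue_on S. f x * cnj (h x) = g x * cnj (h x)"
    using assms(1) by eventually_elim simp
qed (use assms L2_measurable[OF L2_cnj[OF assms(4)]] in auto)

section \<open>Square integrable functions on bounded intervals\<close>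

lemma L2_continuous:
  fixes f :: "real \<Rightarrow> complex"
  assumes "continuous_on {c..d} f" shows "f \<in> L2 {c<..<d}"
proof -
  have "continuous_on {c..d} (\<lambda>x. complex_of_real ((cmod (f x))\<^sup>2))"
    using assms by (intro continuous_intros)
  then have "integrable (lebesgue_on {c<..<d}) (\<lambda>x. complex_of_real ((cmod (f x))\<^sup>2))"
    by (rule integrable_Ioo_continuous)
  then have "integrable (lebesgue_on {c<..<d}) (\<lambda>x. (cmod (f x))\<^sup>2)"
    by (simp only: complex_of_real_integrable_eq)
  then show ?thesis using borel_measurable_Ioo_continuous[OF assms] by (simp add: L2_def)
qed

lemma L2_norm_const: "c \<le> d \<Longrightarrow> L2_norm {c<..<d} (\<lambda>x. k) = cmod k * sqrt (d - c)"
  by (simp add: L2_norm_def real_sqrt_mult measure_restrict_space)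

lemma L2_norm_bounded:
  assumes "f \<in> borel_measurable (lebesgue_on {c<..<d})" "\<And>x. x \<in> {c<..<d} \<Longrightarrow> cmod (f x) \<le> B" "c < d"
  shows "f \<in> L2 {c<..<d}" "L2_norm {c<..<d} f \<le> B * sqrt (d - c)"
proof -
  have B: "B \<ge> 0" using order_trans[OF norm_ge_zero assms(2)[of "(c + d) / 2"]] \<open>c < d\<close> by simp
  have "(\<lambda>x. complex_of_real B) \<in> L2 {c<..<d}" by (intro L2_continuous continuous_on_const)
  moreover have "AE x in lebesgue_on {c<..<d}. cmod (f x) \<le> cmod (complex_of_real B)"
    using assms(2) B by (intro AE_I2) auto
  ultimately have "f \<in> L2 {c<..<d}" "L2_norm {c<..<d} f \<le> L2_norm {c<..<d} (\<lambda>x. complex_of_real B)"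
    using L2_dominated[OF _ assms(1)] by blast+
  then show "f \<in> L2 {c<..<d}" "L2_norm {c<..<d} f \<le> B * sqrt (d - c)"
    using L2_norm_const[of c d "complex_of_real B"] B \<open>c < d\<close> by simp_all
qed

lemma L2_integrable:
  assumes "f \<in> L2 {c<..<d}" shows "integrable (lebesgue_on {c<..<d}) f"
  using L2_mult_integrable[OF assms, of "\<lambda>x. 1"] L2_continuous[of c d "\<lambda>x. 1"] by simp

lemma L1_le_L2_norm:
  assumes "f \<in> L2 {c<..<d}" "c \<le> d"
  shows "(LINT x|lebesgue_on {c<..<d}. cmod (f x)) \<le> L2_norm {c<..<d} f * sqrt (d - c)"
  using L2_abs_mult_le[OF assms(1), of "\<lambda>x. 1"] L2_continuous[of c d "\<lambda>x. 1"] assms(2)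
  by (simp add: L2_norm_const)

text \<open>The Riesz-Fischer argument: on a bounded interval a Cauchy sequence in \<open>L2\<close>
  is Cauchy in L1, so a subsequence converges almost everywhere, and Fatou's lemma transfers the
  Cauchy bounds to the limit.\<close>

lemma L2_complete:
  assumes f: "\<And>n. f n \<in> L2 {c<..<d}" and "c \<le> d"
    and cauchy: "\<And>e. e > 0 \<Longrightarrow> \<exists>N. \<forall>i\<ge>N. \<forall>j\<ge>N. L2_norm {c<..<d} (\<lambda>x. f i x - f j x) < e"
  obtains g where "g \<in> L2 {c<..<d}" "(\<lambda>n. L2_norm {c<..<d} (\<lambda>x. f n x - g x)) \<longlonglongrightarrow> 0"
proof -
  let ?S = "{c<..<d}" and ?M = "lebesgue_on {c<..<d}"
  have meas [measurable]: "f n \<in> borel_measurable ?M" for n using f by (rule L2_measurable)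
  have L1: "\<exists>N. \<forall>i\<ge>N. \<forall>j\<ge>N. (LINT x|?M. norm (f i x - f j x)) < e" if "e > 0" for e
  proof -
    \<comment> \<open>The added 1 keeps the divisor below positive when
      \<open>c = d\<close>.\<close>
    have pos: "sqrt (d - c) + 1 > 0" using \<open>c \<le> d\<close> by (simp add: add_nonneg_pos)
    then obtain N where N: "\<And>i j. i \<ge> N \<Longrightarrow> j \<ge> N \<Longrightarrow> L2_norm ?S (\<lambda>x. f i x - f j x) < e / (sqrt (d - c) + 1)"
      using cauchy[of "e / (sqrt (d - c) + 1)"] \<open>e > 0\<close> by auto
    have "(LINT x|?M. norm (f i x - f j x)) < e" if "i \<ge> N" "j \<ge> N" for i j
    proof -
      have "(LINT x|?M. norm (f i x - f j x)) \<le> L2_norm ?S (\<lambda>x. f i x - f j x) * sqrt (d - c)"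
        by (rule L1_le_L2_norm[OF L2_diff[OF f f] \<open>c \<le> d\<close>])
      also have "\<dots> \<le> L2_norm ?S (\<lambda>x. f i x - f j x) * (sqrt (d - c) + 1)"
        by (intro mult_left_mono L2_norm_nonneg) simp
      also have "\<dots> < e" using N[OF that] pos by (simp add: field_simps)
      finally show ?thesis .
    qed
    then show ?thesis by blast
  qed
  obtain r where r: "strict_mono r" "AE x in ?M. Cauchy (\<lambda>i. f (r i) x)"
    by (rule cauchy_L1_AE_cauchy_subseq[of ?M f, OF L2_integrable[OF f] L1])
  define g where "g x = lim (\<lambda>i. f (r i) x)" for x
  have g_meas [measurable]: "g \<in> borel_measurable ?M"
    unfolding g_def by (rule borel_measurable_lim_metric) simp
  have g_lim: "AE x in ?M. (\<lambda>i. f (r i) x) \<longlonglongrightarrow> g x"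
    using r(2) by eventually_elim (simp add: g_def Cauchy_convergent_iff convergent_LIMSEQ_iff)
  have fatou: "(\<integral>\<^sup>+x. ennreal ((cmod (f n x - g x))\<^sup>2) \<partial>?M) \<le> ennreal (e\<^sup>2)"
    if e: "e > 0" and N: "\<And>i. i \<ge> N \<Longrightarrow> L2_norm ?S (\<lambda>x. f n x - f i x) < e" for n N e
  proof -
    have "(\<integral>\<^sup>+x. ennreal ((cmod (f n x - g x))\<^sup>2) \<partial>?M) =
        (\<integral>\<^sup>+x. liminf (\<lambda>i. ennreal ((cmod (f n x - f (r i) x))\<^sup>2)) \<partial>?M)"
    proof (rule nn_integral_cong_AE)
      show "AE x in ?M. ennreal ((cmod (f n x - g x))\<^sup>2) = liminf (\<lambda>i. ennreal ((cmod (f n x - f (r i) x))\<^sup>2))"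
        using g_lim
      proof eventually_elim
        fix x assume "(\<lambda>i. f (r i) x) \<longlonglongrightarrow> g x"
        then have "(\<lambda>i. ennreal ((cmod (f n x - f (r i) x))\<^sup>2)) \<longlonglongrightarrow> ennreal ((cmod (f n x - g x))\<^sup>2)"
          by (intro tendsto_intros tendsto_ennrealI)
        from lim_imp_Liminf[OF sequentially_bot this]
        show "ennreal ((cmod (f n x - g x))\<^sup>2) = liminf (\<lambda>i. ennreal ((cmod (f n x - f (r i) x))\<^sup>2))"
          by (rule sym)
      qed
    qed
    also have "\<dots> \<le> liminf (\<lambda>i. \<integral>\<^sup>+x. ennreal ((cmod (f n x - f (r i) x))\<^sup>2) \<partial>?M)"
      by (rule nn_integral_liminf) simp
    also have "\<dots> \<le> limsup (\<lambda>i. \<integral>\<^sup>+x. ennreal ((cmod (f n x - f (r i) x))\<^sup>2) \<partial>?M)"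
      by (rule Liminf_le_Limsup) simp
    also have "\<dots> \<le> ennreal (e\<^sup>2)"
    proof (rule Limsup_bounded)
      show "\<forall>\<^sub>F i in sequentially. (\<integral>\<^sup>+x. ennreal ((cmod (f n x - f (r i) x))\<^sup>2) \<partial>?M) \<le> ennreal (e\<^sup>2)"
        using eventually_ge_at_top[of N]
      proof eventually_elim
        fix i assume "N \<le> i"
        then have "N \<le> r i" using seq_suble[OF r(1), of i] by simp
        then have "L2_norm ?S (\<lambda>x. f n x - f (r i) x) < e" by (rule N)
        then have "(L2_norm ?S (\<lambda>x. f n x - f (r i) x))\<^sup>2 \<le> e\<^sup>2"
          by (intro power_mono) (auto simp: L2_norm_nonneg)
        moreover have "(\<integral>\<^sup>+x. ennreal ((cmod (f n x - f (r i) x))\<^sup>2) \<partial>?M) =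
            ennreal (LINT x|?M. (cmod (f n x - f (r i) x))\<^sup>2)"
          by (rule nn_integral_eq_integral[OF L2_square_integrable[OF L2_diff[OF f f]]]) simp
        ultimately show "(\<integral>\<^sup>+x. ennreal ((cmod (f n x - f (r i) x))\<^sup>2) \<partial>?M) \<le> ennreal (e\<^sup>2)"
          by (simp add: L2_norm_power2 ennreal_leI)
      qed
    qed
    finally show ?thesis .
  qed
  have conv: "(\<lambda>x. f n x - g x) \<in> L2 ?S \<and> L2_norm ?S (\<lambda>x. f n x - g x) \<le> e"
    if e: "e > 0" and N: "\<And>i. i \<ge> N \<Longrightarrow> L2_norm ?S (\<lambda>x. f n x - f i x) < e" for n N e
  proof
    have b: "(\<integral>\<^sup>+x. ennreal ((cmod (f n x - g x))\<^sup>2) \<partial>?M) \<le> ennreal (e\<^sup>2)"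
      using e N by (rule fatou)
    have int: "integrable ?M (\<lambda>x. (cmod (f n x - g x))\<^sup>2)"
      using b by (intro integrableI_bounded) (auto intro: le_less_trans[OF _ ennreal_less_top])
    then show "(\<lambda>x. f n x - g x) \<in> L2 ?S" by (simp add: L2_def)
    have "(LINT x|?M. (cmod (f n x - g x))\<^sup>2) \<le> e\<^sup>2"
      using b by (subst (asm) nn_integral_eq_integral[OF int]) simp_all
    then show "L2_norm ?S (\<lambda>x. f n x - g x) \<le> e"
      using e by (intro power2_le_imp_le[OF _ less_imp_le[OF e]]) (simp add: L2_norm_power2)
  qed
  obtain N where "\<And>i. i \<ge> N \<Longrightarrow> L2_norm ?S (\<lambda>x. f N x - f i x) < 1"
    using cauchy[of 1] by auto
  then have "(\<lambda>x. f N x - g x) \<in> L2 ?S" using conv[of 1 N N] by simp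
  from L2_diff[OF f[of N] this] have g: "g \<in> L2 ?S" by simp
  have "(\<lambda>n. L2_norm ?S (\<lambda>x. f n x - g x)) \<longlonglongrightarrow> 0"
  proof (rule LIMSEQ_I)
    fix e :: real assume "0 < e"
    then obtain N where "\<forall>i\<ge>N. \<forall>j\<ge>N. L2_norm ?S (\<lambda>x. f i x - f j x) < e / 2"
      using cauchy[of "e / 2"] by auto
    then have "L2_norm ?S (\<lambda>x. f n x - g x) \<le> e / 2" if "n \<ge> N" for n
      using conv[of "e / 2" N n] that \<open>0 < e\<close> by auto
    then show "\<exists>no. \<forall>n\<ge>no. norm (L2_norm ?S (\<lambda>x. f n x - g x) - 0) < e"
      using \<open>0 < e\<close> by (intro exI[of _ N]) (fastforce simp: L2_norm_nonneg)
  qed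
  with g show ?thesis by (rule that)
qed

section \<open>Existence of weak derivatives\<close>

text \<open>A minimising sequence of \<open>f \<mapsto> \<parallel>f\<parallel>\<^sup>2 - 2 L f\<close> on \<open>V\<close> is a Cauchy sequence by the parallelogram identity.\<close>

lemma riesz_real_subspace:
  fixes L :: "(real \<Rightarrow> complex) \<Rightarrow> real"
  assumes "c \<le> d" and V: "V \<subseteq> L2 {c<..<d}" and ne: "V \<noteq> {}"
    and V_add: "\<And>f g. f \<in> V \<Longrightarrow> g \<in> V \<Longrightarrow> (\<lambda>x. f x + g x) \<in> V"
    and V_scale: "\<And>f r. f \<in> V \<Longrightarrow> (\<lambda>x. complex_of_real r * f x) \<in> V"
    and L_add: "\<And>f g. f \<in> V \<Longrightarrow> g \<in> V \<Longrightarrow> L (\<lambda>x. f x + g x) = L f + L g"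
    and L_scale: "\<And>f r. f \<in> V \<Longrightarrow> L (\<lambda>x. complex_of_real r * f x) = r * L f"
    and bound: "\<And>f. f \<in> V \<Longrightarrow> \<bar>L f\<bar> \<le> C * L2_norm {c<..<d} f"
  obtains g where "g \<in> L2 {c<..<d}" "\<And>f. f \<in> V \<Longrightarrow> L f = Re (L2_inner {c<..<d} f g)"
proof -
  let ?S = "{c<..<d}"
  define J where "J f = (L2_norm ?S f)\<^sup>2 - 2 * L f" for f
  have L2: "f \<in> L2 ?S" if "f \<in> V" for f using V that by auto
  have lower: "- (C\<^sup>2) \<le> J f" if "f \<in> V" for f
  proof -
    have "0 \<le> (L2_norm ?S f - C)\<^sup>2" by simp
    also have "\<dots> = (L2_norm ?S f)\<^sup>2 - 2 * (C * L2_norm ?S f) + C\<^sup>2"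
      by (simp add: power2_eq_square algebra_simps)
    also have "\<dots> \<le> J f + C\<^sup>2" using bound[OF that] by (simp add: J_def)
    finally show ?thesis by simp
  qed
  define m where "m = Inf (J ` V)"
  have bdd: "bdd_below (J ` V)" using lower by (intro bdd_belowI[of _ "- (C\<^sup>2)"]) auto
  have m_le: "m \<le> J f" if "f \<in> V" for f
    unfolding m_def using bdd that by (intro cInf_lower) auto
  have "\<exists>f\<in>V. J f < m + 1 / real (Suc n)" for n
  proof -
    have "Inf (J ` V) < m + 1 / real (Suc n)" by (simp add: m_def)
    then show ?thesis using cInf_lessD[of "J ` V"] ne by blast
  qed
  then obtain f where f: "\<And>n. f n \<in> V" "\<And>n. J (f n) < m + 1 / real (Suc n)" by metis
  have par: "(L2_norm ?S (\<lambda>x. u x - v x))\<^sup>2 = 2 * J u + 2 * J v - 4 * J (\<lambda>x. complex_of_real (1/2) * (u x + v x))"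
    if u: "u \<in> V" and v: "v \<in> V" for u v
  proof -
    have 1: "(L2_norm ?S (\<lambda>x. u x + v x))\<^sup>2 = (L2_norm ?S u)\<^sup>2 + (L2_norm ?S v)\<^sup>2 + 2 * Re (L2_inner ?S u v)"
      by (rule L2_norm_add_power2[OF L2[OF u] L2[OF v]])
    have 2: "(L2_norm ?S (\<lambda>x. u x - v x))\<^sup>2 = (L2_norm ?S u)\<^sup>2 + (L2_norm ?S v)\<^sup>2 - 2 * Re (L2_inner ?S u v)"
      using L2_norm_add_power2[OF L2[OF u] L2_minus[OF L2[OF v]]] L2_inner_scale_right[of ?S u "-1" v]
      by (simp add: L2_norm_minus)
    have 3: "J (\<lambda>x. complex_of_real (1/2) * (u x + v x)) = (L2_norm ?S (\<lambda>x. u x + v x))\<^sup>2 / 4 - (L u + L v)"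
      unfolding J_def L_scale[OF V_add[OF u v]] L_add[OF u v] L2_norm_scale
      by (simp add: power2_eq_square add_divide_distrib)
    show ?thesis unfolding 2 3 1 J_def by (simp add: algebra_simps)
  qed
  \<comment> \<open>The midpoint lies in \<open>V\<close>, so \<open>J\<close> is at least
    \<open>m\<close> there; the four copies of \<open>m\<close> cancel and only the excesses of the
    two end points remain.\<close>
  have dist: "(L2_norm ?S (\<lambda>x. f i x - f j x))\<^sup>2 \<le> 2 / real (Suc i) + 2 / real (Suc j)" for i j
    using par[OF f(1)[of i] f(1)[of j]] f(2)[of i] f(2)[of j]
      m_le[OF V_scale[OF V_add[OF f(1)[of i] f(1)[of j]], of "1/2"]]
    by simp
  obtain g where g: "g \<in> L2 ?S" "(\<lambda>n. L2_norm ?S (\<lambda>x. f n x - g x)) \<longlonglongrightarrow> 0"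
  proof (rule L2_complete[of f c d])
    show "f n \<in> L2 ?S" for n by (rule L2[OF f(1)])
    fix e :: real assume e: "e > 0"
    obtain N where N: "real N > 4 / e\<^sup>2" using reals_Archimedean2 by blast
    have "L2_norm ?S (\<lambda>x. f i x - f j x) < e" if "i \<ge> N" "j \<ge> N" for i j
    proof (rule power2_less_imp_less)
      have N0: "real N > 0" using N e by (meson le_less_trans divide_nonneg_nonneg zero_le_numeral zero_le_power2)
      have "2 / real (Suc i) \<le> 2 / real N" "2 / real (Suc j) \<le> 2 / real N"
        using that N0 by (auto intro!: divide_left_mono mult_pos_pos)
      then have "(L2_norm ?S (\<lambda>x. f i x - f j x))\<^sup>2 \<le> 4 / real N"
        using dist[of i j] by simp
      also have "\<dots> < e\<^sup>2" using N N0 e by (simp add: field_simps)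
      finally show "(L2_norm ?S (\<lambda>x. f i x - f j x))\<^sup>2 < e\<^sup>2" .
    qed (use e in simp)
    then show "\<exists>N. \<forall>i\<ge>N. \<forall>j\<ge>N. L2_norm ?S (\<lambda>x. f i x - f j x) < e" by blast
  qed (use \<open>c \<le> d\<close> in auto)
  show ?thesis
  proof (rule that[OF g(1)])
    fix \<psi> assume \<psi>: "\<psi> \<in> V"
    define N where "N = (L2_norm ?S \<psi>)\<^sup>2"
    define D where "D = Re (L2_inner ?S \<psi> g) - L \<psi>"
    have lim: "(\<lambda>n. Re (L2_inner ?S (f n) \<psi>)) \<longlonglongrightarrow> Re (L2_inner ?S g \<psi>)"
    proof (rule LIM_zero_cancel, rule tendsto_rabs_zero_cancel, rule tendsto_sandwich[OF _ _ tendsto_const])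
      show "\<forall>\<^sub>F n in sequentially. \<bar>Re (L2_inner ?S (f n) \<psi>) - Re (L2_inner ?S g \<psi>)\<bar>
          \<le> L2_norm ?S (\<lambda>x. f n x - g x) * L2_norm ?S \<psi>"
      proof (rule always_eventually, rule allI)
        fix n
        have "Re (L2_inner ?S (f n) \<psi>) - Re (L2_inner ?S g \<psi>) = Re (L2_inner ?S (\<lambda>x. f n x - g x) \<psi>)"
          using L2_inner_diff_left[OF L2[OF f(1)] g(1) L2[OF \<psi>], of n] by simp
        also have "\<bar>\<dots>\<bar> \<le> L2_norm ?S (\<lambda>x. f n x - g x) * L2_norm ?S \<psi>"
          using L2_inner_le[OF L2_diff[OF L2[OF f(1)] g(1)] L2[OF \<psi>], of n] abs_Re_le_cmod order_trans by blast
        finally show "\<bar>Re (L2_inner ?S (f n) \<psi>) - Re (L2_inner ?S g \<psi>)\<bar>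
          \<le> L2_norm ?S (\<lambda>x. f n x - g x) * L2_norm ?S \<psi>" .
      qed
      show "(\<lambda>n. L2_norm ?S (\<lambda>x. f n x - g x) * L2_norm ?S \<psi>) \<longlonglongrightarrow> 0"
        using tendsto_mult_right[OF g(2), of "L2_norm ?S \<psi>"] by simp
    qed simp
    have Re_comm: "Re (L2_inner ?S g \<psi>) = Re (L2_inner ?S \<psi> g)"
      by (subst L2_inner_commute) simp
    have var: "0 \<le> t\<^sup>2 * N + 2 * t * D" for t
    proof -
      have step: "0 \<le> 1 / real (Suc n) + t\<^sup>2 * N + 2 * t * (Re (L2_inner ?S (f n) \<psi>) - L \<psi>)" for n
      proof -
        note \<psi>' = V_scale[OF \<psi>, of t]
        have "m \<le> J (\<lambda>x. f n x + complex_of_real t * \<psi> x)" by (rule m_le[OF V_add[OF f(1) \<psi>']])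
        also have "\<dots> = J (f n) + t\<^sup>2 * N + 2 * t * (Re (L2_inner ?S (f n) \<psi>) - L \<psi>)"
          unfolding J_def L2_norm_add_power2[OF L2[OF f(1)] L2[OF \<psi>']] L_add[OF f(1) \<psi>'] L_scale[OF \<psi>]
            L2_norm_scale L2_inner_scale_right
          by (simp add: N_def power_mult_distrib algebra_simps)
        finally show ?thesis using f(2)[of n] by simp
      qed
      have "(\<lambda>n. 1 / real (Suc n) + t\<^sup>2 * N + 2 * t * (Re (L2_inner ?S (f n) \<psi>) - L \<psi>)) \<longlonglongrightarrow>
          0 + t\<^sup>2 * N + 2 * t * (Re (L2_inner ?S g \<psi>) - L \<psi>)"
        by (intro tendsto_intros lim LIMSEQ_Suc[OF lim_1_over_n])
      from tendsto_lowerbound[OF this, of 0] step show ?thesis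
        by (simp add: D_def Re_comm)
    qed
    have N: "N \<ge> 0" by (simp add: N_def)
    have "D = 0"
    proof (rule ccontr)
      assume "D \<noteq> 0"
      \<comment> \<open>The minimiser of the quadratic would be t = - D / N; replacing
        \<open>N\<close> by \<open>N + 1\<close> avoids a division by zero and still gives a
        negative value.\<close>
      have "(- D / (N + 1))\<^sup>2 * N + 2 * (- D / (N + 1)) * D = - (D / (N + 1))\<^sup>2 * (N + 2)"
        using N by (simp add: field_simps power2_eq_square add_nonneg_eq_0_iff)
      moreover have "(D / (N + 1))\<^sup>2 * (N + 2) > 0" using \<open>D \<noteq> 0\<close> N by (intro mult_pos_pos) auto
      ultimately show False using var[of "- D / (N + 1)"] by simp
    qed
    then show "L \<psi> = Re (L2_inner ?S \<psi> g)" by (simp add: D_def)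
  qed
qed

lemma L2_test_fun: "test_fun \<Omega> \<eta> \<Longrightarrow> (\<lambda>x. complex_of_real (\<eta> x)) \<in> L2 {c<..<d}"
  by (intro L2_continuous continuous_on_of_real smooth_continuous test_fun_smooth)

lemma integrable_test_fun_L2:
  "test_fun \<Omega> \<eta> \<Longrightarrow> f \<in> L2 {c<..<d} \<Longrightarrow> integrable (lebesgue_on {c<..<d}) (\<lambda>x. \<eta> x *\<^sub>R f x)"
  by (intro integrable_Ioo_test_fun L2_integrable)

lemma deriv_test_add:
  "test_fun \<Omega> \<eta> \<Longrightarrow> test_fun \<Omega> \<psi> \<Longrightarrow> deriv (\<lambda>x. \<eta> x + \<psi> x) x = deriv \<eta> x + deriv \<psi> x"
  by (intro DERIV_imp_deriv DERIV_add test_fun_DERIV)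

lemma deriv_test_scale:
  "test_fun \<Omega> \<eta> \<Longrightarrow> deriv (\<lambda>x. r * \<eta> x) x = r * deriv \<eta> x"
  by (intro DERIV_imp_deriv DERIV_cmult test_fun_DERIV)

text \<open>Test functions are real, so they span only a real subspace of the complex
  \<open>L2\<close>, and the representation captures real parts. The imaginary part is recovered
  afterwards by multiplying \<open>v\<close> by \<open>- \<i>\<close>.\<close>

lemma bounded_real_functional_representation:
  assumes "c \<le> d" and v: "v \<in> L2 {c<..<d}"
    and bound: "\<And>\<eta>. test_fun {c<..<d} \<eta> \<Longrightarrow>
      cmod (LINT x|lebesgue_on {c<..<d}. deriv \<eta> x *\<^sub>R v x) \<le> C * L2_norm {c<..<d} (\<lambda>x. complex_of_real (\<eta> x))"
  obtains g where "g \<in> L2 {c<..<d}"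
    "\<And>\<eta>. test_fun {c<..<d} \<eta> \<Longrightarrow>
      Re (LINT x|lebesgue_on {c<..<d}. deriv \<eta> x *\<^sub>R v x) = Re (LINT x|lebesgue_on {c<..<d}. \<eta> x *\<^sub>R g x)"
proof -
  let ?S = "{c<..<d}" and ?M = "lebesgue_on {c<..<d}"
  define V where "V = {(\<lambda>x. complex_of_real (\<eta> x)) |\<eta>. test_fun ?S \<eta>}"
  define L where "L f = Re (LINT x|?M. deriv (\<lambda>x. Re (f x)) x *\<^sub>R v x)" for f
  have int: "integrable ?M (\<lambda>x. deriv \<eta> x *\<^sub>R v x)" if "test_fun ?S \<eta>" for \<eta>
    using that v by (intro integrable_test_fun_L2 test_fun_deriv)
  obtain g where g: "g \<in> L2 ?S" "\<And>f. f \<in> V \<Longrightarrow> L f = Re (L2_inner ?S f g)"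
  proof (rule riesz_real_subspace[of c d V L C])
    show "V \<subseteq> L2 ?S" using L2_test_fun by (auto simp: V_def)
    have "test_fun ?S (\<lambda>x. 0)" by (rule test_funI[of _ "{}"]) (auto simp: smooth_const)
    then show "V \<noteq> {}" by (auto simp: V_def)
    show "(\<lambda>x. f x + g x) \<in> V" if "f \<in> V" "g \<in> V" for f g
    proof -
      obtain \<eta> \<psi> where e: "f = (\<lambda>x. complex_of_real (\<eta> x))" "g = (\<lambda>x. complex_of_real (\<psi> x))"
        "test_fun ?S \<eta>" "test_fun ?S \<psi>" using \<open>f \<in> V\<close> \<open>g \<in> V\<close> by (auto simp: V_def)
      have "(\<lambda>x. f x + g x) = (\<lambda>x. complex_of_real (\<eta> x + \<psi> x))" by (simp add: e)
      then show ?thesis using test_fun_add[OF e(3,4)] unfolding V_def by (intro CollectI exI conjI)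
    qed
    show "(\<lambda>x. complex_of_real r * f x) \<in> V" if "f \<in> V" for f r
    proof -
      obtain \<eta> where e: "f = (\<lambda>x. complex_of_real (\<eta> x))" "test_fun ?S \<eta>"
        using \<open>f \<in> V\<close> by (auto simp: V_def)
      have "(\<lambda>x. complex_of_real r * f x) = (\<lambda>x. complex_of_real (r * \<eta> x))" by (simp add: e)
      then show ?thesis using test_fun_scale[OF e(2)] unfolding V_def by (intro CollectI exI conjI)
    qed
    show "L (\<lambda>x. f x + g x) = L f + L g" if "f \<in> V" "g \<in> V" for f g
    proof -
      obtain \<eta> \<psi> where e: "f = (\<lambda>x. complex_of_real (\<eta> x))" "g = (\<lambda>x. complex_of_real (\<psi> x))"
        "test_fun ?S \<eta>" "test_fun ?S \<psi>" using \<open>f \<in> V\<close> \<open>g \<in> V\<close> by (auto simp: V_def)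
      show ?thesis using int[OF e(3)] int[OF e(4)]
        by (simp add: L_def e(1,2) deriv_test_add[OF e(3,4)] scaleR_add_left)
    qed
    show "L (\<lambda>x. complex_of_real r * f x) = r * L f" if "f \<in> V" for f r
    proof -
      obtain \<eta> where e: "f = (\<lambda>x. complex_of_real (\<eta> x))" "test_fun ?S \<eta>"
        using \<open>f \<in> V\<close> by (auto simp: V_def)
      have "(LINT x|?M. (r * deriv \<eta> x) *\<^sub>R v x) = r *\<^sub>R (LINT x|?M. deriv \<eta> x *\<^sub>R v x)"
        unfolding scaleR_scaleR[symmetric] by (rule integral_scaleR_right)
      then show ?thesis by (simp add: L_def e(1) deriv_test_scale[OF e(2)])
    qed
    show "\<bar>L f\<bar> \<le> C * L2_norm ?S f" if "f \<in> V" for f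
    proof -
      obtain \<eta> where e: "f = (\<lambda>x. complex_of_real (\<eta> x))" "test_fun ?S \<eta>"
        using \<open>f \<in> V\<close> by (auto simp: V_def)
      show ?thesis using bound[OF e(2)] abs_Re_le_cmod order_trans by (fastforce simp: L_def e(1))
    qed
  qed (use \<open>c \<le> d\<close> in auto)
  show ?thesis
  proof (rule that[OF g(1)])
    fix \<eta> assume \<eta>: "test_fun ?S \<eta>"
    have "Re (LINT x|?M. deriv \<eta> x *\<^sub>R v x) = Re (L2_inner ?S (\<lambda>x. complex_of_real (\<eta> x)) g)"
      using g(2)[of "\<lambda>x. complex_of_real (\<eta> x)"] \<eta> by (auto simp: V_def L_def)
    also have "\<dots> = Re (cnj (LINT x|?M. \<eta> x *\<^sub>R g x))"
      by (simp add: L2_inner_def scaleR_conv_of_real flip: Bochner_Integration.integral_cnj)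
    finally show "Re (LINT x|?M. deriv \<eta> x *\<^sub>R v x) = Re (LINT x|?M. \<eta> x *\<^sub>R g x)" by simp
  qed
qed

lemma has_weak_deriv_1_iff:
  "has_weak_deriv \<Omega> 1 f g \<longleftrightarrow> f \<in> L2 \<Omega> \<and> g \<in> L2 \<Omega> \<and>
     (\<forall>\<eta>. test_fun \<Omega> \<eta> \<longrightarrow> (LINT x|lebesgue_on \<Omega>. deriv \<eta> x *\<^sub>R f x) = - (LINT x|lebesgue_on \<Omega>. \<eta> x *\<^sub>R g x))"
  by (simp add: has_weak_deriv_def)

text \<open>The duality criterion by which the velocity acquires a space derivative: a bound against
  the \<open>L2\<close> norm of the test function makes pairing with its derivative a functional
  that the Riesz argument represents.\<close>

lemma bounded_imp_weak_deriv:
  assumes "c \<le> d" and v: "v \<in> L2 {c<..<d}"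
    and bound: "\<And>\<eta>. test_fun {c<..<d} \<eta> \<Longrightarrow>
      cmod (LINT x|lebesgue_on {c<..<d}. deriv \<eta> x *\<^sub>R v x) \<le> C * L2_norm {c<..<d} (\<lambda>x. complex_of_real (\<eta> x))"
  shows "\<exists>g. has_weak_deriv {c<..<d} 1 v g"
proof -
  let ?S = "{c<..<d}" and ?M = "lebesgue_on {c<..<d}"
  obtain g where g: "g \<in> L2 ?S" "\<And>\<eta>. test_fun ?S \<eta> \<Longrightarrow>
      Re (LINT x|?M. deriv \<eta> x *\<^sub>R v x) = Re (LINT x|?M. \<eta> x *\<^sub>R g x)"
    using bounded_real_functional_representation[OF assms] by blast
  have iv: "(LINT x|?M. deriv \<eta> x *\<^sub>R (- \<i> * v x)) = - \<i> * (LINT x|?M. deriv \<eta> x *\<^sub>R v x)" for \<eta>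
    unfolding mult_scaleR_right[symmetric] by (rule integral_mult_right_zero)
  have "cmod (LINT x|?M. deriv \<eta> x *\<^sub>R (- \<i> * v x)) \<le> C * L2_norm ?S (\<lambda>x. complex_of_real (\<eta> x))"
    if "test_fun ?S \<eta>" for \<eta>
    using bound[OF that] unfolding iv by (simp add: norm_mult)
  from bounded_real_functional_representation[OF \<open>c \<le> d\<close> L2_scale[OF v] this]
  obtain h where h: "h \<in> L2 ?S" "\<And>\<eta>. test_fun ?S \<eta> \<Longrightarrow>
      Re (LINT x|?M. deriv \<eta> x *\<^sub>R (- \<i> * v x)) = Re (LINT x|?M. \<eta> x *\<^sub>R h x)"
    by blast
  have re: "(\<lambda>x. complex_of_real (Re (k x))) \<in> L2 ?S" if "k \<in> L2 ?S" for k
    by (rule L2_dominated[OF that])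
      (use L2_measurable[OF that] in \<open>auto simp: abs_Re_le_cmod\<close>)
  \<comment> \<open>Since test functions are real, only the real parts of \<open>g\<close> and
    \<open>h\<close> are determined; they represent the real and imaginary parts of the functional.
    The minus sign is that of the weak derivative.\<close>
  define w where "w x = - (complex_of_real (Re (g x)) + \<i> * complex_of_real (Re (h x)))" for x
  have w: "w \<in> L2 ?S" unfolding w_def by (intro L2_minus L2_add L2_scale re g h)
  have Re_int: "Re (LINT x|?M. \<eta> x *\<^sub>R k x) = (LINT x|?M. \<eta> x * Re (k x))"
    if "test_fun ?S \<eta>" "k \<in> L2 ?S" for \<eta> k
    using integral_Re[OF integrable_test_fun_L2[OF that]] by simp
  have Im_int: "Im (LINT x|?M. \<eta> x *\<^sub>R k x) = (LINT x|?M. \<eta> x * Im (k x))"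
    if "test_fun ?S \<eta>" "k \<in> L2 ?S" for \<eta> k
    using integral_Im[OF integrable_test_fun_L2[OF that]] by simp
  have "(LINT x|?M. deriv \<eta> x *\<^sub>R v x) = - (LINT x|?M. \<eta> x *\<^sub>R w x)" if \<eta>: "test_fun ?S \<eta>" for \<eta>
  proof (rule complex_eqI)
    show "Re (LINT x|?M. deriv \<eta> x *\<^sub>R v x) = Re (- (LINT x|?M. \<eta> x *\<^sub>R w x))"
      using g(2)[OF \<eta>] Re_int[OF \<eta> w] Re_int[OF \<eta> g(1)] by (simp add: w_def)
    have "Im (LINT x|?M. deriv \<eta> x *\<^sub>R v x) = Re (LINT x|?M. deriv \<eta> x *\<^sub>R (- \<i> * v x))"
      unfolding iv by simp
    then show "Im (LINT x|?M. deriv \<eta> x *\<^sub>R v x) = Im (- (LINT x|?M. \<eta> x *\<^sub>R w x))"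
      using h(2)[OF \<eta>] Im_int[OF \<eta> w] Re_int[OF \<eta> h(1)] by (simp add: w_def)
  qed
  then have "has_weak_deriv ?S 1 v w" unfolding has_weak_deriv_1_iff using v w by blast
  then show ?thesis by blast
qed

section \<open>Uniqueness and calculus of weak derivatives\<close>

lemma has_weak_deriv_unique:
  assumes "has_weak_deriv {c<..<d} k f g" "has_weak_deriv {c<..<d} k f h"
  shows "AE x in lebesgue_on {c<..<d}. g x = h x"
proof -
  let ?M = "lebesgue_on {c<..<d}"
  have g: "g \<in> L2 {c<..<d}" and h: "h \<in> L2 {c<..<d}" using assms by (auto simp: has_weak_deriv_def)
  have "AE x in ?M. g x - h x = 0"
  proof (rule AE_null_if_test_null)
    show "integrable ?M (\<lambda>x. g x - h x)" by (intro L2_integrable L2_diff g h)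
    fix \<eta> assume \<eta>: "test_fun {c<..<d} \<eta>"
    have "(- 1) ^ k * (LINT x|?M. \<eta> x *\<^sub>R g x) = (- 1) ^ k * (LINT x|?M. \<eta> x *\<^sub>R h x)"
      using assms \<eta> by (simp add: has_weak_deriv_def)
    then have "(LINT x|?M. \<eta> x *\<^sub>R g x) = (LINT x|?M. \<eta> x *\<^sub>R h x)" by simp
    then show "(LINT x|?M. \<eta> x *\<^sub>R (g x - h x)) = 0"
      using integrable_test_fun_L2[OF \<eta> g] integrable_test_fun_L2[OF \<eta> h]
      by (simp add: scaleR_diff_right)
  qed
  then show ?thesis by eventually_elim simp
qed

lemma test_fun_higher_deriv: "test_fun \<Omega> \<eta> \<Longrightarrow> test_fun \<Omega> ((deriv ^^ k) \<eta>)"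
  by (induction k) (auto intro: test_fun_deriv)

lemma has_weak_deriv_add:
  assumes "has_weak_deriv {c<..<d} k f g" "has_weak_deriv {c<..<d} k f' g'"
  shows "has_weak_deriv {c<..<d} k (\<lambda>x. f x + f' x) (\<lambda>x. g x + g' x)"
  unfolding has_weak_deriv_def
proof (intro conjI allI impI)
  have L: "f \<in> L2 {c<..<d}" "g \<in> L2 {c<..<d}" "f' \<in> L2 {c<..<d}" "g' \<in> L2 {c<..<d}"
    using assms by (auto simp: has_weak_deriv_def)
  then show "(\<lambda>x. f x + f' x) \<in> L2 {c<..<d}" "(\<lambda>x. g x + g' x) \<in> L2 {c<..<d}"
    by (auto intro: L2_add)
  fix \<eta> assume \<eta>: "test_fun {c<..<d} \<eta>"
  note i = integrable_test_fun_L2[OF test_fun_higher_deriv[OF \<eta>, of k]] integrable_test_fun_L2[OF \<eta>]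
  show "(LINT x|lebesgue_on {c<..<d}. (deriv ^^ k) \<eta> x *\<^sub>R (f x + f' x)) =
      (- 1) ^ k * (LINT x|lebesgue_on {c<..<d}. \<eta> x *\<^sub>R (g x + g' x))"
    using assms \<eta> i[OF L(1)] i[OF L(2)] i[OF L(3)] i[OF L(4)]
    by (simp add: has_weak_deriv_def scaleR_add_right distrib_left i L)
qed

lemma has_weak_deriv_scale:
  assumes "has_weak_deriv {c<..<d} k f g"
  shows "has_weak_deriv {c<..<d} k (\<lambda>x. r * f x) (\<lambda>x. r * g x)"
  using assms unfolding has_weak_deriv_def
  by (auto intro: L2_scale simp: mult_scaleR_right[symmetric] mult.left_commute simp del: mult_scaleR_right)

lemma has_weak_deriv_diff:
  assumes "has_weak_deriv {c<..<d} k f g" "has_weak_deriv {c<..<d} k f' g'"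
  shows "has_weak_deriv {c<..<d} k (\<lambda>x. f x - f' x) (\<lambda>x. g x - g' x)"
  using has_weak_deriv_add[OF assms(1) has_weak_deriv_scale[OF assms(2), of "-1"]] by simp

lemma has_weak_deriv_0: "f \<in> L2 \<Omega> \<Longrightarrow> has_weak_deriv \<Omega> 0 f f"
  by (simp add: has_weak_deriv_def)

lemma weak_deriv_AE:
  assumes "has_weak_deriv {c<..<d} k f g"
  shows "AE x in lebesgue_on {c<..<d}. weak_deriv {c<..<d} k f x = g x"
    and "weak_deriv {c<..<d} k f \<in> L2 {c<..<d}"
    and "L2_norm {c<..<d} (weak_deriv {c<..<d} k f) = L2_norm {c<..<d} g"
proof -
  have w: "has_weak_deriv {c<..<d} k f (weak_deriv {c<..<d} k f)"
    unfolding weak_deriv_def using someI_ex[of "has_weak_deriv {c<..<d} k f"] assms by blast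
  show 1: "AE x in lebesgue_on {c<..<d}. weak_deriv {c<..<d} k f x = g x"
    by (rule has_weak_deriv_unique[OF w assms])
  show 2: "weak_deriv {c<..<d} k f \<in> L2 {c<..<d}" using w by (simp add: has_weak_deriv_def)
  show "L2_norm {c<..<d} (weak_deriv {c<..<d} k f) = L2_norm {c<..<d} g"
    using assms by (intro L2_norm_cong_AE 1 L2_measurable 2) (auto simp: has_weak_deriv_def)
qed

lemma has_weak_deriv_compose:
  assumes "has_weak_deriv \<Omega> k f g" "has_weak_deriv \<Omega> 1 g h"
  shows "has_weak_deriv \<Omega> (Suc k) f h"
proof -
  have "(deriv ^^ Suc k) \<eta> = (deriv ^^ k) (deriv \<eta>)" for \<eta> :: "real \<Rightarrow> real"
    by (simp only: funpow_Suc_right comp_apply)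
  then show ?thesis
    using assms(1) assms(2)[unfolded has_weak_deriv_1_iff] test_fun_deriv
    by (auto simp: has_weak_deriv_def simp del: funpow.simps)
qed

lemma has_weak_deriv_decompose:
  assumes "has_weak_deriv \<Omega> k f g" "has_weak_deriv \<Omega> (Suc k) f h"
  shows "has_weak_deriv \<Omega> 1 g h"
proof -
  have e: "(deriv ^^ Suc k) \<eta> = (deriv ^^ k) (deriv \<eta>)" for \<eta> :: "real \<Rightarrow> real"
    by (simp only: funpow_Suc_right comp_apply)
  have "(LINT x|lebesgue_on \<Omega>. deriv \<eta> x *\<^sub>R g x) = - (LINT x|lebesgue_on \<Omega>. \<eta> x *\<^sub>R h x)"
    if \<eta>: "test_fun \<Omega> \<eta>" for \<eta>
  proof -
    have 1: "(LINT x|lebesgue_on \<Omega>. (deriv ^^ k) (deriv \<eta>) x *\<^sub>R f x) = (- 1) ^ k * (LINT x|lebesgue_on \<Omega>. deriv \<eta> x *\<^sub>R g x)"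
      using assms(1) test_fun_deriv[OF \<eta>] unfolding has_weak_deriv_def by blast
    have 2: "(LINT x|lebesgue_on \<Omega>. (deriv ^^ Suc k) \<eta> x *\<^sub>R f x) = (- 1) ^ Suc k * (LINT x|lebesgue_on \<Omega>. \<eta> x *\<^sub>R h x)"
      using assms(2) \<eta> unfolding has_weak_deriv_def by blast
    have "(- 1) ^ k * (LINT x|lebesgue_on \<Omega>. deriv \<eta> x *\<^sub>R g x) = (- 1) ^ k * - (LINT x|lebesgue_on \<Omega>. \<eta> x *\<^sub>R h x)"
      using 1 2 unfolding e by simp
    then show ?thesis by (rule mult_left_cancel[THEN iffD1, rotated]) simp
  qed
  then show ?thesis using assms unfolding has_weak_deriv_1_iff by (simp add: has_weak_deriv_def)
qed

section \<open>Functions with Neumann boundary values\<close>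

lemma continuous_AE_eq_imp_eq:
  fixes f g :: "real \<Rightarrow> complex"
  assumes "c < d" "continuous_on {c..d} f" "continuous_on {c..d} g"
    and AE: "AE x in lebesgue_on {c<..<d}. f x = g x" and x: "x \<in> {c..d}"
  shows "f x = g x"
proof -
  have cont: "continuous_on {c..d} (\<lambda>x. cmod (f x - g x))"
    using assms by (intro continuous_intros)
  then have "integral {c..d} (\<lambda>x. cmod (f x - g x)) = (LINT x|lebesgue_on {c<..<d}. cmod (f x - g x))"
    by (intro LINT_Ioo_eq_integral[symmetric] integrable_Ioo_continuous)
  also have "\<dots> = 0"
    by (rule integral_eq_zero_AE) (use AE in eventually_elim, simp)
  finally have "integral {c..d} (\<lambda>x. cmod (f x - g x)) = 0" .
  then have "cmod (f x - g x) = 0"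
    using integral_eq_0_iff[OF cont \<open>c < d\<close>] x by simp
  then show ?thesis by simp
qed

lemma integral_upto_cong_AE:
  fixes f g :: "real \<Rightarrow> complex"
  assumes f: "integrable (lebesgue_on {c<..<d}) f" and g: "integrable (lebesgue_on {c<..<d}) g"
    and AE: "AE x in lebesgue_on {c<..<d}. f x = g x" and x: "x \<in> {c..d}"
  shows "integral {c..x} f = integral {c..x} g"
  unfolding integral_upto_eq_LINT[OF f x] integral_upto_eq_LINT[OF g x]
proof (rule integral_cong_AE)
  show "AE y in lebesgue_on {c<..<d}. indicator {..<x} y *\<^sub>R f y = indicator {..<x} y *\<^sub>R g y"
    using AE by eventually_elim simp
qed (intro borel_measurable_integrable integrable_Ioo_indicator f g; simp)+

lemma primitive_has_derivative:
  fixes p :: "real \<Rightarrow> complex"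
  assumes p: "continuous_on {c..d} p" and eq: "\<And>y. y \<in> {c..d} \<Longrightarrow> f y = k + integral {c..y} p" and x: "x \<in> {c..d}"
  shows "(f has_vector_derivative p x) (at x within {c..d})"
proof (rule has_vector_derivative_transform[OF x eq])
  show "((\<lambda>y. k + integral {c..y} p) has_vector_derivative p x) (at x within {c..d})"
    using integral_has_vector_derivative[OF p x] by (auto intro!: derivative_eq_intros)
qed

lemma primitive_of_derivative:
  fixes f :: "real \<Rightarrow> complex"
  assumes "\<And>x. x \<in> {c..d} \<Longrightarrow> (f has_vector_derivative p x) (at x within {c..d})" "x \<in> {c..d}"
  shows "f x = f c + integral {c..x} p"
proof -
  have "(p has_integral (f x - f c)) {c..x}"
  proof (rule fundamental_theorem_of_calculus)
    fix y assume y: "y \<in> {c..x}"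
    show "(f has_vector_derivative p y) (at y within {c..x})"
      by (rule has_vector_derivative_within_subset[OF assms(1)]) (use y assms(2) in auto)
  qed (use assms in auto)
  then show ?thesis by (simp add: has_integral_iff)
qed

text \<open>\<open>p\<close> and \<open>g\<close> are the first two derivatives of \<open>f\<close>; the condition \<open>p (- a) = 0\<close> is implicit in
  the integral formula for \<open>p\<close>.\<close>

definition neumann_rep :: "real \<Rightarrow> (real \<Rightarrow> complex) \<Rightarrow> (real \<Rightarrow> complex) \<Rightarrow> (real \<Rightarrow> complex) \<Rightarrow> bool" where
  "neumann_rep a f p g \<longleftrightarrow> g \<in> L2 {-a<..<a} \<and> (\<forall>x\<in>{-a..a}. p x = integral {-a..x} g) \<and> p a = 0 \<and>
     (\<forall>x\<in>{-a..a}. (f has_vector_derivative p x) (at x within {-a..a}))"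

lemma neumann_repD:
  assumes "neumann_rep a f p g"
  shows "g \<in> L2 {-a<..<a}" "\<And>x. x \<in> {-a..a} \<Longrightarrow> p x = integral {-a..x} g" "p a = 0"
    "\<And>x. x \<in> {-a..a} \<Longrightarrow> (f has_vector_derivative p x) (at x within {-a..a})"
    "continuous_on {-a..a} p" "continuous_on {-a..a} f" "p \<in> L2 {-a<..<a}" "f \<in> L2 {-a<..<a}"
    "integrable (lebesgue_on {-a<..<a}) g" "g integrable_on {-a..a}"
proof -
  show g: "g \<in> L2 {-a<..<a}" and p: "\<And>x. x \<in> {-a..a} \<Longrightarrow> p x = integral {-a..x} g" and "p a = 0"
    and f: "\<And>x. x \<in> {-a..a} \<Longrightarrow> (f has_vector_derivative p x) (at x within {-a..a})"
    using assms by (auto simp: neumann_rep_def)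
  show i: "integrable (lebesgue_on {-a<..<a}) g" using g by (rule L2_integrable)
  show io: "g integrable_on {-a..a}" using i by (rule integrable_Ioo_integrable_on)
  show pc: "continuous_on {-a..a} p"
    by (rule continuous_on_eq[OF indefinite_integral_continuous_1[OF io]]) (simp add: p)
  show fc: "continuous_on {-a..a} f"
    by (rule continuous_on_vector_derivative) (use f in auto)
  show "p \<in> L2 {-a<..<a}" "f \<in> L2 {-a<..<a}" using pc fc by (auto intro: L2_continuous)
qed

text \<open>Two applications of \<open>du_Bois_Reymond\<close> show that the given continuous
  representative is continuously differentiable. Uniqueness of one-sided derivatives at the end
  points then turns the Neumann conditions into \<open>C = 0\<close> and
  \<open>p a = 0\<close>.\<close>

lemma D_Neu_rep:
  assumes "a > 0" and f: "f \<in> D_Neu a"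
  obtains p g where "neumann_rep a f p g" "has_weak_deriv {-a<..<a} 1 f p" "has_weak_deriv {-a<..<a} 2 f g"
proof -
  let ?S = "{-a<..<a}" and ?M = "lebesgue_on {-a<..<a}"
  have lt: "-a < a" using \<open>a > 0\<close> by simp
  have H2: "f \<in> Sobolev_H 2 ?S" and fc: "continuous_on {-a..a} f"
    and fl: "(f has_vector_derivative 0) (at (-a) within {-a..a})"
    and fr: "(f has_vector_derivative 0) (at a within {-a..a})"
    using f by (auto simp: D_Neu_def)
  have ex: "\<exists>g. has_weak_deriv ?S k f g" if "k \<le> 2" for k
    using H2 that unfolding Sobolev_H_def by blast
  obtain g1 where g1: "has_weak_deriv ?S 1 f g1" using ex[of 1] by (metis one_le_numeral)
  obtain g where g: "has_weak_deriv ?S 2 f g" using ex[of 2] by blast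
  have g12: "has_weak_deriv ?S 1 g1 g"
    using has_weak_deriv_decompose[OF g1, of g] g by (simp add: numeral_2_eq_2)
  have L2: "f \<in> L2 ?S" "g1 \<in> L2 ?S" "g \<in> L2 ?S" using g1 g by (auto simp: has_weak_deriv_def)
  obtain C where C: "AE x in ?M. g1 x = C + integral {-a..x} g"
    using du_Bois_Reymond[OF lt L2_integrable[OF L2(2)] L2_integrable[OF L2(3)]] g12
    unfolding has_weak_deriv_1_iff by blast
  obtain D where D: "AE x in ?M. f x = D + integral {-a..x} g1"
    using du_Bois_Reymond[OF lt L2_integrable[OF L2(1)] L2_integrable[OF L2(2)]] g1
    unfolding has_weak_deriv_1_iff by blast
  define p where "p x = C + integral {-a..x} g" for x
  have pc: "continuous_on {-a..a} p" unfolding p_def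
    by (intro continuous_on_add continuous_on_const indefinite_integral_continuous_1
        integrable_Ioo_integrable_on L2_integrable L2)
  have eq: "f x = D + integral {-a..x} p" if x: "x \<in> {-a..a}" for x
  proof (rule continuous_AE_eq_imp_eq[OF lt fc _ _ x])
    show "continuous_on {-a..a} (\<lambda>x. D + integral {-a..x} p)"
      by (intro continuous_on_add continuous_on_const indefinite_integral_continuous_1
          integrable_continuous_interval pc)
    have "integral {-a..x} g1 = integral {-a..x} p" if "x \<in> {-a..a}" for x
      by (rule integral_upto_cong_AE[OF L2_integrable[OF L2(2)] integrable_Ioo_continuous[OF pc] _ that])
        (use C in \<open>simp add: p_def\<close>)
    then have "integral {-a..x} g1 = integral {-a..x} p" if "x \<in> space ?M" for x
      using that by simp
    with D AE_space[of ?M] show "AE x in ?M. f x = D + integral {-a..x} p"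
      by (auto elim: eventually_elim2)
  qed
  have fd: "(f has_vector_derivative p x) (at x within {-a..a})" if "x \<in> {-a..a}" for x
    using pc eq that by (rule primitive_has_derivative)
  have "p (-a) = 0" "p a = 0"
    using vector_derivative_within_closed_interval[OF lt _ fd[of "-a"]]
      vector_derivative_within_closed_interval[OF lt _ fl]
      vector_derivative_within_closed_interval[OF lt _ fd[of a]]
      vector_derivative_within_closed_interval[OF lt _ fr] lt by auto
  then have C0: "C = 0" by (simp add: p_def)
  have pg1: "AE x in ?M. p x = g1 x" using C by (auto simp: p_def)
  show ?thesis
  proof
    show "neumann_rep a f p g"
      using L2 \<open>p a = 0\<close> fd by (auto simp: neumann_rep_def p_def C0)
    show "has_weak_deriv ?S 2 f g" by (rule g)
    have "(LINT x|?M. \<eta> x *\<^sub>R g1 x) = (LINT x|?M. \<eta> x *\<^sub>R p x)" if \<eta>: "test_fun ?S \<eta>" for \<eta>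
    proof (rule integral_cong_AE)
      show "AE x in ?M. \<eta> x *\<^sub>R g1 x = \<eta> x *\<^sub>R p x" using pg1 by eventually_elim simp
    qed (intro borel_measurable_integrable integrable_test_fun_L2[OF \<eta>] L2 L2_continuous[OF pc])+
    then show "has_weak_deriv ?S 1 f p"
      using g1 L2_continuous[OF pc] unfolding has_weak_deriv_1_iff by simp
  qed
qed

section \<open>Linear operations, conjugation and reflection of Neumann functions\<close>

lemma neumann_rep_add:
  assumes "neumann_rep a f p g" "neumann_rep a f' p' g'"
  shows "neumann_rep a (\<lambda>x. f x + f' x) (\<lambda>x. p x + p' x) (\<lambda>x. g x + g' x)"
  unfolding neumann_rep_def
proof (intro conjI ballI)
  note A = neumann_repD[OF assms(1)] and B = neumann_repD[OF assms(2)]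
  show "(\<lambda>x. g x + g' x) \<in> L2 {-a<..<a}" by (intro L2_add A B)
  show "p a + p' a = 0" using A(3) B(3) by simp
  fix x assume x: "x \<in> {-a..a}"
  then have "g integrable_on {-a..x}" "g' integrable_on {-a..x}"
    using integrable_subinterval_real[OF A(10)] integrable_subinterval_real[OF B(10)] by auto
  then show "p x + p' x = integral {-a..x} (\<lambda>x. g x + g' x)"
    using A(2)[OF x] B(2)[OF x] by (simp add: Henstock_Kurzweil_Integration.integral_add)
  show "((\<lambda>x. f x + f' x) has_vector_derivative p x + p' x) (at x within {-a..a})"
    by (intro has_vector_derivative_add A(4) B(4) x)
qed

lemma neumann_rep_scale:
  assumes "neumann_rep a f p g"
  shows "neumann_rep a (\<lambda>x. c * f x) (\<lambda>x. c * p x) (\<lambda>x. c * g x)"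
  using assms unfolding neumann_rep_def
  by (auto intro!: L2_scale has_vector_derivative_mult_right)

lemma neumann_rep_diff:
  assumes "neumann_rep a f p g" "neumann_rep a f' p' g'"
  shows "neumann_rep a (\<lambda>x. f x - f' x) (\<lambda>x. p x - p' x) (\<lambda>x. g x - g' x)"
  using neumann_rep_add[OF assms(1) neumann_rep_scale[OF assms(2), of "-1"]] by simp

lemma neumann_rep_cnj:
  assumes "neumann_rep a f p g"
  shows "neumann_rep a (\<lambda>x. cnj (f x)) (\<lambda>x. cnj (p x)) (\<lambda>x. cnj (g x))"
  unfolding neumann_rep_def
proof (intro conjI ballI)
  note A = neumann_repD[OF assms]
  show "(\<lambda>x. cnj (g x)) \<in> L2 {-a<..<a}" by (rule L2_cnj[OF A(1)])
  show "cnj (p a) = 0" by (simp add: A(3))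
  fix x assume x: "x \<in> {-a..a}"
  show "cnj (p x) = integral {-a..x} (\<lambda>x. cnj (g x))"
    unfolding A(2)[OF x] by (rule Henstock_Kurzweil_Integration.integral_cnj)
  show "((\<lambda>x. cnj (f x)) has_vector_derivative cnj (p x)) (at x within {-a..a})"
    by (rule bounded_linear.has_vector_derivative[OF bounded_linear_cnj A(4)[OF x]])
qed

lemma LINT_reflect:
  fixes f :: "real \<Rightarrow> complex"
  assumes "integrable (lebesgue_on {-a<..<a}) f"
  shows "integrable (lebesgue_on {-a<..<a}) (\<lambda>x. f (- x))"
    "(LINT x|lebesgue_on {-a<..<a}. f (- x)) = (LINT x|lebesgue_on {-a<..<a}. f x)"
proof -
  show i: "integrable (lebesgue_on {-a<..<a}) (\<lambda>x. f (- x))"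
    using assms absolutely_integrable_reflect_real[where f = f and a = "-a" and b = a] by (simp add: integrable_Ioo_iff)
  show "(LINT x|lebesgue_on {-a<..<a}. f (- x)) = (LINT x|lebesgue_on {-a<..<a}. f x)"
    unfolding LINT_Ioo_eq_integral[OF assms] LINT_Ioo_eq_integral[OF i]
    using Henstock_Kurzweil_Integration.integral_reflect_real[where f = f and a = "-a" and b = a] by simp
qed

lemma L2_reflect:
  assumes "f \<in> L2 {-a<..<a}" shows "(\<lambda>x. f (- x)) \<in> L2 {-a<..<a}"
proof -
  have "(\<lambda>x. f (- x)) \<in> borel_measurable (lebesgue_on {-a<..<a})"
    using LINT_reflect(1)[OF L2_integrable[OF assms]] by auto
  moreover have "integrable (lebesgue_on {-a<..<a}) (\<lambda>x. complex_of_real ((cmod (f x))\<^sup>2))"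
    using L2_square_integrable[OF assms] by (simp only: complex_of_real_integrable_eq)
  from LINT_reflect(1)[OF this]
  have "integrable (lebesgue_on {-a<..<a}) (\<lambda>x. (cmod (f (- x)))\<^sup>2)"
    by (simp only: complex_of_real_integrable_eq)
  ultimately show ?thesis by (simp add: L2_def)
qed

lemma L2_inner_reflect:
  assumes "f \<in> L2 {-a<..<a}" "g \<in> L2 {-a<..<a}"
  shows "L2_inner {-a<..<a} (\<lambda>x. f (- x)) g = L2_inner {-a<..<a} f (\<lambda>x. g (- x))"
  using LINT_reflect(2)[OF L2_inner_integrable[OF assms(1) L2_reflect[OF assms(2)]]]
  by (simp add: L2_inner_def)

lemma L2_norm_reflect:
  assumes "f \<in> L2 {-a<..<a}"
  shows "L2_norm {-a<..<a} (\<lambda>x. f (- x)) = L2_norm {-a<..<a} f"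
proof -
  have "complex_of_real ((L2_norm {-a<..<a} (\<lambda>x. f (- x)))\<^sup>2) = complex_of_real ((L2_norm {-a<..<a} f)\<^sup>2)"
    using L2_inner_reflect[OF assms L2_reflect[OF assms]]
    by (simp add: L2_inner_self assms L2_reflect)
  then show ?thesis
    by (simp only: of_real_eq_iff power2_eq_iff_nonneg L2_norm_nonneg)
qed

text \<open>Starting the primitive at the other end is harmless because \<open>g\<close> has
  integral zero over the whole interval, a consequence of the two Neumann conditions.\<close>

lemma neumann_rep_reflect:
  assumes "neumann_rep a f p g"
    and "a > 0"
  shows "neumann_rep a (\<lambda>x. f (- x)) (\<lambda>x. - p (- x)) (\<lambda>x. g (- x))"
proof -
  have True: "a \<ge> 0" using \<open>a > 0\<close> by simp
  note A = neumann_repD[OF assms(1)]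
  have pa: "p (-a) = 0" using A(2)[of "-a"] True by simp
  show ?thesis unfolding neumann_rep_def
  proof (intro conjI ballI)
    show "(\<lambda>x. g (- x)) \<in> L2 {-a<..<a}" by (rule L2_reflect[OF A(1)])
    show "- p (- a) = 0" using pa by simp
    fix x assume x: "x \<in> {-a..a}"
    have "integral {-a..x} (\<lambda>x. g (- x)) = integral {-x..a} g"
      using Henstock_Kurzweil_Integration.integral_reflect_real[where f = g and a = "-x" and b = a] by simp
    also have "\<dots> = integral {-a..a} g - integral {-a..-x} g"
      using Henstock_Kurzweil_Integration.integral_combine[OF _ _ A(10), of "-x"] x by (simp add: algebra_simps)
    also have "\<dots> = - p (- x)" using A(2)[of a] A(2)[of "-x"] A(3) x True by simp
    finally show "- p (- x) = integral {-a..x} (\<lambda>x. g (- x))" ..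
    have "((f \<circ> uminus) has_vector_derivative (- 1) *\<^sub>R p (- x)) (at x within {-a..a})"
    proof (rule vector_diff_chain_within)
      show "(uminus has_vector_derivative - 1) (at x within {-a..a})"
        by (auto intro!: derivative_eq_intros)
      show "(f has_vector_derivative p (- x)) (at (- x) within uminus ` {-a..a})"
        using A(4)[of "-x"] x by simp
    qed
    then show "((\<lambda>x. f (- x)) has_vector_derivative - p (- x)) (at x within {-a..a})"
      by (simp add: comp_def)
  qed

qed

text \<open>No boundary term appears because \<open>p\<close> vanishes at both ends;
  \<open>Q\<close> is therefore free of boundary conditions, which allows the nonlinear term in its
  place.\<close>

lemma neumann_rep_parts:
  assumes rep: "neumann_rep a f p g" and h: "h \<in> L2 {-a<..<a}"
    and Q: "\<And>x. x \<in> {-a..a} \<Longrightarrow> Q x = k + integral {-a..x} h" and "a > 0"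
  shows "(LINT x|lebesgue_on {-a<..<a}. g x * Q x) = - (LINT x|lebesgue_on {-a<..<a}. p x * h x)"
proof -
  let ?M = "lebesgue_on {-a<..<a}"
  note A = neumann_repD[OF rep]
  have hc: "continuous_on {-a..a} (\<lambda>x. integral {-a..x} h)"
    by (intro indefinite_integral_continuous_1 integrable_Ioo_integrable_on L2_integrable h)
  have i: "integrable ?M (\<lambda>x. integral {-a..x} h * g x)"
    by (rule integrable_Ioo_mult_continuous[OF A(9) hc])
  have "(LINT x|?M. g x * Q x) = (LINT x|?M. k * g x + integral {-a..x} h * g x)"
    by (rule Bochner_Integration.integral_cong) (auto simp: Q algebra_simps)
  also have "\<dots> = (LINT x|?M. k * g x) + (LINT x|?M. integral {-a..x} h * g x)"
    by (rule Bochner_Integration.integral_add[OF _ i]) (use A(9) in simp)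
  also have "(LINT x|?M. k * g x) = k * (LINT x|?M. g x)" by (rule integral_mult_right_zero)
  also have "(LINT x|?M. g x) = integral {-a..a} g" by (rule LINT_Ioo_eq_integral[OF A(9)])
  also have "integral {-a..a} g = 0" using A(2)[of a] A(3) \<open>a > 0\<close> by simp
  also have "(LINT x|?M. integral {-a..x} h * g x) = (LINT y|?M. h y * integral {y..a} g)"
    by (rule integral_primitive_swap[OF L2_integrable[OF h] A(9)])
  also have "\<dots> = (LINT y|?M. - (p y * h y))"
  proof (rule Bochner_Integration.integral_cong)
    fix y assume "y \<in> space ?M"
    then have y: "y \<in> {-a..a}" by simp
    have "integral {y..a} g = p a - p y"
      using Henstock_Kurzweil_Integration.integral_combine[OF _ _ A(10), of y] y A(2)[OF y] A(2)[of a] \<open>a > 0\<close>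
      by (simp add: algebra_simps)
    then show "h y * integral {y..a} g = - (p y * h y)" using A(3) by simp
  qed simp
  finally show ?thesis by simp
qed

lemma neumann_rep_green:
  assumes f: "neumann_rep a f p g" and w: "neumann_rep a w q r" and "a > 0"
  shows "L2_inner {-a<..<a} g w = - L2_inner {-a<..<a} p q"
proof -
  note B = neumann_repD[OF neumann_rep_cnj[OF w]]
  show ?thesis unfolding L2_inner_def
    by (rule neumann_rep_parts[OF f B(7) primitive_of_derivative[OF B(4)] \<open>a > 0\<close>])
qed

lemma Re_L2_inner_sum_diff:
  assumes "f \<in> L2 S" "g \<in> L2 S"
  shows "Re (L2_inner S (\<lambda>x. f x + g x) (\<lambda>x. f x - g x)) = (L2_norm S f)\<^sup>2 - (L2_norm S g)\<^sup>2"
proof -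
  have "Re (L2_inner S g f) = Re (L2_inner S f g)" by (subst L2_inner_commute) simp
  then show ?thesis
    by (simp add: L2_inner_add_left L2_inner_diff_right L2_diff assms L2_inner_self)
qed

text \<open>A difference of squared norms is the real part of the pairing of sum and difference;
  Green's formula moves both derivatives onto the sum. This is the hypothesis \<open>E\<close> of
  \<open>energy_deriv\<close> for the gradient norm.\<close>

lemma energy_difference:
  assumes f: "neumann_rep a f p g" and w: "neumann_rep a w q r" and "a > 0"
  shows "(L2_norm {-a<..<a} p)\<^sup>2 - (L2_norm {-a<..<a} q)\<^sup>2
    = - Re (L2_inner {-a<..<a} (\<lambda>x. g x + r x) (\<lambda>x. f x - w x))"
  using neumann_rep_green[OF neumann_rep_add[OF f w] neumann_rep_diff[OF f w] \<open>a > 0\<close>]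
    Re_L2_inner_sum_diff[OF neumann_repD(7)[OF f] neumann_repD(7)[OF w]]
  by simp

text \<open>As \<open>p\<close> vanishes at \<open>- a\<close>, it is bounded by the L1 norm of
  \<open>g\<close>; the factor is Cauchy-Schwarz on an interval of length \<open>2 * a\<close>.
  Together with \<open>neumann_rep_sup_le\<close> it gives the embedding of H^2 into C^1.\<close>

lemma neumann_rep_deriv_le:
  assumes rep: "neumann_rep a f p g" and x: "x \<in> {-a..a}"
  shows "cmod (p x) \<le> sqrt (2 * a) * L2_norm {-a<..<a} g"
proof -
  let ?M = "lebesgue_on {-a<..<a}"
  note A = neumann_repD[OF rep]
  have "cmod (p x) = cmod (LINT y|?M. indicator {..<x} y *\<^sub>R g y)"
    using A(2)[OF x] integral_upto_eq_LINT[OF A(9) x] by simp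
  also have "\<dots> \<le> (LINT y|?M. cmod (indicator {..<x} y *\<^sub>R g y))" by (rule integral_norm_bound)
  also have "\<dots> \<le> (LINT y|?M. cmod (g y))"
    using A(9) integrable_Ioo_indicator[OF A(9), of "{..<x}"]
    by (intro integral_mono integrable_norm) (auto simp: indicator_def)
  also have "\<dots> \<le> L2_norm {-a<..<a} g * sqrt (a - (-a))"
    by (rule L1_le_L2_norm[OF A(1)]) (use x in auto)
  finally show ?thesis by (simp add: mult.commute)
qed

lemma neumann_rep_lipschitz:
  assumes rep: "neumann_rep a f p g" and x: "x \<in> {-a..a}" and y: "y \<in> {-a..a}"
    and B: "\<And>z. z \<in> {-a..a} \<Longrightarrow> cmod (p z) \<le> B"
  shows "cmod (f x - f y) \<le> B * \<bar>x - y\<bar>"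
proof -
  have "norm (f x - f y) \<le> B * norm (x - y)"
  proof (rule differentiable_bound[of "{-a..a}" f "\<lambda>z h. h *\<^sub>R p z"])
    fix z assume z: "z \<in> {-a..a}"
    show "(f has_derivative (\<lambda>h. h *\<^sub>R p z)) (at z within {-a..a})"
      using neumann_repD(4)[OF rep z] by (simp add: has_vector_derivative_def)
    show "onorm (\<lambda>h. h *\<^sub>R p z) \<le> B"
    proof (rule onorm_bound)
      show "0 \<le> B" using order_trans[OF norm_ge_zero B[OF z]] .
      show "norm (h *\<^sub>R p z) \<le> B * norm h" for h
        using mult_right_mono[OF B[OF z] norm_ge_zero[of h]] by (simp add: mult.commute)
    qed
  qed (use x y in auto)
  then show ?thesis by simp
qed

text \<open>The Lipschitz estimate between \<open>x\<close> and \<open>y\<close> is integrated over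
  \<open>y\<close>, which replaces a point value by a norm; the factor \<open>2 * a\<close> on the
  left is the length of the interval.\<close>

lemma neumann_rep_sup_le:
  assumes rep: "neumann_rep a f p g" and x: "x \<in> {-a..a}" and "a > 0"
  shows "2 * a * cmod (f x) \<le> sqrt (2 * a) * L2_norm {-a<..<a} f + 4 * a\<^sup>2 * sqrt (2 * a) * L2_norm {-a<..<a} g"
proof -
  let ?M = "lebesgue_on {-a<..<a}"
  note A = neumann_repD[OF rep]
  let ?B = "sqrt (2 * a) * L2_norm {-a<..<a} g"
  have B0: "?B \<ge> 0" using \<open>a > 0\<close> by (simp add: L2_norm_nonneg)
  have le: "cmod (f x) \<le> cmod (f y) + 2 * a * ?B" if y: "y \<in> {-a<..<a}" for y
  proof -
    have "cmod (f x) \<le> cmod (f y) + cmod (f x - f y)" by (rule norm_triangle_sub)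
    also have "cmod (f x - f y) \<le> ?B * \<bar>x - y\<bar>"
      using y by (intro neumann_rep_lipschitz[OF rep x] neumann_rep_deriv_le[OF rep]) auto
    also have "\<dots> \<le> ?B * (2 * a)" using x y by (intro mult_left_mono B0) auto
    finally show ?thesis by (simp add: mult.commute)
  qed
  have meas: "measure ?M (space ?M) = 2 * a" using \<open>a > 0\<close> by (simp add: measure_restrict_space)
  have fin: "finite_measure ?M" by (rule finite_measure_lebesgue_on) simp
  have int: "integrable ?M (\<lambda>y. cmod (f y))" by (intro integrable_norm L2_integrable A)
  have "(LINT y|?M. cmod (f x)) \<le> (LINT y|?M. cmod (f y) + 2 * a * ?B)"
    using le int
    by (intro integral_mono finite_measure.integrable_const[OF fin] Bochner_Integration.integrable_add) auto
  also have "\<dots> = (LINT y|?M. cmod (f y)) + (LINT y|?M. 2 * a * ?B)"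
    by (intro Bochner_Integration.integral_add int finite_measure.integrable_const[OF fin])
  also have "(LINT y|?M. cmod (f y)) \<le> L2_norm {-a<..<a} f * sqrt (a - (-a))"
    by (rule L1_le_L2_norm[OF A(8)]) (use \<open>a > 0\<close> in simp)
  finally show ?thesis unfolding lebesgue_integral_const meas
    by (simp add: power2_eq_square algebra_simps)
qed

section \<open>Differentiable curves of square integrable functions\<close>

text \<open>Differentiability is asked only after pairing with a fixed \<open>z\<close>, the form in
  which a weak time derivative is given. Norm continuity of \<open>v\<close> upgrades it to
  differentiability in norm, see \<open>time_C1_strong\<close>.\<close>

definition time_C1 :: "real set \<Rightarrow> (real \<Rightarrow> real \<Rightarrow> complex) \<Rightarrow> (real \<Rightarrow> real \<Rightarrow> complex) \<Rightarrow> bool" where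
  "time_C1 \<Omega> w v \<longleftrightarrow> (\<forall>t. w t \<in> L2 \<Omega> \<and> v t \<in> L2 \<Omega>) \<and>
     (\<forall>t. \<forall>z\<in>L2 \<Omega>. ((\<lambda>s. L2_inner \<Omega> (w s) z) has_vector_derivative L2_inner \<Omega> (v t) z) (at t)) \<and>
     (\<forall>t. ((\<lambda>s. L2_norm \<Omega> (\<lambda>x. v s x - v t x)) \<longlongrightarrow> 0) (at t))"

lemma time_C1D:
  assumes "time_C1 \<Omega> w v"
  shows "w t \<in> L2 \<Omega>" "v t \<in> L2 \<Omega>"
    "z \<in> L2 \<Omega> \<Longrightarrow> ((\<lambda>s. L2_inner \<Omega> (w s) z) has_vector_derivative L2_inner \<Omega> (v t) z) (at t)"
    "((\<lambda>s. L2_norm \<Omega> (\<lambda>x. v s x - v t x)) \<longlongrightarrow> 0) (at t)"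
  using assms by (auto simp: time_C1_def)

text \<open>The mean value inequality is applied to the pairing with the remainder itself;
  cancelling one factor of its norm turns a scalar estimate into a norm estimate.\<close>

lemma time_C1_strong:
  assumes "time_C1 \<Omega> w v"
  shows "((\<lambda>s. L2_norm \<Omega> (\<lambda>x. w s x - w t x - complex_of_real (s - t) * v t x) / \<bar>s - t\<bar>) \<longlongrightarrow> 0) (at t)"
proof (rule LIM_I)
  fix e :: real assume "e > 0"
  note T = time_C1D[OF assms]
  obtain \<delta> where \<delta>: "\<delta> > 0" "\<And>r. r \<noteq> t \<Longrightarrow> \<bar>r - t\<bar> < \<delta> \<Longrightarrow> L2_norm \<Omega> (\<lambda>x. v r x - v t x) < e / 2"
    using LIM_D[OF T(4)[of t], of "e / 2"] \<open>e > 0\<close> by (auto simp: L2_norm_nonneg)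
  have near: "L2_norm \<Omega> (\<lambda>x. v r x - v t x) \<le> e / 2" if "\<bar>r - t\<bar> < \<delta>" for r
    using \<delta>(2)[of r] that \<open>e > 0\<close> by (cases "r = t") (auto simp: L2_norm_def)
  have "L2_norm \<Omega> (\<lambda>x. w s x - w t x - complex_of_real (s - t) * v t x) \<le> (e / 2) * \<bar>s - t\<bar>"
    if s: "\<bar>s - t\<bar> < \<delta>" for s
  proof -
    define z where "z x = w s x - w t x - complex_of_real (s - t) * v t x" for x
    have z: "z \<in> L2 \<Omega>" unfolding z_def by (intro L2_diff L2_scale T)
    define h where "h r = Re (L2_inner \<Omega> (w r) z) - (r - t) * Re (L2_inner \<Omega> (v t) z)" for r
    have der: "(h has_real_derivative Re (L2_inner \<Omega> (v r) z) - Re (L2_inner \<Omega> (v t) z)) (at r)" for r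
    proof -
      have "((\<lambda>r. Re (L2_inner \<Omega> (w r) z)) has_real_derivative Re (L2_inner \<Omega> (v r) z)) (at r)"
        using bounded_linear.has_vector_derivative[OF bounded_linear_Re T(3)[OF z, of r]]
        by (simp add: has_real_derivative_iff_has_vector_derivative)
      moreover have "((\<lambda>r. (r - t) * Re (L2_inner \<Omega> (v t) z)) has_real_derivative Re (L2_inner \<Omega> (v t) z)) (at r)"
        by (auto intro!: derivative_eq_intros)
      ultimately show ?thesis unfolding h_def by (rule DERIV_diff)
    qed
    have "norm (h s - h t) \<le> (e / 2 * L2_norm \<Omega> z) * norm (s - t)"
    proof (rule field_differentiable_bound[where S = "ball t \<delta>"])
      fix r assume "r \<in> ball t \<delta>"
      then have r: "\<bar>r - t\<bar> < \<delta>" by (simp add: dist_real_def abs_minus_commute)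
      show "(h has_real_derivative Re (L2_inner \<Omega> (v r) z) - Re (L2_inner \<Omega> (v t) z)) (at r within ball t \<delta>)"
        using der[of r] by (rule has_field_derivative_at_within)
      have "\<bar>Re (L2_inner \<Omega> (v r) z) - Re (L2_inner \<Omega> (v t) z)\<bar> = \<bar>Re (L2_inner \<Omega> (\<lambda>x. v r x - v t x) z)\<bar>"
        by (simp add: L2_inner_diff_left T z)
      also have "\<dots> \<le> cmod (L2_inner \<Omega> (\<lambda>x. v r x - v t x) z)" by (rule abs_Re_le_cmod)
      also have "\<dots> \<le> L2_norm \<Omega> (\<lambda>x. v r x - v t x) * L2_norm \<Omega> z"
        by (rule L2_inner_le[OF L2_diff[OF T(2) T(2)] z])
      also have "\<dots> \<le> e / 2 * L2_norm \<Omega> z"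
        by (rule mult_right_mono[OF near[OF r] L2_norm_nonneg])
      finally show "norm (Re (L2_inner \<Omega> (v r) z) - Re (L2_inner \<Omega> (v t) z)) \<le> e / 2 * L2_norm \<Omega> z"
        by simp
    qed (use \<delta>(1) s in \<open>auto simp: dist_real_def abs_minus_commute\<close>)
    moreover have "h s - h t = (L2_norm \<Omega> z)\<^sup>2"
    proof -
      have "L2_inner \<Omega> z z = L2_inner \<Omega> (w s) z - L2_inner \<Omega> (w t) z - complex_of_real (s - t) * L2_inner \<Omega> (v t) z"
        unfolding z_def
        by (subst L2_inner_diff_left L2_inner_scale_left; (intro L2_diff L2_scale T)?)+ simp
      then have "Re (L2_inner \<Omega> z z) = h s - h t" by (simp add: h_def)
      then show ?thesis using L2_inner_self[OF z] by simp
    qed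
    ultimately have "L2_norm \<Omega> z * L2_norm \<Omega> z \<le> (e / 2 * \<bar>s - t\<bar>) * L2_norm \<Omega> z"
      by (simp add: power2_eq_square mult_ac)
    then have "L2_norm \<Omega> z \<le> e / 2 * \<bar>s - t\<bar>"
      using L2_norm_nonneg[of \<Omega> z] \<open>e > 0\<close> by (cases "L2_norm \<Omega> z = 0") (auto simp: mult_le_cancel_right)
    then show ?thesis unfolding z_def[abs_def] .
  qed
  note bound = this
  show "\<exists>\<delta>>0. \<forall>s. s \<noteq> t \<and> norm (s - t) < \<delta> \<longrightarrow>
    norm (L2_norm \<Omega> (\<lambda>x. w s x - w t x - complex_of_real (s - t) * v t x) / \<bar>s - t\<bar> - 0) < e"
  proof (intro exI[of _ \<delta>] conjI allI impI)
    fix s assume "s \<noteq> t \<and> norm (s - t) < \<delta>"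
    then have "L2_norm \<Omega> (\<lambda>x. w s x - w t x - complex_of_real (s - t) * v t x) \<le> e / 2 * \<bar>s - t\<bar>" "\<bar>s - t\<bar> > 0"
      using bound[of s] by auto
    then have "L2_norm \<Omega> (\<lambda>x. w s x - w t x - complex_of_real (s - t) * v t x) / \<bar>s - t\<bar> \<le> e / 2"
      by (simp add: divide_le_eq)
    moreover have "0 \<le> L2_norm \<Omega> (\<lambda>x. w s x - w t x - complex_of_real (s - t) * v t x) / \<bar>s - t\<bar>"
      by (intro divide_nonneg_nonneg L2_norm_nonneg) simp
    ultimately show "norm (L2_norm \<Omega> (\<lambda>x. w s x - w t x - complex_of_real (s - t) * v t x) / \<bar>s - t\<bar> - 0) < e"
      unfolding diff_0_right real_norm_def using \<open>e > 0\<close> by linarith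
  qed (rule \<delta>(1))
qed

text \<open>\<open>E\<close> is a quadratic form in \<open>w\<close> with \<open>E s - E t = Re \<langle>A (w s + w t), w s - w t\<rangle>\<close>, where \<open>R = A w\<close>; below
  \<open>A\<close> is the identity or the second derivative.\<close>

lemma energy_deriv:
  assumes C1: "time_C1 \<Omega> w v" and R: "\<And>s. R s \<in> L2 \<Omega>"
    and R_cont: "((\<lambda>s. L2_norm \<Omega> (\<lambda>x. R s x - R t x)) \<longlongrightarrow> 0) (at t)"
    and E: "\<And>s. E s - E t = Re (L2_inner \<Omega> (\<lambda>x. R s x + R t x) (\<lambda>x. w s x - w t x))"
  shows "(E has_real_derivative 2 * Re (L2_inner \<Omega> (R t) (v t))) (at t)"
proof -
  note T = time_C1D[OF C1]
  define \<rho> where "\<rho> s = L2_norm \<Omega> (\<lambda>x. R s x - R t x)" for s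
  define \<delta> where "\<delta> s = L2_norm \<Omega> (\<lambda>x. w s x - w t x - complex_of_real (s - t) * v t x) / \<bar>s - t\<bar>" for s
  have lim: "((\<lambda>s. (2 * L2_norm \<Omega> (R t) + \<rho> s) * \<delta> s + \<rho> s * L2_norm \<Omega> (v t)) \<longlongrightarrow>
      (2 * L2_norm \<Omega> (R t) + 0) * 0 + 0 * L2_norm \<Omega> (v t)) (at t)"
    unfolding \<rho>_def \<delta>_def by (intro tendsto_intros R_cont time_C1_strong[OF C1])
  \<comment> \<open>Write \<open>R s + R t\<close> as \<open>2 R t\<close> plus the increment of
    \<open>R\<close>, and \<open>w s - w t\<close> as \<open>(s - t) v t\<close> plus the remainder
    \<open>z\<close>; all terms except the claimed derivative are then small.\<close>
  have bound: "\<bar>(E s - E t) / (s - t) - 2 * Re (L2_inner \<Omega> (R t) (v t))\<bar>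
      \<le> (2 * L2_norm \<Omega> (R t) + \<rho> s) * \<delta> s + \<rho> s * L2_norm \<Omega> (v t)" if "s \<noteq> t" for s
  proof -
    define z where "z x = w s x - w t x - complex_of_real (s - t) * v t x" for x
    have z: "z \<in> L2 \<Omega>" unfolding z_def by (intro L2_diff L2_scale T)
    have sum: "(\<lambda>x. R s x + R t x) \<in> L2 \<Omega>" by (intro L2_add R)
    have dif: "(\<lambda>x. R s x - R t x) \<in> L2 \<Omega>" by (intro L2_diff R)
    have "(\<lambda>x. w s x - w t x) = (\<lambda>x. z x + complex_of_real (s - t) * v t x)" by (simp add: z_def)
    then have "E s - E t = Re (L2_inner \<Omega> (\<lambda>x. R s x + R t x) z) + (s - t) * Re (L2_inner \<Omega> (\<lambda>x. R s x + R t x) (v t))"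
      using E[of s] by (simp add: L2_inner_add_right[OF z L2_scale[OF T(2)] sum] L2_inner_scale_right)
    moreover have "L2_inner \<Omega> (\<lambda>x. R s x + R t x) (v t) = 2 * L2_inner \<Omega> (R t) (v t) + L2_inner \<Omega> (\<lambda>x. R s x - R t x) (v t)"
      by (simp add: L2_inner_add_left L2_inner_diff_left R T)
    ultimately have "(E s - E t) / (s - t) - 2 * Re (L2_inner \<Omega> (R t) (v t)) =
        Re (L2_inner \<Omega> (\<lambda>x. R s x + R t x) z) / (s - t) + Re (L2_inner \<Omega> (\<lambda>x. R s x - R t x) (v t))"
      using that by (simp add: field_simps)
    also have "\<bar>\<dots>\<bar> \<le> \<bar>Re (L2_inner \<Omega> (\<lambda>x. R s x + R t x) z)\<bar> / \<bar>s - t\<bar> + \<bar>Re (L2_inner \<Omega> (\<lambda>x. R s x - R t x) (v t))\<bar>"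
      using abs_triangle_ineq by (simp only: abs_divide[symmetric])
    also have "\<dots> \<le> (2 * L2_norm \<Omega> (R t) + \<rho> s) * \<delta> s + \<rho> s * L2_norm \<Omega> (v t)"
    proof (rule add_mono)
      have "L2_norm \<Omega> (\<lambda>x. R s x + R t x) \<le> L2_norm \<Omega> (R s) + L2_norm \<Omega> (R t)" by (rule L2_norm_triangle[OF R R])
      also have "L2_norm \<Omega> (R s) \<le> L2_norm \<Omega> (R t) + \<rho> s" unfolding \<rho>_def by (rule L2_norm_triangle_le[OF R R])
      finally have n: "L2_norm \<Omega> (\<lambda>x. R s x + R t x) \<le> 2 * L2_norm \<Omega> (R t) + \<rho> s" by simp
      have "\<bar>Re (L2_inner \<Omega> (\<lambda>x. R s x + R t x) z)\<bar> \<le> L2_norm \<Omega> (\<lambda>x. R s x + R t x) * L2_norm \<Omega> z"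
        using L2_inner_le[OF sum z] abs_Re_le_cmod order_trans by blast
      also have "\<dots> \<le> (2 * L2_norm \<Omega> (R t) + \<rho> s) * L2_norm \<Omega> z"
        by (rule mult_right_mono[OF n L2_norm_nonneg])
      finally show "\<bar>Re (L2_inner \<Omega> (\<lambda>x. R s x + R t x) z)\<bar> / \<bar>s - t\<bar> \<le> (2 * L2_norm \<Omega> (R t) + \<rho> s) * \<delta> s"
        unfolding \<delta>_def z_def[abs_def, symmetric] by (simp add: divide_right_mono)
      show "\<bar>Re (L2_inner \<Omega> (\<lambda>x. R s x - R t x) (v t))\<bar> \<le> \<rho> s * L2_norm \<Omega> (v t)"
        unfolding \<rho>_def using L2_inner_le[OF dif T(2)] abs_Re_le_cmod order_trans by blast
    qed
    finally show ?thesis .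
  qed
  have "((\<lambda>s. (E s - E t) / (s - t) - 2 * Re (L2_inner \<Omega> (R t) (v t))) \<longlongrightarrow> 0) (at t)"
  proof (rule tendsto_rabs_zero_cancel, rule tendsto_sandwich[OF _ _ tendsto_const])
    show "\<forall>\<^sub>F s in at t. \<bar>(E s - E t) / (s - t) - 2 * Re (L2_inner \<Omega> (R t) (v t))\<bar>
       \<le> (2 * L2_norm \<Omega> (R t) + \<rho> s) * \<delta> s + \<rho> s * L2_norm \<Omega> (v t)"
      using bound by (auto simp: eventually_at_filter)
    show "((\<lambda>s. (2 * L2_norm \<Omega> (R t) + \<rho> s) * \<delta> s + \<rho> s * L2_norm \<Omega> (v t)) \<longlongrightarrow> 0) (at t)"
      using lim by simp
  qed simp
  then show ?thesis
    unfolding has_field_derivative_iff by (rule LIM_zero_cancel)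
qed

lemma time_C1_continuous:
  assumes C1: "time_C1 \<Omega> w v"
  shows "((\<lambda>s. L2_norm \<Omega> (\<lambda>x. w s x - w t x)) \<longlongrightarrow> 0) (at t)"
proof -
  note T = time_C1D[OF C1]
  let ?d = "\<lambda>s. L2_norm \<Omega> (\<lambda>x. w s x - w t x - complex_of_real (s - t) * v t x) / \<bar>s - t\<bar>"
  show ?thesis
  proof (rule tendsto_sandwich[OF _ _ tendsto_const])
    have "L2_norm \<Omega> (\<lambda>x. w s x - w t x) \<le> \<bar>s - t\<bar> * L2_norm \<Omega> (v t) + ?d s * \<bar>s - t\<bar>" if "s \<noteq> t" for s
      using L2_norm_triangle_le[OF L2_diff[OF T(1)[of s] T(1)[of t]] L2_scale[OF T(2)[of t], of "complex_of_real (s - t)"]] that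
      by (simp add: L2_norm_scale del: of_real_diff)
    then show "\<forall>\<^sub>F s in at t. L2_norm \<Omega> (\<lambda>x. w s x - w t x) \<le> \<bar>s - t\<bar> * L2_norm \<Omega> (v t) + ?d s * \<bar>s - t\<bar>"
      by (auto simp: eventually_at_filter)
    have "((\<lambda>s. \<bar>s - t\<bar> * L2_norm \<Omega> (v t) + ?d s * \<bar>s - t\<bar>) \<longlongrightarrow> \<bar>t - t\<bar> * L2_norm \<Omega> (v t) + 0 * \<bar>t - t\<bar>) (at t)"
      by (intro tendsto_intros time_C1_strong[OF C1])
    then show "((\<lambda>s. \<bar>s - t\<bar> * L2_norm \<Omega> (v t) + ?d s * \<bar>s - t\<bar>) \<longlongrightarrow> 0) (at t)" by simp
  qed (simp add: L2_norm_nonneg)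
qed

lemma L2_norm_deriv:
  assumes C1: "time_C1 \<Omega> w v"
  shows "((\<lambda>s. (L2_norm \<Omega> (w s))\<^sup>2) has_real_derivative 2 * Re (L2_inner \<Omega> (w t) (v t))) (at t)"
proof (rule energy_deriv[OF C1])
  show "w s \<in> L2 \<Omega>" for s by (rule time_C1D(1)[OF C1])
  show "((\<lambda>s. L2_norm \<Omega> (\<lambda>x. w s x - w t x)) \<longlongrightarrow> 0) (at t)" by (rule time_C1_continuous[OF C1])
  show "(L2_norm \<Omega> (w s))\<^sup>2 - (L2_norm \<Omega> (w t))\<^sup>2 = Re (L2_inner \<Omega> (\<lambda>x. w s x + w t x) (\<lambda>x. w s x - w t x))" for s
    by (rule Re_L2_inner_sum_diff[symmetric]; rule time_C1D(1)[OF C1])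
qed

text \<open>Here \<open>v\<close> lies only in \<open>L2\<close>, so \<open>q\<close> need not be
  differentiable in time; its norm is, because the difference of energies involves just the second
  derivative \<open>r\<close> and the increment of \<open>w\<close>.\<close>

lemma gradient_norm_deriv:
  assumes C1: "time_C1 {-a<..<a} w v" and rep: "\<And>s. neumann_rep a (w s) (q s) (r s)" and "a > 0"
    and r_cont: "((\<lambda>s. L2_norm {-a<..<a} (\<lambda>x. r s x - r t x)) \<longlongrightarrow> 0) (at t)"
  shows "((\<lambda>s. (L2_norm {-a<..<a} (q s))\<^sup>2) has_real_derivative - 2 * Re (L2_inner {-a<..<a} (r t) (v t))) (at t)"
proof -
  let ?\<Omega> = "{-a<..<a}"
  have "((\<lambda>s. - (L2_norm ?\<Omega> (q s))\<^sup>2) has_real_derivative 2 * Re (L2_inner ?\<Omega> (r t) (v t))) (at t)"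
  proof (rule energy_deriv[OF C1])
    show "r s \<in> L2 ?\<Omega>" for s by (rule neumann_repD(1)[OF rep])
    show "((\<lambda>s. L2_norm ?\<Omega> (\<lambda>x. r s x - r t x)) \<longlongrightarrow> 0) (at t)" by (rule r_cont)
    show "- (L2_norm ?\<Omega> (q s))\<^sup>2 - - (L2_norm ?\<Omega> (q t))\<^sup>2 = Re (L2_inner ?\<Omega> (\<lambda>x. r s x + r t x) (\<lambda>x. w s x - w t x))" for s
      using energy_difference[OF rep[of s] rep[of t] \<open>a > 0\<close>] by simp
  qed
  from DERIV_minus[OF this] show ?thesis by simp
qed

section \<open>Operations on differentiable curves\<close>

lemma L2_norm_diff_tendsto:
  assumes "\<And>s. f s \<in> L2 \<Omega>" "\<And>s. g s \<in> L2 \<Omega>"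
    and "((\<lambda>s. L2_norm \<Omega> (\<lambda>x. f s x - f t x)) \<longlongrightarrow> 0) (at t)" "((\<lambda>s. L2_norm \<Omega> (\<lambda>x. g s x - g t x)) \<longlongrightarrow> 0) (at t)"
  shows "((\<lambda>s. L2_norm \<Omega> (\<lambda>x. (f s x + g s x) - (f t x + g t x))) \<longlongrightarrow> 0) (at t)"
proof (rule tendsto_sandwich[OF _ _ tendsto_const])
  show "\<forall>\<^sub>F s in at t. L2_norm \<Omega> (\<lambda>x. (f s x + g s x) - (f t x + g t x))
      \<le> L2_norm \<Omega> (\<lambda>x. f s x - f t x) + L2_norm \<Omega> (\<lambda>x. g s x - g t x)"
  proof (rule always_eventually, rule allI)
    fix s
    show "L2_norm \<Omega> (\<lambda>x. (f s x + g s x) - (f t x + g t x))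
      \<le> L2_norm \<Omega> (\<lambda>x. f s x - f t x) + L2_norm \<Omega> (\<lambda>x. g s x - g t x)"
      using L2_norm_triangle[OF L2_diff[OF assms(1,1)] L2_diff[OF assms(2,2)], of s t s t]
      by (simp add: algebra_simps)
  qed
  show "((\<lambda>s. L2_norm \<Omega> (\<lambda>x. f s x - f t x) + L2_norm \<Omega> (\<lambda>x. g s x - g t x)) \<longlongrightarrow> 0) (at t)"
    using tendsto_add[OF assms(3,4)] by simp
qed (simp add: L2_norm_nonneg)

lemma L2_norm_scale_tendsto:
  assumes "((\<lambda>s. L2_norm \<Omega> (\<lambda>x. f s x - f t x)) \<longlongrightarrow> 0) (at t)"
  shows "((\<lambda>s. L2_norm \<Omega> (\<lambda>x. c * f s x - c * f t x)) \<longlongrightarrow> 0) (at t)"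
  unfolding right_diff_distrib[symmetric] L2_norm_scale
  using tendsto_mult_right_zero[OF assms] by simp

lemma time_C1_add:
  assumes "time_C1 \<Omega> w v" "time_C1 \<Omega> w' v'"
  shows "time_C1 \<Omega> (\<lambda>t x. w t x + w' t x) (\<lambda>t x. v t x + v' t x)"
  unfolding time_C1_def
proof (intro conjI allI ballI)
  note A = time_C1D[OF assms(1)] and B = time_C1D[OF assms(2)]
  show "(\<lambda>x. w t x + w' t x) \<in> L2 \<Omega>" "(\<lambda>x. v t x + v' t x) \<in> L2 \<Omega>" for t by (intro L2_add A B)+
  show "((\<lambda>s. L2_norm \<Omega> (\<lambda>x. (v s x + v' s x) - (v t x + v' t x))) \<longlongrightarrow> 0) (at t)" for t
    by (intro L2_norm_diff_tendsto A B)
  show "((\<lambda>s. L2_inner \<Omega> (\<lambda>x. w s x + w' s x) z) has_vector_derivative L2_inner \<Omega> (\<lambda>x. v t x + v' t x) z) (at t)"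
    if "z \<in> L2 \<Omega>" for t z
    unfolding L2_inner_add_left[OF A(1) B(1) that] L2_inner_add_left[OF A(2) B(2) that]
    by (intro has_vector_derivative_add A B that)
qed

lemma time_C1_scale:
  assumes "time_C1 \<Omega> w v"
  shows "time_C1 \<Omega> (\<lambda>t x. c * w t x) (\<lambda>t x. c * v t x)"
  unfolding time_C1_def
proof (intro conjI allI ballI)
  note A = time_C1D[OF assms]
  show "(\<lambda>x. c * w t x) \<in> L2 \<Omega>" "(\<lambda>x. c * v t x) \<in> L2 \<Omega>" for t by (intro L2_scale A)+
  show "((\<lambda>s. L2_norm \<Omega> (\<lambda>x. c * v s x - c * v t x)) \<longlongrightarrow> 0) (at t)" for t
    by (intro L2_norm_scale_tendsto A)
  show "((\<lambda>s. L2_inner \<Omega> (\<lambda>x. c * w s x) z) has_vector_derivative L2_inner \<Omega> (\<lambda>x. c * v t x) z) (at t)"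
    if "z \<in> L2 \<Omega>" for t z
    unfolding L2_inner_scale_left by (intro has_vector_derivative_mult_right A that)
qed

lemma time_C1_diff:
  assumes "time_C1 \<Omega> w v" "time_C1 \<Omega> w' v'"
  shows "time_C1 \<Omega> (\<lambda>t x. w t x - w' t x) (\<lambda>t x. v t x - v' t x)"
  using time_C1_add[OF assms(1) time_C1_scale[OF assms(2), of "-1"]] by simp

lemma time_C1_const: "f \<in> L2 \<Omega> \<Longrightarrow> time_C1 \<Omega> (\<lambda>t. f) (\<lambda>t x. 0)"
  by (auto simp: time_C1_def L2_norm_def L2_inner_def L2_def)

lemma time_C1_shift:
  assumes "time_C1 \<Omega> w v"
  shows "time_C1 \<Omega> (\<lambda>t. w (t + h)) (\<lambda>t. v (t + h))"
  unfolding time_C1_def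
proof (intro conjI allI ballI)
  note A = time_C1D[OF assms]
  show "w (t + h) \<in> L2 \<Omega>" "v (t + h) \<in> L2 \<Omega>" for t by (rule A)+
  show "((\<lambda>s. L2_norm \<Omega> (\<lambda>x. v (s + h) x - v (t + h) x)) \<longlongrightarrow> 0) (at t)" for t
    using LIM_offset[OF A(4)[of "t + h"], of h] by simp
  show "((\<lambda>s. L2_inner \<Omega> (w (s + h)) z) has_vector_derivative L2_inner \<Omega> (v (t + h)) z) (at t)"
    if "z \<in> L2 \<Omega>" for t z
  proof -
    have "((\<lambda>s. s + h) has_vector_derivative 1) (at t)" by (auto intro!: derivative_eq_intros)
    from vector_diff_chain_at[OF this A(3)[OF that]] show ?thesis by (simp add: comp_def)
  qed
qed

lemma time_C1_reflect:
  assumes "time_C1 {-a<..<a} w v"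
  shows "time_C1 {-a<..<a} (\<lambda>t x. w t (- x)) (\<lambda>t x. v t (- x))"
  unfolding time_C1_def
proof (intro conjI allI ballI)
  note A = time_C1D[OF assms]
  show "(\<lambda>x. w t (- x)) \<in> L2 {-a<..<a}" "(\<lambda>x. v t (- x)) \<in> L2 {-a<..<a}" for t by (intro L2_reflect A)+
  show "((\<lambda>s. L2_norm {-a<..<a} (\<lambda>x. v s (- x) - v t (- x))) \<longlongrightarrow> 0) (at t)" for t
    using L2_norm_reflect[OF L2_diff[OF A(2) A(2)]] A(4)[of t] by simp
  show "((\<lambda>s. L2_inner {-a<..<a} (\<lambda>x. w s (- x)) z) has_vector_derivative L2_inner {-a<..<a} (\<lambda>x. v t (- x)) z) (at t)"
    if "z \<in> L2 {-a<..<a}" for t z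
    unfolding L2_inner_reflect[OF A(1) that] L2_inner_reflect[OF A(2) that]
    by (rule A(3)[OF L2_reflect[OF that]])
qed

text \<open>The function f(s) exp(- \<alpha> s) - \<beta> s is nonincreasing, because exp(- \<alpha>
  s) is at most 1 for s nonnegative.\<close>

lemma gronwall_forward:
  fixes f f' :: "real \<Rightarrow> real"
  assumes "T \<ge> 0" "\<alpha> \<ge> 0" "\<beta> \<ge> 0"
    and der: "\<And>s. 0 \<le> s \<Longrightarrow> s \<le> T \<Longrightarrow> (f has_real_derivative f' s) (at s)"
    and le: "\<And>s. 0 \<le> s \<Longrightarrow> s \<le> T \<Longrightarrow> f' s \<le> \<alpha> * f s + \<beta>"
  shows "f T \<le> (f 0 + \<beta> * T) * exp (\<alpha> * T)"
proof -
  have "f T * exp (- \<alpha> * T) - \<beta> * T \<le> f 0 * exp (- \<alpha> * 0) - \<beta> * 0"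
  proof (rule DERIV_nonpos_imp_nonincreasing[OF \<open>T \<ge> 0\<close>])
    fix s assume s: "0 \<le> s" "s \<le> T"
    have "((\<lambda>s. f s * exp (- \<alpha> * s) - \<beta> * s) has_real_derivative (f' s - \<alpha> * f s) * exp (- \<alpha> * s) - \<beta>) (at s)"
      by (rule derivative_eq_intros der[OF s] refl | simp add: algebra_simps)+
    moreover have "(f' s - \<alpha> * f s) * exp (- \<alpha> * s) - \<beta> \<le> 0"
    proof -
      have "(f' s - \<alpha> * f s) * exp (- \<alpha> * s) \<le> \<beta> * exp (- \<alpha> * s)"
        using le[OF s] by (intro mult_right_mono) auto
      also have "\<dots> \<le> \<beta> * 1" using assms s by (intro mult_left_mono) auto
      finally show ?thesis by simp
    qed
    ultimately show "\<exists>y. ((\<lambda>s. f s * exp (- \<alpha> * s) - \<beta> * s) has_real_derivative y) (at s) \<and> y \<le> 0" by blast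
  qed
  then have "f T * exp (- \<alpha> * T) \<le> f 0 + \<beta> * T" by simp
  then have "f T * exp (- \<alpha> * T) * exp (\<alpha> * T) \<le> (f 0 + \<beta> * T) * exp (\<alpha> * T)"
    by (intro mult_right_mono) auto
  then show ?thesis by (simp add: mult.assoc flip: exp_add)
qed

text \<open>Bounding the absolute value of the derivative makes the estimate symmetric under time
  reversal, which gives both signs of \<open>t\<close>.\<close>

lemma gronwall:
  fixes f f' :: "real \<Rightarrow> real"
  assumes "\<alpha> \<ge> 0" "\<beta> \<ge> 0"
    and der: "\<And>s. \<bar>s\<bar> \<le> \<bar>t\<bar> \<Longrightarrow> (f has_real_derivative f' s) (at s)"
    and le: "\<And>s. \<bar>s\<bar> \<le> \<bar>t\<bar> \<Longrightarrow> \<bar>f' s\<bar> \<le> \<alpha> * f s + \<beta>"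
  shows "f t \<le> (f 0 + \<beta> * \<bar>t\<bar>) * exp (\<alpha> * \<bar>t\<bar>)"
proof (cases "t \<ge> 0")
  case True
  then show ?thesis
    using gronwall_forward[of t \<alpha> \<beta> f f'] assms by (auto simp: abs_le_iff)
next
  case False
  have "f (- (-t)) \<le> (f (- 0) + \<beta> * (-t)) * exp (\<alpha> * (-t))"
  proof (rule gronwall_forward[of _ _ _ "\<lambda>s. f (- s)" "\<lambda>s. - f' (- s)"])
    fix s assume s: "0 \<le> s" "s \<le> - t"
    then have *: "\<bar>- s\<bar> \<le> \<bar>t\<bar>" using False by simp
    show "((\<lambda>s. f (- s)) has_real_derivative - f' (- s)) (at s)"
      using DERIV_chain2[OF der[OF *] DERIV_minus[OF DERIV_ident]] by simp
    show "- f' (- s) \<le> \<alpha> * f (- s) + \<beta>" using le[OF *] by simp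
  qed (use assms False in auto)
  then show ?thesis using False by simp
qed

section \<open>The logarithmic nonlinearity\<close>

lemma abs_ln_diff_le:
  fixes r s :: real
  assumes "0 < m" "m \<le> r" "m \<le> s"
  shows "\<bar>ln r - ln s\<bar> \<le> \<bar>r - s\<bar> / m"
proof -
  have *: "ln x - ln y \<le> \<bar>x - y\<bar> / m" if "m \<le> x" "m \<le> y" for x y
  proof -
    have "x > 0" "y > 0" using that assms by auto
    then have "ln x - ln y = ln (x / y)" by (simp add: ln_div)
    also have "\<dots> \<le> x / y - 1" using \<open>x > 0\<close> \<open>y > 0\<close> by (intro ln_le_minus_one) simp
    also have "\<dots> = (x - y) / y" using \<open>y > 0\<close> by (simp add: field_simps)
    also have "\<dots> \<le> \<bar>x - y\<bar> / y" using \<open>y > 0\<close> by (intro divide_right_mono) auto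
    also have "\<dots> \<le> \<bar>x - y\<bar> / m" using that assms by (intro divide_left_mono) auto
    finally show ?thesis .
  qed
  show ?thesis using *[of r s] *[of s r] assms by (simp add: abs_le_iff abs_minus_commute)
qed

lemma abs_ln_cmod_diff_le:
  assumes "0 < m" "m \<le> cmod z" "m \<le> cmod w"
  shows "\<bar>ln ((cmod z)\<^sup>2) - ln ((cmod w)\<^sup>2)\<bar> \<le> 2 * (cmod (z - w) / m)"
proof -
  have "cmod z > 0" "cmod w > 0" using assms by linarith+
  then have e: "ln ((cmod z)\<^sup>2) = 2 * ln (cmod z)" "ln ((cmod w)\<^sup>2) = 2 * ln (cmod w)"
    by (simp_all add: ln_realpow)
  have "\<bar>ln ((cmod z)\<^sup>2) - ln ((cmod w)\<^sup>2)\<bar> = 2 * \<bar>ln (cmod z) - ln (cmod w)\<bar>"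
    unfolding e right_diff_distrib[symmetric] abs_mult by simp
  also have "\<dots> \<le> 2 * (\<bar>cmod z - cmod w\<bar> / m)"
    using abs_ln_diff_le[OF assms] by simp
  also have "\<dots> \<le> 2 * (cmod (z - w) / m)"
    using norm_triangle_ineq3[of z w] assms(1) by (intro mult_left_mono divide_right_mono) auto
  finally show ?thesis .
qed

lemma log_nl_minus: "log_nl (- z) = - log_nl z"
  by (simp add: log_nl_def)

text \<open>With \<open>l\<close> and \<open>k\<close> the two logarithms, the difference is
  \<open>l * (z - w) + (l - k) * w\<close>, whose first part becomes real after multiplication by
  \<open>cnj (z - w)\<close>. In the second part \<open>w\<close> may be exchanged for
  \<open>z\<close> under \<open>Im\<close>; hence the smaller modulus \<open>m\<close> is available
  and cancels the factor \<open>1 / m\<close> in the Lipschitz bound of the logarithm.\<close>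

lemma Im_log_nl_diff_le: "\<bar>Im (cnj (z - w) * (log_nl z - log_nl w))\<bar> \<le> 2 * (cmod (z - w))\<^sup>2"
proof (cases "z = 0 \<or> w = 0")
  case True
  have "Im (cnj z * (z * of_real r)) = 0" for z r
    by (simp add: algebra_simps)
  with True show ?thesis by (auto simp: log_nl_def algebra_simps)
next
  case False
  then have pos: "cmod z > 0" "cmod w > 0" by auto
  define l k where "l = ln ((cmod z)\<^sup>2)" and "k = ln ((cmod w)\<^sup>2)"
  define m where "m = min (cmod z) (cmod w)"
  have m: "m > 0" "m \<le> cmod z" "m \<le> cmod w" using pos by (auto simp: m_def)
  have 1: "\<bar>l - k\<bar> \<le> 2 * (cmod (z - w) / m)"
    unfolding l_def k_def by (rule abs_ln_cmod_diff_le[OF m])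
  have 2: "\<bar>Im (cnj (z - w) * w)\<bar> \<le> cmod (z - w) * m"
  proof -
    have "Im (cnj (z - w) * w) = Im (cnj (z - w) * z)" by (simp add: algebra_simps)
    moreover have "\<bar>Im (cnj (z - w) * v)\<bar> \<le> cmod (z - w) * cmod v" for v
      using abs_Im_le_cmod[of "cnj (z - w) * v"] by (simp add: norm_mult del: complex_cnj_diff)
    ultimately show ?thesis by (metis m_def min_def)
  qed
  have "Im (cnj (z - w) * (log_nl z - log_nl w)) = (l - k) * Im (cnj (z - w) * w)"
    by (simp add: log_nl_def l_def k_def algebra_simps)
  also have "\<bar>\<dots>\<bar> \<le> (2 * (cmod (z - w) / m)) * (cmod (z - w) * m)"
    unfolding abs_mult by (intro mult_mono 1 2) (use m in auto)
  also have "\<dots> = 2 * (cmod (z - w))\<^sup>2" using m by (simp add: power2_eq_square)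
  finally show ?thesis .
qed

text \<open>The elementary bounds ln y <= y and - ln y <= 1 / y are used for the fourth root y of r,
  which costs the factor 16 on squaring. The gain is a singularity of order r^(-1/2) only,
  integrable in x when r is comparable to |x|.\<close>

lemma ln_power2_le:
  fixes r :: real
  assumes "r > 0" shows "(ln r)\<^sup>2 \<le> 32 * (sqrt r + 1 / sqrt r)"
proof -
  define y where "y = sqrt (sqrt r)"
  have y: "y > 0" "y\<^sup>2 = sqrt r" using assms by (auto simp: y_def)
  have "(y\<^sup>2)\<^sup>2 = r" using y assms by simp
  then have "r = y ^ 4" by (simp add: power_mult[symmetric])
  then have ln: "ln r = 4 * ln y" using y by (simp add: ln_realpow)
  have "ln y \<le> y" using ln_le_minus_one[OF y(1)] by simp
  moreover have "- ln y \<le> 1 / y"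
    using ln_le_minus_one[of "1 / y"] y by (simp add: ln_div)
  moreover have "1 / y > 0" using y by simp
  ultimately have "\<bar>ln y\<bar> \<le> \<bar>y + 1 / y\<bar>" using y(1) by linarith
  then have "(ln y)\<^sup>2 \<le> (y + 1 / y)\<^sup>2" by (simp only: abs_le_square_iff)
  also have "\<dots> = 2 * (y\<^sup>2 + 1 / y\<^sup>2) - (y - 1 / y)\<^sup>2"
  proof -
    have "(y + b)\<^sup>2 = 2 * (y\<^sup>2 + b\<^sup>2) - (y - b)\<^sup>2" for b
      by (simp add: power2_eq_square algebra_simps)
    from this[of "1 / y"] show ?thesis by (simp only: power_one_over)
  qed
  also have "\<dots> \<le> 2 * (y\<^sup>2 + 1 / y\<^sup>2)" by simp
  finally show ?thesis unfolding ln y(2) by (simp add: power_mult_distrib)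
qed

lemma isCont_log_nl: "isCont log_nl z"
proof (cases "z = 0")
  case False
  then show ?thesis unfolding log_nl_def[abs_def]
    by (intro continuous_intros) auto
next
  case True
  have bound: "cmod (log_nl z) \<le> 2 * sqrt (32 * ((cmod z)\<^sup>2 * sqrt (cmod z) + cmod z * sqrt (cmod z)))" for z
  proof (cases "z = 0")
    case False
    then have r: "cmod z > 0" by simp
    have "(cmod z * ln (cmod z))\<^sup>2 \<le> (cmod z)\<^sup>2 * (32 * (sqrt (cmod z) + 1 / sqrt (cmod z)))"
      unfolding power_mult_distrib by (intro mult_left_mono ln_power2_le r) simp
    also have "\<dots> = 32 * ((cmod z)\<^sup>2 * sqrt (cmod z) + cmod z * (cmod z / sqrt (cmod z)))"
      using r by (simp add: power2_eq_square field_simps)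
    also have "cmod z / sqrt (cmod z) = sqrt (cmod z)" using r by (simp add: real_div_sqrt)
    finally have "\<bar>cmod z * ln (cmod z)\<bar> \<le> sqrt (32 * ((cmod z)\<^sup>2 * sqrt (cmod z) + cmod z * sqrt (cmod z)))"
      using real_le_rsqrt by (metis power2_abs)
    then show ?thesis using r by (simp add: log_nl_def norm_mult ln_realpow abs_mult)
  qed (simp add: log_nl_def)
  have "(log_nl \<longlongrightarrow> 0) (at 0)"
  proof (rule Lim_null_comparison)
    show "\<forall>\<^sub>F z in at 0. norm (log_nl z) \<le> 2 * sqrt (32 * ((cmod z)\<^sup>2 * sqrt (cmod z) + cmod z * sqrt (cmod z)))"
      using bound by simp
    have "((\<lambda>z::complex. 2 * sqrt (32 * ((cmod z)\<^sup>2 * sqrt (cmod z) + cmod z * sqrt (cmod z)))) \<longlongrightarrow>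
        2 * sqrt (32 * ((cmod 0)\<^sup>2 * sqrt (cmod 0) + cmod 0 * sqrt (cmod 0)))) (at (0::complex))"
      by (intro tendsto_intros)
    then show "((\<lambda>z::complex. 2 * sqrt (32 * ((cmod z)\<^sup>2 * sqrt (cmod z) + cmod z * sqrt (cmod z)))) \<longlongrightarrow> 0) (at 0)"
      by simp
  qed
  then show ?thesis using True by (simp add: isCont_def log_nl_def)
qed

lemma continuous_on_log_nl: "continuous_on S log_nl"
  by (simp add: continuous_at_imp_continuous_on isCont_log_nl)

text \<open>The real differential of \<open>log_nl\<close> at \<open>z\<close> in direction
  \<open>p\<close>. The last two terms together are z times 2 Re(cnj z p) / |z|^2, the derivative of
  the logarithm; split like this, each has modulus |p| when \<open>z\<close> is nonzero.\<close>

definition dlog_nl :: "complex \<Rightarrow> complex \<Rightarrow> complex" where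
  "dlog_nl z p = p * complex_of_real (ln ((cmod z)\<^sup>2)) + p + (z / cnj z) * cnj p"

lemma DERIV_cmod_power2:
  assumes "(f has_vector_derivative p) (at x within S)"
  shows "((\<lambda>x. (cmod (f x))\<^sup>2) has_real_derivative 2 * Re (cnj (f x) * p)) (at x within S)"
proof -
  have "((\<lambda>x. f x * cnj (f x)) has_vector_derivative f x * cnj p + p * cnj (f x)) (at x within S)"
    by (intro has_vector_derivative_mult assms bounded_linear.has_vector_derivative[OF bounded_linear_cnj assms])
  from bounded_linear.has_vector_derivative[OF bounded_linear_Re this]
  have "((\<lambda>x. Re (f x * cnj (f x))) has_vector_derivative Re (f x * cnj p + p * cnj (f x))) (at x within S)" .
  moreover have "Re (f x * cnj (f x)) = (cmod (f x))\<^sup>2" for x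
    by (simp add: complex_mult_cnj cmod_power2)
  ultimately show ?thesis
    by (simp add: has_real_derivative_iff_has_vector_derivative algebra_simps)
qed

lemma log_nl_chain:
  assumes f: "(f has_vector_derivative p) (at x within S)" and nz: "f x \<noteq> 0"
  shows "((\<lambda>x. log_nl (f x)) has_vector_derivative dlog_nl (f x) p) (at x within S)"
proof -
  have pos: "(cmod (f x))\<^sup>2 > 0" using nz by simp
  have "((\<lambda>x. ln ((cmod (f x))\<^sup>2)) has_real_derivative inverse ((cmod (f x))\<^sup>2) * (2 * Re (cnj (f x) * p))) (at x within S)"
    by (rule DERIV_chain2[OF _ DERIV_cmod_power2[OF f]]) (use pos in \<open>auto intro!: derivative_eq_intros simp: inverse_eq_divide\<close>)
  from has_vector_derivative_of_real[OF this]
  have "((\<lambda>x. complex_of_real (ln ((cmod (f x))\<^sup>2))) has_vector_derivative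
      complex_of_real (inverse ((cmod (f x))\<^sup>2) * (2 * Re (cnj (f x) * p)))) (at x within S)" .
  from has_vector_derivative_mult[OF f this]
  have "((\<lambda>x. log_nl (f x)) has_vector_derivative
      f x * complex_of_real (inverse ((cmod (f x))\<^sup>2) * (2 * Re (cnj (f x) * p))) + p * complex_of_real (ln ((cmod (f x))\<^sup>2))) (at x within S)"
    by (simp add: log_nl_def)
  moreover have "f x * complex_of_real (inverse ((cmod (f x))\<^sup>2) * (2 * Re (cnj (f x) * p))) = p + (f x / cnj (f x)) * cnj p"
  proof -
    have "complex_of_real (2 * Re (cnj (f x) * p)) = cnj (f x) * p + f x * cnj p"
      using complex_add_cnj[of "cnj (f x) * p"] by simp
    moreover have "complex_of_real ((cmod (f x))\<^sup>2) = f x * cnj (f x)"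
      by (rule complex_norm_square)
    ultimately have "f x * complex_of_real (inverse ((cmod (f x))\<^sup>2) * (2 * Re (cnj (f x) * p))) =
        f x * (inverse (f x * cnj (f x)) * (cnj (f x) * p + f x * cnj p))"
      by (simp only: of_real_mult of_real_inverse)
    also have "\<dots> = p + (f x / cnj (f x)) * cnj p"
      using nz by (simp add: field_simps)
    finally show ?thesis .
  qed
  ultimately show ?thesis by (simp add: dlog_nl_def add_ac)
qed

section \<open>Integrability of the differentiated nonlinearity\<close>

lemma inverse_sqrt_integrable:
  assumes "a > 0"
  shows "integrable (lebesgue_on {-a<..<a}) (\<lambda>x. 1 / sqrt \<bar>x\<bar>)"
proof -
  define H where "H x = 2 * sgn x * sqrt \<bar>x\<bar>" for x :: real
  have "((\<lambda>x. 1 / sqrt \<bar>x\<bar>) has_integral (H a - H (-a))) {-a..a}"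
  proof (rule fundamental_theorem_of_calculus_interior_strong[where S = "{0}"])
    show "continuous_on {-a..a} H"
    proof -
      have "H = (\<lambda>x. 2 * sqrt (max x 0) - 2 * sqrt (max (- x) 0))"
        by (auto simp: H_def fun_eq_iff sgn_if max_def)
      then show ?thesis by (auto intro!: continuous_intros)
    qed
    fix x assume "x \<in> {-a<..<a} - {0}"
    then consider "x > 0" | "x < 0" by fastforce
    then show "(H has_vector_derivative 1 / sqrt \<bar>x\<bar>) (at x)"
    proof cases
      case 1
      have "((\<lambda>x. 2 * sqrt x) has_real_derivative 1 / sqrt \<bar>x\<bar>) (at x)"
        using 1 by (auto intro!: derivative_eq_intros simp: inverse_eq_divide)
      then have "(H has_real_derivative 1 / sqrt \<bar>x\<bar>) (at x)"
        by (rule has_field_derivative_transform_within_open[where S = "{0<..}"]) (use 1 in \<open>auto simp: H_def\<close>)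
      then show ?thesis by (simp add: has_real_derivative_iff_has_vector_derivative)
    next
      case 2
      have "((\<lambda>x. - 2 * sqrt (- x)) has_real_derivative 1 / sqrt \<bar>x\<bar>) (at x)"
        using 2 by (auto intro!: derivative_eq_intros simp: inverse_eq_divide)
      then have "(H has_real_derivative 1 / sqrt \<bar>x\<bar>) (at x)"
        by (rule has_field_derivative_transform_within_open[where S = "{..<0}"]) (use 2 in \<open>auto simp: H_def\<close>)
      then show ?thesis by (simp add: has_real_derivative_iff_has_vector_derivative)
    qed
  qed (use assms in auto)
  then have "(\<lambda>x. 1 / sqrt \<bar>x\<bar>) absolutely_integrable_on {-a..a}"
    by (intro nonnegative_absolutely_integrable_1) auto
  then show ?thesis by (simp add: integrable_Ioo_iff)
qed

lemma borel_measurable_cnj: "f \<in> borel_measurable M \<Longrightarrow> (\<lambda>x. cnj (f x)) \<in> borel_measurable M"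
  by (rule borel_measurable_continuous_on[of cnj]) (auto intro: continuous_intros)

lemma AE_nonzero_Ioo: "AE x in lebesgue_on {c<..<d}. x \<noteq> (0::real)"
proof -
  have "AE x in lebesgue. x \<noteq> (0::real)"
    using AE_lborel_singleton[of "0::real"] by (rule AE_completion)
  then show ?thesis by (simp add: AE_restrict_space_iff) (auto elim: eventually_mono)
qed

text \<open>The lower bound \<open>c|x|\<close> makes the logarithmic term in the derivative square integrable.\<close>

lemma log_nl_primitive:
  assumes rep: "neumann_rep a f p g" and "a > 0" "c > 0"
    and low: "\<And>x. x \<in> {-a..a} \<Longrightarrow> c * \<bar>x\<bar> \<le> cmod (f x)"
  shows "(\<lambda>x. dlog_nl (f x) (p x)) \<in> L2 {-a<..<a}"
    "\<And>x. x \<in> {-a..a} \<Longrightarrow> log_nl (f x) = log_nl (f (-a)) + integral {-a..x} (\<lambda>x. dlog_nl (f x) (p x))"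
proof -
  let ?M = "lebesgue_on {-a<..<a}"
  note A = neumann_repD[OF rep]
  have fm: "f \<in> borel_measurable ?M" and pm: "p \<in> borel_measurable ?M"
    using A by (auto intro: L2_measurable)
  have meas: "(\<lambda>x. dlog_nl (f x) (p x)) \<in> borel_measurable ?M"
    unfolding dlog_nl_def using fm pm borel_measurable_cnj[OF fm] borel_measurable_cnj[OF pm] by measurable
  obtain M where M: "\<And>x. x \<in> {-a..a} \<Longrightarrow> cmod (p x) \<le> M"
    using continuous_Icc_bounded[OF A(5)] by blast
  obtain N where N: "\<And>x. x \<in> {-a..a} \<Longrightarrow> cmod (f x) \<le> N"
    using continuous_Icc_bounded[OF A(6)] by blast
  \<comment> \<open>With L = |ln |f||, the square of 2 L + 2 is 8 + 8 L^2 - 4 (L - 1)^2, at most 8 +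
    8 L^2; \<open>ln_power2_le\<close> contributes the 32, and the upper and lower bounds of |f|
    contribute the two terms in the bracket.\<close>
  define b where "b x = M\<^sup>2 * (8 + 8 * 32 * (sqrt N + (1 / sqrt c) * (1 / sqrt \<bar>x\<bar>)))" for x
  have b_int: "integrable ?M b" unfolding b_def
    by (intro Bochner_Integration.integrable_add integrable_mult_right inverse_sqrt_integrable
        finite_measure.integrable_const finite_measure_lebesgue_on \<open>a > 0\<close>) simp_all
  have bound: "(cmod (dlog_nl (f x) (p x)))\<^sup>2 \<le> b x" if x: "x \<in> {-a<..<a}" "x \<noteq> 0" for x
  proof -
    have xI: "x \<in> {-a..a}" using x by auto
    have pos: "0 < c * \<bar>x\<bar>" using x \<open>c > 0\<close> by simp
    have fpos: "cmod (f x) > 0" using low[OF xI] pos by linarith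
    have "cmod (dlog_nl (f x) (p x)) \<le> cmod (p x) * (2 * \<bar>ln (cmod (f x))\<bar>) + cmod (p x) + cmod (p x)"
    proof -
      have "cmod (dlog_nl (f x) (p x)) \<le> cmod (p x * complex_of_real (ln ((cmod (f x))\<^sup>2))) + cmod (p x) + cmod (f x / cnj (f x) * cnj (p x))"
        unfolding dlog_nl_def by (intro order_trans[OF norm_triangle_ineq] add_mono norm_triangle_ineq) simp
      also have "cmod (f x / cnj (f x) * cnj (p x)) = cmod (p x)" using fpos by (simp add: norm_mult norm_divide)
      also have "cmod (p x * complex_of_real (ln ((cmod (f x))\<^sup>2))) = cmod (p x) * (2 * \<bar>ln (cmod (f x))\<bar>)"
        using fpos by (simp add: norm_mult ln_realpow abs_mult)
      finally show ?thesis .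
    qed
    also have "\<dots> = cmod (p x) * (2 * \<bar>ln (cmod (f x))\<bar> + 2)" by (simp add: algebra_simps)
    also have "\<dots> \<le> M * (2 * \<bar>ln (cmod (f x))\<bar> + 2)" by (intro mult_right_mono M xI) simp
    finally have "(cmod (dlog_nl (f x) (p x)))\<^sup>2 \<le> (M * (2 * \<bar>ln (cmod (f x))\<bar> + 2))\<^sup>2"
      by (intro power_mono) auto
    also have "\<dots> = M\<^sup>2 * (8 + 8 * (ln (cmod (f x)))\<^sup>2 - 4 * (\<bar>ln (cmod (f x))\<bar> - 1)\<^sup>2)"
      by (simp add: power_mult_distrib power2_eq_square algebra_simps)
    also have "\<dots> \<le> M\<^sup>2 * (8 + 8 * (32 * (sqrt N + (1 / sqrt c) * (1 / sqrt \<bar>x\<bar>))))"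
    proof (rule mult_left_mono)
      have "(ln (cmod (f x)))\<^sup>2 \<le> 32 * (sqrt (cmod (f x)) + 1 / sqrt (cmod (f x)))"
        by (rule ln_power2_le[OF fpos])
      also have "\<dots> \<le> 32 * (sqrt N + 1 / sqrt (c * \<bar>x\<bar>))"
        using N[OF xI] low[OF xI] pos fpos
        by (intro mult_left_mono add_mono divide_left_mono) auto
      finally have "(ln (cmod (f x)))\<^sup>2 \<le> 32 * (sqrt N + (1 / sqrt c) * (1 / sqrt \<bar>x\<bar>))"
        by (simp add: real_sqrt_mult)
      then show "8 + 8 * (ln (cmod (f x)))\<^sup>2 - 4 * (\<bar>ln (cmod (f x))\<bar> - 1)\<^sup>2
        \<le> 8 + 8 * (32 * (sqrt N + (1 / sqrt c) * (1 / sqrt \<bar>x\<bar>)))"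
        using zero_le_power2[of "\<bar>ln (cmod (f x))\<bar> - 1"] by linarith
    qed simp
    finally show ?thesis by (simp add: b_def mult.assoc)
  qed
  have "AE x in ?M. norm ((cmod (dlog_nl (f x) (p x)))\<^sup>2) \<le> norm (b x)"
    using AE_nonzero_Ioo AE_space[of ?M]
  proof eventually_elim
    fix x assume "x \<noteq> 0" "x \<in> space ?M"
    then show "norm ((cmod (dlog_nl (f x) (p x)))\<^sup>2) \<le> norm (b x)"
      using bound[of x] by simp
  qed
  then have "integrable ?M (\<lambda>x. (cmod (dlog_nl (f x) (p x)))\<^sup>2)"
    using meas by (intro Bochner_Integration.integrable_bound[OF b_int]) auto
  then show L2: "(\<lambda>x. dlog_nl (f x) (p x)) \<in> L2 {-a<..<a}"
    using meas by (simp add: L2_def)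
  fix x assume x: "x \<in> {-a..a}"
  \<comment> \<open>Away from \<open>x = 0\<close> the lower bound keeps \<open>f\<close> nonzero,
    so the chain rule applies; at the one exceptional point continuity of \<open>log_nl\<close>
    suffices.\<close>
  have "((\<lambda>x. dlog_nl (f x) (p x)) has_integral (log_nl (f x) - log_nl (f (-a)))) {-a..x}"
  proof (rule fundamental_theorem_of_calculus_interior_strong[where S = "{0}"])
    show "continuous_on {-a..x} (\<lambda>x. log_nl (f x))"
      using x by (intro continuous_on_compose2[OF continuous_on_log_nl[of UNIV]] continuous_on_subset[OF A(6)]) auto
    fix y assume y: "y \<in> {-a<..<x} - {0}"
    then have yI: "y \<in> {-a..a}" using x by auto
    have "0 < c * \<bar>y\<bar>" using y \<open>c > 0\<close> by simp
    then have "f y \<noteq> 0" using low[OF yI] by auto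
    from log_nl_chain[OF A(4)[OF yI] this]
    show "((\<lambda>x. log_nl (f x)) has_vector_derivative dlog_nl (f y) (p y)) (at y)"
      using y x by (simp add: at_within_Icc_at)
  qed (use x in auto)
  then show "log_nl (f x) = log_nl (f (-a)) + integral {-a..x} (\<lambda>x. dlog_nl (f x) (p x))"
    by (simp add: has_integral_iff)
qed

text \<open>The contribution of \<open>q * ln |z|^2\<close> to the difference is a real multiple of \<open>q\<close> and disappears
  in the imaginary part, so the singular factor \<open>ln |z|^2\<close> does not enter the estimate.\<close>

lemma Im_dlog_nl_diff_le:
  assumes "0 < m" "m \<le> cmod z" "m \<le> cmod w" "cmod s \<le> M"
  shows "\<bar>Im (cnj (p - s) * (dlog_nl z p - dlog_nl w s))\<bar>
    \<le> 2 * (cmod (p - s))\<^sup>2 + 4 * M * cmod (p - s) * (cmod (z - w) / m)"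
proof -
  define q d where "q = p - s" and "d = z - w"
  have nz: "z \<noteq> 0" "w \<noteq> 0" using assms by auto
  define l k where "l = ln ((cmod z)\<^sup>2)" and "k = ln ((cmod w)\<^sup>2)"
  have 1: "\<bar>l - k\<bar> \<le> 2 * (cmod d / m)"
    unfolding l_def k_def d_def by (rule abs_ln_cmod_diff_le[OF assms(1-3)])
  \<comment> \<open>The phase \<open>z / cnj z\<close> has no limit at 0, but for moduli at least
    \<open>m\<close> it has Lipschitz constant \<open>2 / m\<close>, just like the
    logarithm.\<close>
  have 2: "cmod (z / cnj z - w / cnj w) \<le> 2 * (cmod d / m)"
  proof -
    have "z / cnj z - w / cnj w = (d * cnj w - w * cnj d) / (cnj z * cnj w)"
      using nz by (simp add: d_def field_simps)
    then have "cmod (z / cnj z - w / cnj w) = cmod (d * cnj w - w * cnj d) / (cmod z * cmod w)"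
      by (simp add: norm_divide norm_mult)
    also have "\<dots> \<le> (2 * cmod d * cmod w) / (cmod z * cmod w)"
      using norm_triangle_ineq4[of "d * cnj w" "w * cnj d"]
      by (intro divide_right_mono) (auto simp: norm_mult)
    also have "\<dots> = 2 * cmod d / cmod z" using nz by simp
    also have "\<dots> \<le> 2 * cmod d / m" using assms nz by (intro divide_left_mono mult_pos_pos) auto
    finally show ?thesis by simp
  qed
  define E where "E = s * complex_of_real (l - k) + q + (z / cnj z) * cnj q + (z / cnj z - w / cnj w) * cnj s"
  have "dlog_nl z p - dlog_nl w s = q * complex_of_real l + E"
    by (simp add: dlog_nl_def E_def q_def l_def k_def algebra_simps)
  then have "Im (cnj q * (dlog_nl z p - dlog_nl w s)) = Im (cnj q * E)"
    by (simp add: algebra_simps)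
  also have "\<bar>\<dots>\<bar> \<le> cmod q * cmod E"
    using abs_Im_le_cmod[of "cnj q * E"] by (simp add: norm_mult)
  also have "cmod E \<le> cmod s * \<bar>l - k\<bar> + cmod q + cmod q + cmod (z / cnj z - w / cnj w) * cmod s"
  proof -
    have "cmod E \<le> cmod (s * complex_of_real (l - k)) + cmod q + cmod ((z / cnj z) * cnj q) + cmod ((z / cnj z - w / cnj w) * cnj s)"
      unfolding E_def by (intro order_trans[OF norm_triangle_ineq] add_mono norm_triangle_ineq order_refl)
    also have "cmod ((z / cnj z) * cnj q) = cmod q" using nz by (simp add: norm_mult norm_divide)
    also have "cmod (s * complex_of_real (l - k)) = cmod s * \<bar>l - k\<bar>"
      by (simp only: norm_mult norm_of_real)
    also have "cmod ((z / cnj z - w / cnj w) * cnj s) = cmod (z / cnj z - w / cnj w) * cmod s"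
      by (simp only: norm_mult complex_mod_cnj)
    finally show ?thesis .
  qed
  also have "\<dots> \<le> M * (2 * (cmod d / m)) + cmod q + cmod q + (2 * (cmod d / m)) * M"
    using order_trans[OF norm_ge_zero assms(4)] assms(1)
    by (intro add_mono mult_mono 1 2 assms(4) order_refl) auto
  also have "cmod q * \<dots> = 2 * (cmod q)\<^sup>2 + 4 * M * cmod q * (cmod d / m)"
    by (simp add: power2_eq_square algebra_simps)
  finally show ?thesis by (simp add: q_def d_def mult_left_mono)
qed

section \<open>Hardy's inequality and the energy estimate\<close>

text \<open>Integrate the derivative of \<open>\<bar>f x\<bar>\<^sup>2 / x\<close> over \<open>[-a, a]\<close>: the boundary terms have the favourable sign.\<close>

lemma hardy:
  assumes rep: "neumann_rep a f p g" and "a > 0" and zero: "f 0 = 0"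
  shows "(\<lambda>x. f x / complex_of_real x) \<in> L2 {-a<..<a}"
    "L2_norm {-a<..<a} (\<lambda>x. f x / complex_of_real x) \<le> 2 * L2_norm {-a<..<a} p"
proof -
  let ?S = "{-a<..<a}" and ?M = "lebesgue_on {-a<..<a}"
  note A = neumann_repD[OF rep]
  obtain B where B: "B > 0" "\<And>x. x \<in> {-a..a} \<Longrightarrow> cmod (p x) \<le> B"
    using continuous_Icc_bounded[OF A(5)] by blast
  have lip: "cmod (f x) \<le> B * \<bar>x\<bar>" if "x \<in> {-a..a}" for x
    using neumann_rep_lipschitz[OF rep that, of 0 B] B(2) zero \<open>a > 0\<close> by simp
  define k where "k x = f x / complex_of_real x" for x
  have id: "(\<lambda>x. x) \<in> borel_measurable ?M"
    using id_borel_measurable_lebesgue_on[of ?S] by (simp add: id_def)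
  have k_meas: "k \<in> borel_measurable ?M"
    unfolding k_def[abs_def] using L2_measurable[OF A(8)] id by measurable
  have "cmod (k x) \<le> B" if "x \<in> ?S" for x
  proof (cases "x = 0")
    case False
    then show ?thesis using lip[of x] that by (simp add: k_def norm_divide divide_le_eq)
  qed (use B(1) in \<open>simp add: k_def\<close>)
  \<comment> \<open>Finiteness of this norm must be known first, because part of it is absorbed into
    the left-hand side at the end.\<close>
  then have k: "k \<in> L2 ?S" by (rule L2_norm_bounded(1)[OF k_meas]) (use \<open>a > 0\<close> in auto)
  define H where "H x = (cmod (f x))\<^sup>2 / x" for x
  define y where "y x = 2 * Re (cnj (k x) * p x) - (cmod (k x))\<^sup>2" for x
  have "(y has_integral (H a - H (-a))) {-a..a}"
  proof (rule fundamental_theorem_of_calculus_interior_strong[where S = "{0}"])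
    show "continuous_on {-a..a} H"
      unfolding continuous_on_eq_continuous_within
    proof
      fix x assume x: "x \<in> {-a..a}"
      show "continuous (at x within {-a..a}) H"
      proof (cases "x = 0")
        case False
        have "continuous (at x within {-a..a}) f"
          using A(6) x by (simp add: continuous_on_eq_continuous_within)
        then show ?thesis unfolding H_def[abs_def] using False by (intro continuous_intros) auto
      next
        case True
        have "(H \<longlongrightarrow> 0) (at 0 within {-a..a})"
        proof (rule Lim_null_comparison)
          have "norm (H x) \<le> B\<^sup>2 * \<bar>x\<bar>" if "x \<in> {-a..a}" "x \<noteq> 0" for x
          proof -
            have "(cmod (f x))\<^sup>2 \<le> (B * \<bar>x\<bar>)\<^sup>2" by (rule power_mono[OF lip[OF that(1)]]) simp
            then show ?thesis using that(2)
              by (simp add: H_def divide_le_eq power2_eq_square mult_ac)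
          qed
          then show "\<forall>\<^sub>F x in at 0 within {-a..a}. norm (H x) \<le> B\<^sup>2 * \<bar>x\<bar>"
            by (auto simp: eventually_at_filter)
          have "((\<lambda>x. B\<^sup>2 * \<bar>x\<bar>) \<longlongrightarrow> B\<^sup>2 * \<bar>0\<bar>) (at 0 within {-a..a})"
            by (intro tendsto_intros)
          then show "((\<lambda>x. B\<^sup>2 * \<bar>x\<bar>) \<longlongrightarrow> 0) (at 0 within {-a..a})" by simp
        qed
        then show ?thesis using True by (simp add: continuous_within H_def)
      qed
    qed
    fix x assume x: "x \<in> {-a<..<a} - {0}"
    have fx: "(f has_vector_derivative p x) (at x)"
      using A(4)[of x] x by (simp add: at_within_Icc_at)
    have "(H has_real_derivative (2 * Re (cnj (f x) * p x) * x - (cmod (f x))\<^sup>2 * 1) / (x * x)) (at x)"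
      unfolding H_def[abs_def] by (rule DERIV_divide[OF DERIV_cmod_power2[OF fx] DERIV_ident]) (use x in simp)
    also have "(2 * Re (cnj (f x) * p x) * x - (cmod (f x))\<^sup>2 * 1) / (x * x) = y x"
    proof -
      have "Re (cnj (k x) * p x) = Re (cnj (f x) * p x) / x"
        using Re_divide_of_real[of "cnj (f x) * p x" x] by (simp add: k_def)
      then show ?thesis using x
        by (simp add: y_def k_def norm_divide power_divide power2_eq_square diff_divide_distrib)
    qed
    finally show "(H has_vector_derivative y x) (at x)"
      by (simp add: has_real_derivative_iff_has_vector_derivative)
  qed (use \<open>a > 0\<close> in auto)
  then have y_int: "integral {-a..a} y = H a - H (-a)" by (simp add: has_integral_iff)
  have Re_int: "integrable ?M (\<lambda>x. Re (cnj (k x) * p x))"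
    by (intro integrable_Re L2_mult_integrable L2_cnj k A)
  have y_L: "integrable ?M y" unfolding y_def
    by (intro Bochner_Integration.integrable_diff integrable_mult_right Re_int L2_square_integrable k)
  have "0 \<le> H a - H (-a)" using \<open>a > 0\<close> by (simp add: H_def)
  also have "\<dots> = (LINT x|?M. y x)" using LINT_Ioo_eq_integral[OF y_L] y_int by simp
  \<comment> \<open>Young's inequality 2 |k| |p| <= |k|^2 / 2 + 2 |p|^2, with weights chosen so that
    half of |k|^2 survives; this gives the constant 2 of the Hardy bound.\<close>
  also have "\<dots> \<le> (LINT x|?M. 2 * (cmod (p x))\<^sup>2 - (1/2) * (cmod (k x))\<^sup>2)"
  proof (rule integral_mono[OF y_L])
    show "integrable ?M (\<lambda>x. 2 * (cmod (p x))\<^sup>2 - (1/2) * (cmod (k x))\<^sup>2)"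
      by (intro Bochner_Integration.integrable_diff integrable_mult_right L2_square_integrable k A)
    fix x
    have "Re (cnj (k x) * p x) \<le> cmod (k x) * cmod (p x)"
      using complex_Re_le_cmod[of "cnj (k x) * p x"] by (simp add: norm_mult)
    moreover have "0 \<le> (cmod (k x) - 2 * cmod (p x))\<^sup>2" by simp
    ultimately show "y x \<le> 2 * (cmod (p x))\<^sup>2 - (1/2) * (cmod (k x))\<^sup>2"
      unfolding y_def by (simp add: power2_eq_square algebra_simps)
  qed
  also have "\<dots> = 2 * (L2_norm ?S p)\<^sup>2 - (1/2) * (L2_norm ?S k)\<^sup>2"
    using L2_square_integrable[OF k] L2_square_integrable[OF A(7)] by (simp add: L2_norm_power2)
  finally have "(L2_norm ?S k)\<^sup>2 \<le> (2 * L2_norm ?S p)\<^sup>2" by (simp add: power_mult_distrib)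
  then have "L2_norm ?S k \<le> 2 * L2_norm ?S p"
    by (rule power2_le_imp_le) (simp add: L2_norm_nonneg)
  with k show "(\<lambda>x. f x / complex_of_real x) \<in> L2 {-a<..<a}"
    "L2_norm {-a<..<a} (\<lambda>x. f x / complex_of_real x) \<le> 2 * L2_norm {-a<..<a} p"
    by (simp_all add: k_def[abs_def])
qed

text \<open>One derivative is moved from the second derivatives onto the nonlinear difference, and
  the pointwise bound is applied with \<open>m = c * |x|\<close>. The coefficient
  \<open>8 * M / c\<close> is \<open>4 * M / c\<close> from that bound times the factor 2 of
  \<open>hardy\<close>.\<close>

lemma Im_inner_log_nl_le:
  assumes rep1: "neumann_rep a f1 p1 g1" and rep2: "neumann_rep a f2 p2 g2" and "a > 0" "c > 0"
    and low1: "\<And>x. x \<in> {-a..a} \<Longrightarrow> c * \<bar>x\<bar> \<le> cmod (f1 x)"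
    and low2: "\<And>x. x \<in> {-a..a} \<Longrightarrow> c * \<bar>x\<bar> \<le> cmod (f2 x)"
    and zero: "f1 0 = 0" "f2 0 = 0" and M: "\<And>x. x \<in> {-a..a} \<Longrightarrow> cmod (p2 x) \<le> M"
  shows "\<bar>Im (L2_inner {-a<..<a} (\<lambda>x. g1 x - g2 x) (\<lambda>x. log_nl (f1 x) - log_nl (f2 x)))\<bar>
    \<le> (2 + 8 * M / c) * (L2_norm {-a<..<a} (\<lambda>x. p1 x - p2 x))\<^sup>2"
proof -
  let ?S = "{-a<..<a}" and ?M = "lebesgue_on {-a<..<a}"
  define q w where "q x = p1 x - p2 x" and "w x = f1 x - f2 x" for x
  define D where "D x = dlog_nl (f1 x) (p1 x) - dlog_nl (f2 x) (p2 x)" for x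
  have rep: "neumann_rep a w q (\<lambda>x. g1 x - g2 x)"
    unfolding q_def[abs_def] w_def[abs_def] by (rule neumann_rep_diff[OF rep1 rep2])
  note A = neumann_repD[OF rep]
  have P1: "(\<lambda>x. dlog_nl (f1 x) (p1 x)) \<in> L2 ?S"
    "\<And>x. x \<in> {-a..a} \<Longrightarrow> log_nl (f1 x) = log_nl (f1 (-a)) + integral {-a..x} (\<lambda>x. dlog_nl (f1 x) (p1 x))"
    using log_nl_primitive[OF rep1 \<open>a > 0\<close> \<open>c > 0\<close>] low1 by blast+
  have P2: "(\<lambda>x. dlog_nl (f2 x) (p2 x)) \<in> L2 ?S"
    "\<And>x. x \<in> {-a..a} \<Longrightarrow> log_nl (f2 x) = log_nl (f2 (-a)) + integral {-a..x} (\<lambda>x. dlog_nl (f2 x) (p2 x))"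
    using log_nl_primitive[OF rep2 \<open>a > 0\<close> \<open>c > 0\<close>] low2 by blast+
  have D: "D \<in> L2 ?S" unfolding D_def[abs_def] by (rule L2_diff[OF P1(1) P2(1)])
  have M0: "M \<ge> 0" using order_trans[OF norm_ge_zero M[of 0]] \<open>a > 0\<close> by simp
  have prim: "cnj (log_nl (f1 x) - log_nl (f2 x)) =
      cnj (log_nl (f1 (-a)) - log_nl (f2 (-a))) + integral {-a..x} (\<lambda>x. cnj (D x))" if x: "x \<in> {-a..a}" for x
  proof -
    have sub: "{-a..x} \<subseteq> {-a..a}" using x by auto
    have i: "(\<lambda>x. dlog_nl (f1 x) (p1 x)) integrable_on {-a..x}" "(\<lambda>x. dlog_nl (f2 x) (p2 x)) integrable_on {-a..x}"
      using integrable_subinterval_real[OF integrable_Ioo_integrable_on[OF L2_integrable[OF P1(1)]] sub]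
        integrable_subinterval_real[OF integrable_Ioo_integrable_on[OF L2_integrable[OF P2(1)]] sub] by auto
    have "integral {-a..x} D = integral {-a..x} (\<lambda>x. dlog_nl (f1 x) (p1 x)) - integral {-a..x} (\<lambda>x. dlog_nl (f2 x) (p2 x))"
      unfolding D_def[abs_def] by (rule Henstock_Kurzweil_Integration.integral_diff[OF i])
    then show ?thesis using P1(2)[OF x] P2(2)[OF x]
      by (simp add: Henstock_Kurzweil_Integration.integral_cnj[symmetric])
  qed
  have z: "w 0 = 0" using zero by (simp add: w_def)
  have w_int: "integrable ?M (\<lambda>x. cmod (q x) * cmod (w x / complex_of_real x))"
    using integrable_norm[OF L2_mult_integrable[OF A(7) hardy(1)[OF rep \<open>a > 0\<close> z]]] by (simp only: norm_mult)
  have "L2_inner ?S (\<lambda>x. g1 x - g2 x) (\<lambda>x. log_nl (f1 x) - log_nl (f2 x)) = - L2_inner ?S q D"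
    unfolding L2_inner_def by (rule neumann_rep_parts[OF rep L2_cnj[OF D] prim \<open>a > 0\<close>])
  then have "\<bar>Im (L2_inner ?S (\<lambda>x. g1 x - g2 x) (\<lambda>x. log_nl (f1 x) - log_nl (f2 x)))\<bar> = \<bar>Im (L2_inner ?S q D)\<bar>"
    by simp
  also have "Im (L2_inner ?S q D) = (LINT x|?M. Im (q x * cnj (D x)))"
    unfolding L2_inner_def by (rule integral_Im[symmetric, OF L2_inner_integrable[OF A(7) D]])
  also have "\<bar>\<dots>\<bar> \<le> (LINT x|?M. \<bar>Im (q x * cnj (D x))\<bar>)"
    using integral_norm_bound[of ?M "\<lambda>x. Im (q x * cnj (D x))"] by simp
  also have "\<dots> \<le> (LINT x|?M. 2 * (cmod (q x))\<^sup>2 + 4 * M / c * (cmod (q x) * cmod (w x / complex_of_real x)))"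
  proof (rule integral_mono_AE)
    show "integrable ?M (\<lambda>x. \<bar>Im (q x * cnj (D x))\<bar>)"
      by (intro integrable_abs integrable_Im L2_inner_integrable A D)
    from w_int show "integrable ?M (\<lambda>x. 2 * (cmod (q x))\<^sup>2 + 4 * M / c * (cmod (q x) * cmod (w x / complex_of_real x)))"
      by (intro Bochner_Integration.integrable_add integrable_mult_right L2_square_integrable A)
    show "AE x in ?M. \<bar>Im (q x * cnj (D x))\<bar> \<le> 2 * (cmod (q x))\<^sup>2 + 4 * M / c * (cmod (q x) * cmod (w x / complex_of_real x))"
      using AE_nonzero_Ioo AE_space[of ?M]
    proof eventually_elim
      fix x assume "x \<noteq> 0" "x \<in> space ?M"
      then have x: "x \<in> {-a..a}" "0 < c * \<bar>x\<bar>" using \<open>c > 0\<close> by auto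
      have "\<bar>Im (q x * cnj (D x))\<bar> = \<bar>Im (cnj (q x) * D x)\<bar>" by (simp add: algebra_simps)
      also have "\<dots> \<le> 2 * (cmod (q x))\<^sup>2 + 4 * M * cmod (q x) * (cmod (w x) / (c * \<bar>x\<bar>))"
        unfolding q_def D_def w_def
        by (rule Im_dlog_nl_diff_le[OF x(2) low1[OF x(1)] low2[OF x(1)] M[OF x(1)]])
      also have "\<dots> = 2 * (cmod (q x))\<^sup>2 + 4 * M / c * (cmod (q x) * cmod (w x / complex_of_real x))"
        by (simp add: norm_divide)
      finally show "\<bar>Im (q x * cnj (D x))\<bar> \<le> 2 * (cmod (q x))\<^sup>2 + 4 * M / c * (cmod (q x) * cmod (w x / complex_of_real x))" .
    qed
  qed
  also have "\<dots> = 2 * (L2_norm ?S q)\<^sup>2 + 4 * M / c * (LINT x|?M. cmod (q x) * cmod (w x / complex_of_real x))"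
  proof -
    from w_int have "(LINT x|?M. 2 * (cmod (q x))\<^sup>2 + 4 * M / c * (cmod (q x) * cmod (w x / complex_of_real x))) =
       (LINT x|?M. 2 * (cmod (q x))\<^sup>2) + (LINT x|?M. 4 * M / c * (cmod (q x) * cmod (w x / complex_of_real x)))"
      by (intro Bochner_Integration.integral_add integrable_mult_right L2_square_integrable A)
    then show ?thesis by (simp only: integral_mult_right_zero L2_norm_power2)
  qed
  also have "\<dots> \<le> 2 * (L2_norm ?S q)\<^sup>2 + 4 * M / c * (L2_norm ?S q * (2 * L2_norm ?S q))"
  proof (intro add_left_mono mult_left_mono)
    have "(LINT x|?M. cmod (q x) * cmod (w x / complex_of_real x)) \<le> L2_norm ?S q * L2_norm ?S (\<lambda>x. w x / complex_of_real x)"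
      by (rule L2_abs_mult_le[OF A(7) hardy(1)[OF rep \<open>a > 0\<close> z]])
    also have "\<dots> \<le> L2_norm ?S q * (2 * L2_norm ?S q)"
      by (intro mult_left_mono hardy(2)[OF rep \<open>a > 0\<close> z] L2_norm_nonneg)
    finally show "(LINT x|?M. cmod (q x) * cmod (w x / complex_of_real x)) \<le> L2_norm ?S q * (2 * L2_norm ?S q)" .
  qed (use M0 \<open>c > 0\<close> in simp)
  also have "\<dots> = (2 + 8 * M / c) * (L2_norm ?S q)\<^sup>2"
    by (simp add: power2_eq_square algebra_simps)
  finally show ?thesis unfolding q_def .
qed

section \<open>From weak solutions to differentiable curves\<close>

lemma Sobolev_norm_ge:
  assumes "has_weak_deriv {c<..<d} k f g" "k \<le> m"
  shows "L2_norm {c<..<d} g \<le> Sobolev_norm m {c<..<d} f"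
proof -
  have "(L2_norm {c<..<d} (weak_deriv {c<..<d} k f))\<^sup>2 \<le> (\<Sum>k\<le>m. (L2_norm {c<..<d} (weak_deriv {c<..<d} k f))\<^sup>2)"
    using assms(2) by (intro member_le_sum) auto
  then show ?thesis
    unfolding weak_deriv_AE(3)[OF assms(1)] Sobolev_norm_def by (rule real_le_rsqrt)
qed

text \<open>On a bounded window around \<open>t\<close> the function is almost everywhere a constant
  plus a primitive of \<open>k\<close> by \<open>du_Bois_Reymond\<close>; continuity of both
  functions removes the exceptional set and makes the derivative classical.\<close>

lemma weak_time_deriv_imp_deriv:
  fixes f k :: "real \<Rightarrow> complex"
  assumes f: "continuous_on UNIV f" and k: "continuous_on UNIV k"
    and weak: "\<And>\<eta>. test_fun UNIV \<eta> \<Longrightarrow> (LINT t|lebesgue. deriv \<eta> t *\<^sub>R f t) = - (LINT t|lebesgue. \<eta> t *\<^sub>R k t)"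
  shows "(f has_vector_derivative k t) (at t)"
proof -
  define R where "R = \<bar>t\<bar> + 1"
  have R: "-R < R" "t \<in> {-R<..<R}" by (auto simp: R_def)
  have fR: "continuous_on {-R..R} f" and kR: "continuous_on {-R..R} k"
    using f k by (auto intro: continuous_on_subset)
  have restrict: "(LINT t|lebesgue_on {-R<..<R}. \<eta> t *\<^sub>R h t) = (LINT t|lebesgue. \<eta> t *\<^sub>R h t)"
    if "test_fun {-R<..<R} \<eta>" for \<eta> and h :: "real \<Rightarrow> complex"
  proof -
    have "(LINT t|lebesgue_on {-R<..<R}. \<eta> t *\<^sub>R h t) = (LINT t|lebesgue. indicator {-R<..<R} t *\<^sub>R \<eta> t *\<^sub>R h t)"
      by (rule integral_restrict_space) simp
    also have "\<dots> = (LINT t|lebesgue. \<eta> t *\<^sub>R h t)"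
      by (rule Bochner_Integration.integral_cong) (use test_fun_outside[OF that] in \<open>auto simp: indicator_def\<close>)
    finally show ?thesis .
  qed
  obtain C where C: "AE x in lebesgue_on {-R<..<R}. f x = C + integral {-R..x} k"
  proof -
    have "\<exists>C. AE x in lebesgue_on {-R<..<R}. f x = C + integral {-R..x} k"
    proof (rule du_Bois_Reymond[OF R(1) integrable_Ioo_continuous[OF fR] integrable_Ioo_continuous[OF kR]])
      fix \<eta> assume \<eta>: "test_fun {-R<..<R} \<eta>"
      show "(LINT x|lebesgue_on {-R<..<R}. deriv \<eta> x *\<^sub>R f x) = - (LINT x|lebesgue_on {-R<..<R}. \<eta> x *\<^sub>R k x)"
        using weak[OF test_fun_mono[OF \<eta>]] restrict[OF test_fun_deriv[OF \<eta>]] restrict[OF \<eta>] by simp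
    qed
    then show ?thesis using that by blast
  qed
  have eq: "f x = C + integral {-R..x} k" if "x \<in> {-R..R}" for x
    by (rule continuous_AE_eq_imp_eq[OF R(1) fR _ C that])
      (intro continuous_on_add continuous_on_const indefinite_integral_continuous_1
          integrable_continuous_interval kR)
  have "(f has_vector_derivative k t) (at t within {-R..R})"
    using kR eq by (rule primitive_has_derivative) (use R in auto)
  then show ?thesis using R by (simp add: at_within_Icc_at)
qed

lemma L2_inner_continuous_on:
  fixes f :: "real \<Rightarrow> real \<Rightarrow> complex"
  assumes "\<And>s. f s \<in> L2 \<Omega>" "z \<in> L2 \<Omega>"
    and "\<And>t. ((\<lambda>s. L2_norm \<Omega> (\<lambda>x. f s x - f t x)) \<longlongrightarrow> 0) (at t)"
  shows "continuous_on UNIV (\<lambda>s. L2_inner \<Omega> (f s) z)"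
  unfolding continuous_on_eq_continuous_at[OF open_UNIV]
proof
  fix t
  have "((\<lambda>s. L2_inner \<Omega> (f s) z - L2_inner \<Omega> (f t) z) \<longlongrightarrow> 0) (at t)"
  proof (rule Lim_null_comparison)
    show "\<forall>\<^sub>F s in at t. norm (L2_inner \<Omega> (f s) z - L2_inner \<Omega> (f t) z)
        \<le> L2_norm \<Omega> (\<lambda>x. f s x - f t x) * L2_norm \<Omega> z"
      unfolding L2_inner_diff_left[OF assms(1) assms(1) assms(2), symmetric]
      by (rule always_eventually, rule allI, rule L2_inner_le[OF L2_diff[OF assms(1) assms(1)] assms(2)])
    show "((\<lambda>s. L2_norm \<Omega> (\<lambda>x. f s x - f t x) * L2_norm \<Omega> z) \<longlongrightarrow> 0) (at t)"
      by (rule tendsto_mult_left_zero[OF assms(3)])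
  qed
  then show "isCont (\<lambda>s. L2_inner \<Omega> (f s) z) t"
    unfolding isCont_def by (rule LIM_zero_cancel)
qed

lemma neumann_rep_unif_tendsto:
  assumes rep: "\<And>s. neumann_rep a (u s) (p s) (g s)" and "a > 0" and "e > 0"
    and u: "((\<lambda>s. L2_norm {-a<..<a} (\<lambda>x. u s x - u t x)) \<longlongrightarrow> 0) (at t)"
    and g: "((\<lambda>s. L2_norm {-a<..<a} (\<lambda>x. g s x - g t x)) \<longlongrightarrow> 0) (at t)"
  shows "\<forall>\<^sub>F s in at t. \<forall>x\<in>{-a..a}. cmod (u s x - u t x) < e \<and> cmod (p s x - p t x) < e"
proof -
  let ?U = "\<lambda>s. L2_norm {-a<..<a} (\<lambda>x. u s x - u t x)" and ?G = "\<lambda>s. L2_norm {-a<..<a} (\<lambda>x. g s x - g t x)"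
  have "((\<lambda>s. sqrt (2 * a) * ?U s + 4 * a\<^sup>2 * sqrt (2 * a) * ?G s) \<longlongrightarrow> sqrt (2 * a) * 0 + 4 * a\<^sup>2 * sqrt (2 * a) * 0) (at t)"
    by (intro tendsto_intros u g)
  then have 1: "\<forall>\<^sub>F s in at t. sqrt (2 * a) * ?U s + 4 * a\<^sup>2 * sqrt (2 * a) * ?G s < 2 * a * e"
    using \<open>a > 0\<close> \<open>e > 0\<close> by (auto intro: order_tendstoD(2))
  have "((\<lambda>s. sqrt (2 * a) * ?G s) \<longlongrightarrow> sqrt (2 * a) * 0) (at t)"
    by (intro tendsto_intros g)
  then have 2: "\<forall>\<^sub>F s in at t. sqrt (2 * a) * ?G s < e"
    using \<open>e > 0\<close> by (auto intro: order_tendstoD(2))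
  from 1 2 show ?thesis
  proof eventually_elim
    fix s assume s: "sqrt (2 * a) * ?U s + 4 * a\<^sup>2 * sqrt (2 * a) * ?G s < 2 * a * e" "sqrt (2 * a) * ?G s < e"
    note d = neumann_rep_diff[OF rep[of s] rep[of t]]
    show "\<forall>x\<in>{-a..a}. cmod (u s x - u t x) < e \<and> cmod (p s x - p t x) < e"
    proof
      fix x assume x: "x \<in> {-a..a}"
      have "2 * a * cmod (u s x - u t x) < 2 * a * e"
        using neumann_rep_sup_le[OF d x \<open>a > 0\<close>] s(1) by simp
      then show "cmod (u s x - u t x) < e \<and> cmod (p s x - p t x) < e"
        using neumann_rep_deriv_le[OF d x] s(2) \<open>a > 0\<close> by simp
    qed
  qed
qed

text \<open>\<open>log_nl\<close> is not Lipschitz near 0, so convergence is obtained from uniform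
  continuity on a ball containing all values involved. The constant \<open>e'\<close> compensates
  for the norm of a constant on an interval of length \<open>2 * a\<close>.\<close>

lemma log_nl_L2_tendsto:
  assumes rep: "\<And>s. neumann_rep a (u s) (p s) (g s)" and "a > 0"
    and u: "((\<lambda>s. L2_norm {-a<..<a} (\<lambda>x. u s x - u t x)) \<longlongrightarrow> 0) (at t)"
    and g: "((\<lambda>s. L2_norm {-a<..<a} (\<lambda>x. g s x - g t x)) \<longlongrightarrow> 0) (at t)"
  shows "((\<lambda>s. L2_norm {-a<..<a} (\<lambda>x. log_nl (u s x) - log_nl (u t x))) \<longlongrightarrow> 0) (at t)"
proof (rule tendstoI)
  fix e :: real assume "e > 0"
  define e' where "e' = e / (2 * sqrt (2 * a))"
  have e': "e' > 0" "e' * sqrt (2 * a) < e" using \<open>e > 0\<close> \<open>a > 0\<close> by (simp_all add: e'_def)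
  obtain N where N: "\<And>x. x \<in> {-a..a} \<Longrightarrow> cmod (u t x) \<le> N"
    using continuous_Icc_bounded[OF neumann_repD(6)[OF rep]] by blast
  have "uniformly_continuous_on (cball 0 (N + 1)) log_nl"
    by (intro compact_uniformly_continuous continuous_on_log_nl compact_cball)
  then obtain d where d: "d > 0"
    "\<And>z w. z \<in> cball 0 (N + 1) \<Longrightarrow> w \<in> cball 0 (N + 1) \<Longrightarrow> dist w z < d \<Longrightarrow> dist (log_nl w) (log_nl z) < e'"
    using e'(1) unfolding uniformly_continuous_on_def by meson
  have "\<forall>\<^sub>F s in at t. \<forall>x\<in>{-a..a}. cmod (u s x - u t x) < min d 1 \<and> cmod (p s x - p t x) < min d 1"
    by (rule neumann_rep_unif_tendsto[OF rep \<open>a > 0\<close> _ u g]) (use d in simp)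
  then show "\<forall>\<^sub>F s in at t. dist (L2_norm {-a<..<a} (\<lambda>x. log_nl (u s x) - log_nl (u t x))) 0 < e"
  proof eventually_elim
    fix s assume s: "\<forall>x\<in>{-a..a}. cmod (u s x - u t x) < min d 1 \<and> cmod (p s x - p t x) < min d 1"
    have "L2_norm {-a<..<a} (\<lambda>x. log_nl (u s x) - log_nl (u t x)) \<le> e' * sqrt (a - (-a))"
    proof (rule L2_norm_bounded(2))
      show "(\<lambda>x. log_nl (u s x) - log_nl (u t x)) \<in> borel_measurable (lebesgue_on {-a<..<a})"
        by (intro borel_measurable_Ioo_continuous continuous_on_diff
            continuous_on_compose2[OF continuous_on_log_nl[of UNIV]] neumann_repD(6)[OF rep]) auto
      fix x assume "x \<in> {-a<..<a}"
      then have x: "x \<in> {-a..a}" by auto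
      have "cmod (u s x) \<le> cmod (u t x) + cmod (u s x - u t x)" by (rule norm_triangle_sub)
      then have "u s x \<in> cball 0 (N + 1)" "u t x \<in> cball 0 (N + 1)"
        using bspec[OF s x] N[OF x] by auto
      then show "cmod (log_nl (u s x) - log_nl (u t x)) \<le> e'"
        using d(2)[of "u t x" "u s x"] bspec[OF s x] by (simp add: dist_norm)
    qed (use \<open>a > 0\<close> in simp)
    then show "dist (L2_norm {-a<..<a} (\<lambda>x. log_nl (u s x) - log_nl (u t x))) 0 < e"
      using e'(2) by (simp add: L2_norm_nonneg)
  qed
qed

text \<open>The setting of all later estimates: fixed space derivatives \<open>p\<close> and
  \<open>g\<close>, tied to \<open>u\<close> pointwise by \<open>rep\<close> and to the Sobolev
  notions by \<open>weak1\<close> and \<open>weak2\<close>. The velocity in \<open>C1\<close> is the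
  equation solved for the time derivative.\<close>

locale neumann_flow =
  fixes a lam :: real and u p g :: "real \<Rightarrow> real \<Rightarrow> complex"
  assumes a_pos: "a > 0"
    and rep: "\<And>t. neumann_rep a (u t) (p t) (g t)"
    and weak1: "\<And>t. has_weak_deriv {-a<..<a} 1 (u t) (p t)"
    and weak2: "\<And>t. has_weak_deriv {-a<..<a} 2 (u t) (g t)"
    and u_cont: "\<And>t. ((\<lambda>s. L2_norm {-a<..<a} (\<lambda>x. u s x - u t x)) \<longlongrightarrow> 0) (at t)"
    and g_cont: "\<And>t. ((\<lambda>s. L2_norm {-a<..<a} (\<lambda>x. g s x - g t x)) \<longlongrightarrow> 0) (at t)"
    and C1: "time_C1 {-a<..<a} u (\<lambda>t x. \<i> * g t x - \<i> * complex_of_real lam * log_nl (u t x))"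

lemma log_nl_L2:
  assumes "neumann_rep a f p g" shows "(\<lambda>x. log_nl (f x)) \<in> L2 {-a<..<a}"
  by (intro L2_continuous continuous_on_compose2[OF continuous_on_log_nl[of UNIV]] neumann_repD(6)[OF assms]) auto

text \<open>The equation identifies the weak time derivative at each time, up to null sets, with an
  expression continuous in time in the \<open>L2\<close> norm; this is what makes it a classical
  derivative.\<close>

lemma logNLS_solution_flow:
  assumes "a > 0" and sol: "logNLS_solution lam a \<phi> u"
  obtains p g where "neumann_flow a lam u p g"
proof -
  let ?S = "{-a<..<a}" and ?M = "lebesgue_on {-a<..<a}"
  have D: "u t \<in> D_Neu a" and cont: "((\<lambda>s. Sobolev_norm 2 ?S (\<lambda>x. u s x - u t x)) \<longlongrightarrow> 0) (at t)" for t
    using sol by (auto simp: logNLS_solution_def C_D_Neu_def)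
  obtain v where v: "Linf_loc_L2 ?S v" "has_weak_time_deriv ?S u v"
    "\<And>t. AE x in ?M. \<i> * v t x + weak_deriv ?S 2 (u t) x = complex_of_real lam * log_nl (u t x)"
    using sol unfolding logNLS_solution_def by blast
  have "\<exists>p g. neumann_rep a (u t) p g \<and> has_weak_deriv ?S 1 (u t) p \<and> has_weak_deriv ?S 2 (u t) g" for t
    using D_Neu_rep[OF \<open>a > 0\<close> D[of t]] by metis
  then obtain p g where pg: "\<And>t. neumann_rep a (u t) (p t) (g t)"
    "\<And>t. has_weak_deriv ?S 1 (u t) (p t)" "\<And>t. has_weak_deriv ?S 2 (u t) (g t)"
    by metis
  have le0: "L2_norm ?S (\<lambda>x. u s x - u t x) \<le> Sobolev_norm 2 ?S (\<lambda>x. u s x - u t x)" for s t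
    by (rule Sobolev_norm_ge[OF has_weak_deriv_0[OF L2_diff]]) (use neumann_repD(8)[OF pg(1)] in auto)
  have le2: "L2_norm ?S (\<lambda>x. g s x - g t x) \<le> Sobolev_norm 2 ?S (\<lambda>x. u s x - u t x)" for s t
    by (rule Sobolev_norm_ge[OF has_weak_deriv_diff[OF pg(3) pg(3)]]) simp
  have u_cont: "((\<lambda>s. L2_norm ?S (\<lambda>x. u s x - u t x)) \<longlongrightarrow> 0) (at t)" for t
    by (rule tendsto_sandwich[OF _ _ tendsto_const cont]) (simp_all add: L2_norm_nonneg le0)
  have g_cont: "((\<lambda>s. L2_norm ?S (\<lambda>x. g s x - g t x)) \<longlongrightarrow> 0) (at t)" for t
    by (rule tendsto_sandwich[OF _ _ tendsto_const cont]) (simp_all add: L2_norm_nonneg le2)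
  define V where "V t x = \<i> * g t x - \<i> * complex_of_real lam * log_nl (u t x)" for t x
  have uL: "u t \<in> L2 ?S" and gL: "g t \<in> L2 ?S" and lL: "(\<lambda>x. log_nl (u t x)) \<in> L2 ?S" for t
    using neumann_repD[OF pg(1)] log_nl_L2[OF pg(1)] by auto
  have VL: "V t \<in> L2 ?S" for t
    unfolding V_def[abs_def] by (intro L2_diff L2_scale gL lL)
  have vL: "v t \<in> L2 ?S" for t using v(1) by (simp add: Linf_loc_L2_def)
  have vV: "AE x in ?M. v t x = V t x" for t
    using v(3)[of t] weak_deriv_AE(1)[OF pg(3)[of t]]
  proof eventually_elim
    fix x assume "\<i> * v t x + weak_deriv ?S 2 (u t) x = complex_of_real lam * log_nl (u t x)"
      "weak_deriv ?S 2 (u t) x = g t x"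
    then have "\<i> * v t x = complex_of_real lam * log_nl (u t x) - g t x" by (simp add: algebra_simps)
    then have "- \<i> * (\<i> * v t x) = - \<i> * (complex_of_real lam * log_nl (u t x) - g t x)" by simp
    then show "v t x = V t x" by (simp add: V_def algebra_simps)
  qed
  have V_cont: "((\<lambda>s. L2_norm ?S (\<lambda>x. V s x - V t x)) \<longlongrightarrow> 0) (at t)" for t
  proof -
    note l = log_nl_L2_tendsto[OF pg(1) \<open>a > 0\<close> u_cont[of t] g_cont[of t]]
    have "((\<lambda>s. L2_norm ?S (\<lambda>x. (\<i> * g s x + - \<i> * complex_of_real lam * log_nl (u s x)) -
        (\<i> * g t x + - \<i> * complex_of_real lam * log_nl (u t x)))) \<longlongrightarrow> 0) (at t)"
      by (intro L2_norm_diff_tendsto L2_norm_scale_tendsto L2_scale gL lL g_cont l)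
    then show ?thesis by (simp add: V_def)
  qed
  have "time_C1 ?S u V" unfolding time_C1_def
  proof (intro conjI allI ballI)
    fix t z assume z: "z \<in> L2 ?S"
    show "((\<lambda>s. L2_inner ?S (u s) z) has_vector_derivative L2_inner ?S (V t) z) (at t)"
    proof (rule weak_time_deriv_imp_deriv)
      show "continuous_on UNIV (\<lambda>s. L2_inner ?S (u s) z)" by (rule L2_inner_continuous_on[OF uL z u_cont])
      show "continuous_on UNIV (\<lambda>s. L2_inner ?S (V s) z)" by (rule L2_inner_continuous_on[OF VL z V_cont])
      fix \<eta> assume "test_fun UNIV \<eta>"
      moreover have "L2_inner ?S (v s) z = L2_inner ?S (V s) z" for s
        by (rule L2_inner_cong_AE[OF vV L2_measurable[OF vL] L2_measurable[OF VL] z])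
      ultimately show "(LINT t|lebesgue. deriv \<eta> t *\<^sub>R L2_inner ?S (u t) z) = - (LINT t|lebesgue. \<eta> t *\<^sub>R L2_inner ?S (V t) z)"
        using v(2) z unfolding has_weak_time_deriv_def by simp
    qed
  qed (use uL VL V_cont in auto)
  then have "neumann_flow a lam u p g"
    using \<open>a > 0\<close> pg u_cont g_cont by unfold_locales (auto simp: V_def[abs_def])
  then show ?thesis by (rule that)
qed

section \<open>Oddness and lower bounds\<close>

text \<open>Converse of \<open>du_Bois_Reymond\<close>; the constant \<open>k\<close> drops out
  because test functions vanish at both ends.\<close>

lemma has_weak_deriv_of_primitive:
  assumes h: "h \<in> L2 {c<..<d}" and "c < d"
    and Q: "\<And>x. x \<in> {c..d} \<Longrightarrow> Q x = k + integral {c..x} h"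
  shows "has_weak_deriv {c<..<d} 1 Q h"
proof -
  let ?M = "lebesgue_on {c<..<d}"
  have prim: "continuous_on {c..d} (\<lambda>x. integral {c..x} h)"
    by (intro indefinite_integral_continuous_1 integrable_Ioo_integrable_on L2_integrable h)
  have "continuous_on {c..d} Q"
    by (rule continuous_on_eq[OF continuous_on_add[OF continuous_on_const prim]]) (simp add: Q)
  then have QL: "Q \<in> L2 {c<..<d}" by (rule L2_continuous)
  have "(LINT x|?M. deriv \<eta> x *\<^sub>R Q x) = - (LINT x|?M. \<eta> x *\<^sub>R h x)" if \<eta>: "test_fun {c<..<d} \<eta>" for \<eta>
  proof -
    note d\<eta> = test_fun_deriv[OF \<eta>]
    have "(deriv \<eta> has_integral (\<eta> d - \<eta> c)) {c..d}"
    proof (rule fundamental_theorem_of_calculus)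
      show "(\<eta> has_vector_derivative deriv \<eta> x) (at x within {c..d})" for x
        using has_vector_derivative_at_within[OF test_fun_DERIV[OF \<eta>, unfolded has_real_derivative_iff_has_vector_derivative]] .
    qed (use \<open>c < d\<close> in simp)
    then have "(deriv \<eta> has_integral 0) {c..d}" by (simp add: test_fun_outside[OF \<eta>])
    then have "((\<lambda>x. deriv \<eta> x *\<^sub>R k) has_integral 0) {c..d}"
      using has_integral_scaleR_left[of "deriv \<eta>" 0 _ k] by simp
    moreover have ik: "integrable ?M (\<lambda>x. deriv \<eta> x *\<^sub>R k)"
      by (rule integrable_Ioo_test_fun[OF integrable_Ioo_continuous[OF continuous_on_const] d\<eta>])
    ultimately have k0: "(LINT x|?M. deriv \<eta> x *\<^sub>R k) = 0"
      using LINT_Ioo_eq_integral[OF ik] by (simp add: has_integral_iff)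
    have "(LINT x|?M. deriv \<eta> x *\<^sub>R Q x) = (LINT x|?M. deriv \<eta> x *\<^sub>R k + deriv \<eta> x *\<^sub>R integral {c..x} h)"
      by (rule Bochner_Integration.integral_cong) (auto simp: Q scaleR_add_right)
    also have "\<dots> = (LINT x|?M. deriv \<eta> x *\<^sub>R k) + (LINT x|?M. deriv \<eta> x *\<^sub>R integral {c..x} h)"
      by (rule Bochner_Integration.integral_add[OF ik integrable_Ioo_test_fun[OF integrable_Ioo_continuous[OF prim] d\<eta>]])
    also have "\<dots> = - (LINT x|?M. \<eta> x *\<^sub>R h x)"
      unfolding k0 using test_fun_primitive_parts[OF L2_integrable[OF h] \<eta>] by simp
    finally show ?thesis .
  qed
  then show ?thesis unfolding has_weak_deriv_1_iff using QL h by blast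
qed

text \<open>Trades the second derivative of \<open>f\<close> for the first by spending one
  derivative on \<open>\<gamma>\<close>. Used with \<open>\<gamma> = V 0\<close>, it keeps the
  source term within the gradient norm that Gronwall controls.\<close>

lemma inner_second_deriv_le:
  assumes rep: "neumann_rep a f p g" and \<gamma>: "has_weak_deriv {-a<..<a} 1 \<gamma> h" and "a > 0"
  shows "cmod (L2_inner {-a<..<a} g \<gamma>) \<le> L2_norm {-a<..<a} p * L2_norm {-a<..<a} h"
proof -
  let ?S = "{-a<..<a}" and ?M = "lebesgue_on {-a<..<a}"
  note A = neumann_repD[OF rep]
  have L: "\<gamma> \<in> L2 ?S" "h \<in> L2 ?S" using \<gamma> by (auto simp: has_weak_deriv_def)
  \<comment> \<open>\<open>\<gamma>\<close> equals a primitive of \<open>h\<close> only almost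
    everywhere, so the integration by parts is carried out for that primitive.\<close>
  obtain C where C: "AE x in ?M. \<gamma> x = C + integral {-a..x} h"
    using du_Bois_Reymond[OF _ L2_integrable[OF L(1)] L2_integrable[OF L(2)]] \<gamma> \<open>a > 0\<close>
    unfolding has_weak_deriv_1_iff by auto
  have cont: "continuous_on {-a..a} (\<lambda>x. cnj C + integral {-a..x} (\<lambda>x. cnj (h x)))"
    by (intro continuous_on_add continuous_on_const indefinite_integral_continuous_1
        integrable_Ioo_integrable_on L2_integrable L2_cnj L)
  have "L2_inner ?S g \<gamma> = (LINT x|?M. g x * (cnj C + integral {-a..x} (\<lambda>x. cnj (h x))))"
    unfolding L2_inner_def
  proof (rule integral_cong_AE)
    show "AE x in ?M. g x * cnj (\<gamma> x) = g x * (cnj C + integral {-a..x} (\<lambda>x. cnj (h x)))"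
      using C by eventually_elim (simp add: Henstock_Kurzweil_Integration.integral_cnj)
    show "(\<lambda>x. g x * cnj (\<gamma> x)) \<in> borel_measurable ?M"
      by (rule borel_measurable_integrable[OF L2_inner_integrable[OF A(1) L(1)]])
    show "(\<lambda>x. g x * (cnj C + integral {-a..x} (\<lambda>x. cnj (h x)))) \<in> borel_measurable ?M"
      by (rule borel_measurable_integrable[OF L2_mult_integrable[OF A(1) L2_continuous[OF cont]]])
  qed
  also have "\<dots> = - (LINT x|?M. p x * cnj (h x))"
    by (rule neumann_rep_parts[OF rep L2_cnj[OF L(2)] refl \<open>a > 0\<close>])
  finally show ?thesis
    using L2_mult_le[OF A(7) L2_cnj[OF L(2)]] by (simp add: L2_norm_cnj)
qed

lemma vector_derivative_norm_le:
  fixes f :: "real \<Rightarrow> complex"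
  assumes f: "(f has_vector_derivative D) (at t)" and "d > 0"
    and le: "\<And>h. \<bar>h\<bar> < d \<Longrightarrow> cmod (f (t + h) - f t) \<le> B * \<bar>h\<bar>"
  shows "cmod D \<le> B"
proof (rule field_le_epsilon)
  fix e :: real assume "e > 0"
  obtain r where r: "r > 0" "\<And>y. norm (y - t) < r \<Longrightarrow> norm (f y - f t - (y - t) *\<^sub>R D) \<le> e * norm (y - t)"
    using f \<open>e > 0\<close> unfolding has_vector_derivative_def has_derivative_at_alt by blast
  define h where "h = min r d / 2"
  have h: "h > 0" "h < r" "h < d" using r \<open>d > 0\<close> by (auto simp: h_def min_def)
  have "cmod (h *\<^sub>R D) \<le> cmod (f (t + h) - f t) + cmod (f (t + h) - f t - h *\<^sub>R D)"
    using norm_triangle_ineq4[of "f (t + h) - f t" "f (t + h) - f t - h *\<^sub>R D"] by simp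
  also have "\<dots> \<le> B * h + e * h"
    using le[of h] r(2)[of "t + h"] h by (intro add_mono) simp_all
  finally have "h * cmod D \<le> h * (B + e)" using h by (simp add: algebra_simps)
  then show "cmod D \<le> B + e" using h by simp
qed

lemma Im_L2_inner_log_nl_le:
  assumes "f1 \<in> L2 S" "f2 \<in> L2 S" "(\<lambda>x. log_nl (f1 x)) \<in> L2 S" "(\<lambda>x. log_nl (f2 x)) \<in> L2 S"
  shows "\<bar>Im (L2_inner S (\<lambda>x. f1 x - f2 x) (\<lambda>x. log_nl (f1 x) - log_nl (f2 x)))\<bar>
    \<le> 2 * (L2_norm S (\<lambda>x. f1 x - f2 x))\<^sup>2"
proof -
  let ?M = "lebesgue_on S"
  let ?w = "\<lambda>x. f1 x - f2 x" and ?G = "\<lambda>x. log_nl (f1 x) - log_nl (f2 x)"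
  have L: "?w \<in> L2 S" "?G \<in> L2 S" using assms by (auto intro: L2_diff)
  have "Im (L2_inner S ?w ?G) = (LINT x|?M. Im (?w x * cnj (?G x)))"
    unfolding L2_inner_def by (rule integral_Im[symmetric, OF L2_inner_integrable[OF L]])
  also have "\<bar>\<dots>\<bar> \<le> (LINT x|?M. \<bar>Im (?w x * cnj (?G x))\<bar>)"
    using integral_norm_bound[of ?M "\<lambda>x. Im (?w x * cnj (?G x))"] by simp
  also have "\<dots> \<le> (LINT x|?M. 2 * (cmod (?w x))\<^sup>2)"
  proof (rule integral_mono)
    show "integrable ?M (\<lambda>x. \<bar>Im (?w x * cnj (?G x))\<bar>)"
      by (intro integrable_abs integrable_Im L2_inner_integrable L)
    show "integrable ?M (\<lambda>x. 2 * (cmod (?w x))\<^sup>2)"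
      by (intro integrable_mult_right L2_square_integrable L)
    fix x
    have "\<bar>Im (?w x * cnj (?G x))\<bar> = \<bar>Im (cnj (?w x) * ?G x)\<bar>" by (simp add: algebra_simps)
    then show "\<bar>Im (?w x * cnj (?G x))\<bar> \<le> 2 * (cmod (?w x))\<^sup>2"
      using Im_log_nl_diff_le[of "f1 x" "f2 x"] by simp
  qed
  also have "\<dots> = 2 * (L2_norm S ?w)\<^sup>2" by (simp add: L2_norm_power2)
  finally show ?thesis .
qed

lemma L2_norm_zero_imp_zero:
  assumes "continuous_on {c..d} f" "c < d" "L2_norm {c<..<d} f = 0" "x \<in> {c..d}"
  shows "f x = 0"
proof -
  let ?M = "lebesgue_on {c<..<d}"
  have "(LINT x|?M. (cmod (f x))\<^sup>2) = 0" using assms(3) L2_norm_power2[of "{c<..<d}" f] by simp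
  then have "AE x in ?M. (cmod (f x))\<^sup>2 = 0"
    using integral_nonneg_eq_0_iff_AE[OF L2_square_integrable[OF L2_continuous[OF assms(1)]]] by simp
  then have "AE x in ?M. f x = 0" by eventually_elim simp
  from continuous_AE_eq_imp_eq[OF assms(2) assms(1) continuous_on_const this assms(4)] show ?thesis .
qed

text \<open>Near 0 the first-order expansion keeps half the slope \<open>p 0\<close>; on the compact
  rest the minimum \<open>m\<close> of |f| dominates \<open>(m / a) * |x|\<close>.\<close>

lemma lower_bound_simple_zero:
  assumes rep: "neumann_rep a f p g" and "a > 0" and zero: "f 0 = 0" and d0: "p 0 \<noteq> 0"
    and nz: "\<And>x. x \<in> {-a..a} - {0} \<Longrightarrow> f x \<noteq> 0"
  obtains c where "c > 0" "\<And>x. x \<in> {-a..a} \<Longrightarrow> c * \<bar>x\<bar> \<le> cmod (f x)"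
proof -
  note A = neumann_repD[OF rep]
  have "(f has_vector_derivative p 0) (at 0 within {-a..a})" using A(4)[of 0] \<open>a > 0\<close> by simp
  moreover have "cmod (p 0) / 2 > 0" using d0 by simp
  ultimately obtain d where d: "d > 0"
    "\<And>y. y \<in> {-a..a} \<Longrightarrow> norm (y - 0) < d \<Longrightarrow> norm (f y - f 0 - (y - 0) *\<^sub>R p 0) \<le> cmod (p 0) / 2 * norm (y - 0)"
    unfolding has_vector_derivative_def has_derivative_within_alt by blast
  have near: "cmod (p 0) / 2 * \<bar>y\<bar> \<le> cmod (f y)" if "y \<in> {-a..a}" "\<bar>y\<bar> < d" for y
  proof -
    have "cmod (y *\<^sub>R p 0) \<le> cmod (f y) + cmod (f y - y *\<^sub>R p 0)"
      using norm_triangle_ineq4[of "f y" "f y - y *\<^sub>R p 0"] by simp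
    then show ?thesis using d(2)[OF that(1)] that(2) zero by (simp add: mult.commute)
  qed
  define K where "K = {-a..a} - {-d<..<d}"
  have K: "compact K" unfolding K_def by (intro compact_diff) auto
  obtain m where m: "m > 0" "\<And>x. x \<in> K \<Longrightarrow> m \<le> cmod (f x)"
  proof (cases "K = {}")
    case True
    then show ?thesis using that[of 1] by simp
  next
    case False
    have "continuous_on K (\<lambda>x. cmod (f x))"
      by (intro continuous_on_norm continuous_on_subset[OF A(6)]) (auto simp: K_def)
    from continuous_attains_inf[OF K False this] obtain x where x: "x \<in> K" "\<And>y. y \<in> K \<Longrightarrow> cmod (f x) \<le> cmod (f y)"
      by blast
    have "f x \<noteq> 0" using nz[of x] x(1) d(1) by (auto simp: K_def)
    then show ?thesis using that[of "cmod (f x)"] x(2) by simp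
  qed
  show ?thesis
  proof (rule that[of "min (cmod (p 0) / 2) (m / a)"])
    show "min (cmod (p 0) / 2) (m / a) > 0" using d0 m(1) \<open>a > 0\<close> by simp
    fix x assume x: "x \<in> {-a..a}"
    show "min (cmod (p 0) / 2) (m / a) * \<bar>x\<bar> \<le> cmod (f x)"
    proof (cases "\<bar>x\<bar> < d")
      case True
      have "min (cmod (p 0) / 2) (m / a) * \<bar>x\<bar> \<le> cmod (p 0) / 2 * \<bar>x\<bar>" by (rule mult_right_mono[OF min.cobounded1 abs_ge_zero])
      then show ?thesis using near[OF x True] by linarith
    next
      case False
      then have xK: "x \<in> K" using x by (auto simp: K_def)
      have "min (cmod (p 0) / 2) (m / a) * \<bar>x\<bar> \<le> m / a * \<bar>x\<bar>" by (rule mult_right_mono[OF min.cobounded2 abs_ge_zero])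
      also have "\<dots> \<le> m / a * a" using x m(1) \<open>a > 0\<close> by (intro mult_left_mono) auto
      also have "\<dots> = m" using \<open>a > 0\<close> by simp
      finally show ?thesis using m(2)[OF xK] by linarith
    qed
  qed
qed

context neumann_flow
begin

definition V :: "real \<Rightarrow> real \<Rightarrow> complex" where
  "V t x = \<i> * g t x - \<i> * complex_of_real lam * log_nl (u t x)"

lemma C1_V: "time_C1 {-a<..<a} u V"
  using C1 by (simp add: V_def[abs_def])

lemma u_L2: "u t \<in> L2 {-a<..<a}" and p_L2: "p t \<in> L2 {-a<..<a}" and g_L2: "g t \<in> L2 {-a<..<a}"
  and log_L2: "(\<lambda>x. log_nl (u t x)) \<in> L2 {-a<..<a}" and V_L2: "V t \<in> L2 {-a<..<a}"
  using neumann_repD[OF rep] log_nl_L2[OF rep] time_C1D(2)[OF C1_V] by auto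

lemma odd_preserved:
  assumes odd: "\<And>x. x \<in> {-a..a} \<Longrightarrow> u 0 (- x) = - u 0 x" and x: "x \<in> {-a..a}"
  shows "u t (- x) = - u t x"
proof -
  let ?S = "{-a<..<a}"
  \<comment> \<open>A difference of two solutions in disguise: oddness of \<open>log_nl\<close>
    turns the sum of the nonlinear terms of \<open>u\<close> and its reflection into the difference
    \<open>G\<close>.\<close>
  define w q r where "w t x = u t x + u t (- x)" and "q t x = p t x + - p t (- x)" and "r t x = g t x + g t (- x)" for t x
  have w_rep: "neumann_rep a (w t) (q t) (r t)" for t
    unfolding w_def[abs_def] q_def[abs_def] r_def[abs_def]
    by (rule neumann_rep_add[OF rep neumann_rep_reflect[OF rep a_pos]])
  define G where "G t x = log_nl (u t x) - log_nl (- u t (- x))" for t x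
  define v where "v t x = V t x + V t (- x)" for t x
  have v_eq: "v t = (\<lambda>x. \<i> * r t x + (- \<i> * complex_of_real lam) * G t x)" for t
    by (simp add: v_def V_def r_def G_def log_nl_minus fun_eq_iff algebra_simps)
  have w_C1: "time_C1 ?S w v"
    unfolding w_def[abs_def] v_def[abs_def] by (rule time_C1_add[OF C1_V time_C1_reflect[OF C1_V]])
  have rL: "r t \<in> L2 ?S" and wL: "w t \<in> L2 ?S" for t using neumann_repD[OF w_rep] by auto
  have lm: "(\<lambda>x. log_nl (- u t (- x))) \<in> L2 ?S" "(\<lambda>x. - u t (- x)) \<in> L2 ?S" for t
    using L2_minus[OF L2_reflect[OF log_L2[of t]]] L2_minus[OF L2_reflect[OF u_L2[of t]]] by (simp_all add: log_nl_minus)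
  have GL: "G t \<in> L2 ?S" for t unfolding G_def[abs_def] by (rule L2_diff[OF log_L2 lm(1)])
  have der: "((\<lambda>s. (L2_norm ?S (w s))\<^sup>2) has_real_derivative 2 * Re (L2_inner ?S (w s) (v s))) (at s)" for s
    by (rule L2_norm_deriv[OF w_C1])
  have bound: "\<bar>2 * Re (L2_inner ?S (w s) (v s))\<bar> \<le> (4 * \<bar>lam\<bar>) * (L2_norm ?S (w s))\<^sup>2 + 0" for s
  proof -
    \<comment> \<open>Green's formula makes this pairing real, so multiplied by the imaginary unit
      it has no real part.\<close>
    have "L2_inner ?S (w s) (r s) = cnj (L2_inner ?S (r s) (w s))" by (rule L2_inner_commute)
    also have "\<dots> = complex_of_real (- (L2_norm ?S (q s))\<^sup>2)"
      unfolding neumann_rep_green[OF w_rep w_rep a_pos] L2_inner_self[OF neumann_repD(7)[OF w_rep]] by simp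
    finally have wr: "L2_inner ?S (w s) (r s) = complex_of_real (- (L2_norm ?S (q s))\<^sup>2)" .
    have "L2_inner ?S (w s) (v s) = cnj \<i> * L2_inner ?S (w s) (r s) + cnj (- \<i> * complex_of_real lam) * L2_inner ?S (w s) (G s)"
      unfolding v_eq L2_inner_add_right[OF L2_scale[OF rL] L2_scale[OF GL] wL] L2_inner_scale_right ..
    then have "Re (L2_inner ?S (w s) (v s)) = - lam * Im (L2_inner ?S (w s) (G s))"
      by (simp add: wr)
    moreover have "\<bar>Im (L2_inner ?S (w s) (G s))\<bar> \<le> 2 * (L2_norm ?S (w s))\<^sup>2"
      using Im_L2_inner_log_nl_le[OF u_L2[of s] lm(2)[of s] log_L2[of s] lm(1)[of s]]
      by (simp add: w_def[abs_def] G_def[abs_def])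
    from mult_left_mono[OF this, of "2 * \<bar>lam\<bar>"]
    have "2 * \<bar>lam\<bar> * \<bar>Im (L2_inner ?S (w s) (G s))\<bar> \<le> 4 * \<bar>lam\<bar> * (L2_norm ?S (w s))\<^sup>2" by simp
    ultimately show ?thesis by (simp add: abs_mult)
  qed
  have "(L2_norm ?S (w t))\<^sup>2 \<le> ((L2_norm ?S (w 0))\<^sup>2 + 0 * \<bar>t\<bar>) * exp (4 * \<bar>lam\<bar> * \<bar>t\<bar>)"
    by (rule gronwall[OF _ _ der bound]) auto
  moreover have "L2_norm ?S (w 0) = 0"
  proof -
    have "(L2_norm ?S (w 0))\<^sup>2 = (LINT x|lebesgue_on ?S. 0)"
      unfolding L2_norm_power2
      by (rule Bochner_Integration.integral_cong) (auto simp: w_def odd)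
    then show ?thesis by simp
  qed
  ultimately have "L2_norm ?S (w t) = 0" by simp
  then have "w t x = 0"
    using a_pos x by (intro L2_norm_zero_imp_zero[OF neumann_repD(6)[OF w_rep]]) auto
  then show ?thesis by (simp add: w_def add_eq_0_iff)
qed

text \<open>Uniform closeness of \<open>u t\<close> and \<open>u 0\<close> says nothing near the
  zero. Closeness of the derivatives does: \<open>u t - u 0\<close> vanishes at 0 and has slope at
  most \<open>b / 2\<close>, so it takes away at most half of the bound
  \<open>b * |x|\<close>.\<close>

lemma lower_bound_persists:
  assumes odd: "\<And>x. x \<in> {-a..a} \<Longrightarrow> u 0 (- x) = - u 0 x"
    and nz: "\<And>x. x \<in> {-a..a} - {0} \<Longrightarrow> u 0 x \<noteq> 0" and d0: "p 0 0 \<noteq> 0"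
  obtains c M T where "c > 0" "M > 0" "T > 0"
    "\<And>t x. \<bar>t\<bar> < T \<Longrightarrow> x \<in> {-a..a} \<Longrightarrow> c * \<bar>x\<bar> \<le> cmod (u t x) \<and> cmod (p t x) \<le> M"
proof -
  have u0: "u t 0 = 0" for t
    using odd_preserved[OF odd, of 0 t] a_pos by (simp add: eq_neg_iff_add_eq_0)
  obtain b where b: "b > 0" "\<And>x. x \<in> {-a..a} \<Longrightarrow> b * \<bar>x\<bar> \<le> cmod (u 0 x)"
    using lower_bound_simple_zero[OF rep a_pos u0 d0 nz] by blast
  obtain B where B: "B > 0" "\<And>x. x \<in> {-a..a} \<Longrightarrow> cmod (p 0 x) \<le> B"
    using continuous_Icc_bounded[OF neumann_repD(5)[OF rep]] by blast
  have "\<forall>\<^sub>F s in at 0. \<forall>x\<in>{-a..a}. cmod (u s x - u 0 x) < b / 2 \<and> cmod (p s x - p 0 x) < b / 2"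
    by (rule neumann_rep_unif_tendsto[OF rep a_pos _ u_cont g_cont]) (use b in simp)
  then obtain T where T: "T > 0"
    "\<And>s. s \<noteq> 0 \<Longrightarrow> \<bar>s\<bar> < T \<Longrightarrow> \<forall>x\<in>{-a..a}. cmod (u s x - u 0 x) < b / 2 \<and> cmod (p s x - p 0 x) < b / 2"
    unfolding eventually_at by (auto simp: dist_real_def)
  have pd: "cmod (p s x - p 0 x) \<le> b / 2" if "\<bar>s\<bar> < T" "x \<in> {-a..a}" for s x
    using T(2)[of s] that b(1) by (cases "s = 0") (auto intro: less_imp_le)
  show ?thesis
  proof (rule that[of "b / 2" "B + b / 2" T])
    fix t x assume t: "\<bar>t\<bar> < T" and x: "x \<in> {-a..a}"
    have "cmod ((u t x - u 0 x) - (u t 0 - u 0 0)) \<le> b / 2 * \<bar>x - 0\<bar>"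
      by (rule neumann_rep_lipschitz[OF neumann_rep_diff[OF rep rep] x]) (use a_pos pd[OF t] in auto)
    then have "cmod (u t x - u 0 x) \<le> b / 2 * \<bar>x\<bar>" by (simp add: u0)
    moreover have "cmod (u 0 x) \<le> cmod (u t x) + cmod (u t x - u 0 x)"
      using norm_triangle_ineq4[of "u t x" "u t x - u 0 x"] by simp
    ultimately have "b / 2 * \<bar>x\<bar> \<le> cmod (u t x)" using b(2)[OF x] by simp
    moreover have "cmod (p t x) \<le> B + b / 2"
      using norm_triangle_sub[of "p t x" "p 0 x"] B(2)[OF x] pd[OF t x] by simp
    ultimately show "b / 2 * \<bar>x\<bar> \<le> cmod (u t x) \<and> cmod (p t x) \<le> B + b / 2" ..
  qed (use b B T in auto)
qed

end

section \<open>Propagation of regularity\<close>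

context neumann_flow
begin

text \<open>In the energy identity for two solutions the principal part \<open>\<i> * r\<close> does not contribute;
  \<open>\<gamma>\<close> is a time independent source, namely \<open>V 0\<close> when one of the two is frozen at time \<open>0\<close>.\<close>

lemma Re_inner_velocity:
  assumes r: "r \<in> L2 {-a<..<a}" and G: "G \<in> L2 {-a<..<a}" and \<gamma>: "\<gamma> \<in> L2 {-a<..<a}"
  shows "- 2 * Re (L2_inner {-a<..<a} r (\<lambda>x. (\<i> * r x + (- \<i> * complex_of_real lam) * G x) + \<gamma> x))
    = 2 * lam * Im (L2_inner {-a<..<a} r G) - 2 * Re (L2_inner {-a<..<a} r \<gamma>)"
  unfolding L2_inner_add_right[OF L2_add[OF L2_scale[OF r] L2_scale[OF G]] \<gamma> r]
    L2_inner_add_right[OF L2_scale[OF r] L2_scale[OF G] r] L2_inner_scale_right L2_inner_self[OF r]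
  by (simp add: algebra_simps)

lemma gradient_difference_deriv:
  "((\<lambda>s. (L2_norm {-a<..<a} (\<lambda>x. p (s + h) x - p s x))\<^sup>2) has_real_derivative
    2 * lam * Im (L2_inner {-a<..<a} (\<lambda>x. g (t + h) x - g t x) (\<lambda>x. log_nl (u (t + h) x) - log_nl (u t x)))) (at t)"
proof -
  let ?S = "{-a<..<a}"
  let ?r = "\<lambda>s x. g (s + h) x - g s x" and ?G = "\<lambda>s x. log_nl (u (s + h) x) - log_nl (u s x)"
  have C: "time_C1 ?S (\<lambda>s x. u (s + h) x - u s x) (\<lambda>s x. V (s + h) x - V s x)"
    by (rule time_C1_diff[OF time_C1_shift[OF C1_V] C1_V])
  have g_shift: "((\<lambda>s. L2_norm ?S (\<lambda>x. g (s + h) x - g (t + h) x)) \<longlongrightarrow> 0) (at t)"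
    using LIM_offset[OF g_cont[of "t + h"], of h] by simp
  have r_cont: "((\<lambda>s. L2_norm ?S (\<lambda>x. ?r s x - ?r t x)) \<longlongrightarrow> 0) (at t)"
    using L2_norm_diff_tendsto[of "\<lambda>s. g (s + h)" ?S "\<lambda>s x. - 1 * g s x" t,
        OF g_L2 L2_scale[OF g_L2] g_shift L2_norm_scale_tendsto[OF g_cont]]
    by simp
  have "((\<lambda>s. (L2_norm ?S (\<lambda>x. p (s + h) x - p s x))\<^sup>2) has_real_derivative
      - 2 * Re (L2_inner ?S (?r t) (\<lambda>x. V (t + h) x - V t x))) (at t)"
    by (rule gradient_norm_deriv[OF C neumann_rep_diff[OF rep rep] a_pos r_cont])
  \<comment> \<open>The summand 0 is the source in \<open>Re_inner_velocity\<close>: here both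
    compared states follow the flow.\<close>
  moreover have "(\<lambda>x. V (t + h) x - V t x) = (\<lambda>x. (\<i> * ?r t x + (- \<i> * complex_of_real lam) * ?G t x) + 0)"
    by (simp add: V_def fun_eq_iff algebra_simps)
  moreover have "L2_inner ?S (?r t) (\<lambda>x. 0) = 0" by (simp add: L2_inner_def)
  ultimately show ?thesis
    using Re_inner_velocity[OF L2_diff[OF g_L2[of "t + h"] g_L2[of t]] L2_diff[OF log_L2[of "t + h"] log_L2[of t]]
        L2_continuous[OF continuous_on_const[of _ 0]]]
    by (simp only: zero_complex.sel mult_zero_right diff_0_right)
qed

lemma gradient_deviation_deriv:
  "((\<lambda>s. (L2_norm {-a<..<a} (\<lambda>x. p s x - p 0 x))\<^sup>2) has_real_derivative
    2 * lam * Im (L2_inner {-a<..<a} (\<lambda>x. g t x - g 0 x) (\<lambda>x. log_nl (u t x) - log_nl (u 0 x)))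
    - 2 * Re (L2_inner {-a<..<a} (\<lambda>x. g t x - g 0 x) (V 0))) (at t)"
proof -
  let ?S = "{-a<..<a}"
  let ?r = "\<lambda>s x. g s x - g 0 x" and ?G = "\<lambda>s x. log_nl (u s x) - log_nl (u 0 x)"
  have C: "time_C1 ?S (\<lambda>s x. u s x - u 0 x) (\<lambda>s x. V s x - 0)"
    by (rule time_C1_diff[OF C1_V time_C1_const[OF u_L2]])
  have r_cont: "((\<lambda>s. L2_norm ?S (\<lambda>x. ?r s x - ?r t x)) \<longlongrightarrow> 0) (at t)"
    using g_cont[of t] by simp
  have "((\<lambda>s. (L2_norm ?S (\<lambda>x. p s x - p 0 x))\<^sup>2) has_real_derivative
      - 2 * Re (L2_inner ?S (?r t) (\<lambda>x. V t x - 0))) (at t)"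
    by (rule gradient_norm_deriv[OF C neumann_rep_diff[OF rep rep] a_pos r_cont])
  moreover have "(\<lambda>x. V t x - 0) = (\<lambda>x. (\<i> * ?r t x + (- \<i> * complex_of_real lam) * ?G t x) + V 0 x)"
    by (simp add: V_def fun_eq_iff algebra_simps)
  ultimately show ?thesis
    using Re_inner_velocity[OF L2_diff[OF g_L2[of t] g_L2[of 0]] L2_diff[OF log_L2[of t] log_L2[of 0]] V_L2[of 0]]
    by simp
qed

text \<open>Gronwall is used twice: along the deviation from \<open>u 0\<close>, which bounds the
  increment at time 0 by a multiple of \<open>|h|\<close>, and then along the increment with
  \<open>h\<close> fixed, which carries that bound to time \<open>t\<close>.\<close>

lemma gradient_lipschitz:
  assumes "c > 0" "M > 0" "T > 0"
    and bounds: "\<And>t x. \<bar>t\<bar> < T \<Longrightarrow> x \<in> {-a..a} \<Longrightarrow> c * \<bar>x\<bar> \<le> cmod (u t x) \<and> cmod (p t x) \<le> M"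
    and zero: "\<And>t. u t 0 = 0"
    and V0: "has_weak_deriv {-a<..<a} 1 (V 0) h0"
  obtains C where "\<And>t h. \<bar>t\<bar> + \<bar>h\<bar> < T \<Longrightarrow> L2_norm {-a<..<a} (\<lambda>x. p (t + h) x - p t x) \<le> C * \<bar>h\<bar>"
proof -
  let ?S = "{-a<..<a}"
  define k where "k = 2 + 8 * M / c"
  define K where "K = 2 * \<bar>lam\<bar> * k"
  define N where "N = L2_norm ?S h0"
  have K0: "K \<ge> 0" using assms(1,2) by (simp add: K_def k_def)
  have N0: "N \<ge> 0" by (simp add: N_def L2_norm_nonneg)
  have main: "\<bar>2 * lam * Im (L2_inner ?S (\<lambda>x. g s x - g t x) (\<lambda>x. log_nl (u s x) - log_nl (u t x)))\<bar>
      \<le> K * (L2_norm ?S (\<lambda>x. p s x - p t x))\<^sup>2" if "\<bar>s\<bar> < T" "\<bar>t\<bar> < T" for s t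
  proof -
    have "\<bar>Im (L2_inner ?S (\<lambda>x. g s x - g t x) (\<lambda>x. log_nl (u s x) - log_nl (u t x)))\<bar>
        \<le> k * (L2_norm ?S (\<lambda>x. p s x - p t x))\<^sup>2"
      unfolding k_def
      by (rule Im_inner_log_nl_le[OF rep rep a_pos \<open>c > 0\<close> _ _ zero zero]) (use bounds that in auto)
    from mult_left_mono[OF this, of "2 * \<bar>lam\<bar>"] show ?thesis
      by (simp add: abs_mult K_def mult.assoc)
  qed
  have start: "(L2_norm ?S (\<lambda>x. p h x - p 0 x))\<^sup>2 \<le> h\<^sup>2 * (N\<^sup>2 * exp (K * T + 1))" if h: "\<bar>h\<bar> < T" for h
  proof (cases "h = 0")
    case True
    then show ?thesis by (simp add: L2_norm_def)
  next
    case False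
    then have hp: "\<bar>h\<bar> > 0" by simp
    let ?f = "\<lambda>s. (L2_norm ?S (\<lambda>x. p s x - p 0 x))\<^sup>2"
    \<comment> \<open>The source contributes 2 n N with n the gradient norm, split by Young's
      inequality into n^2 / |h| + |h| N^2. Over a time |h| the extra rate costs only
      \<open>exp 1\<close>, while |h| N^2 integrates to h^2 N^2, as a Lipschitz bound
      requires.\<close>
    have "?f h \<le> (?f 0 + (\<bar>h\<bar> * N\<^sup>2) * \<bar>h\<bar>) * exp ((K + 1 / \<bar>h\<bar>) * \<bar>h\<bar>)"
    proof (rule gronwall[where f = ?f, OF _ _ gradient_deviation_deriv])
      fix s assume "\<bar>s\<bar> \<le> \<bar>h\<bar>"
      then have s: "\<bar>s\<bar> < T" using h by simp
      let ?n = "L2_norm ?S (\<lambda>x. p s x - p 0 x)"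
      have "\<bar>Re (L2_inner ?S (\<lambda>x. g s x - g 0 x) (V 0))\<bar> \<le> ?n * N"
        unfolding N_def
        using inner_second_deriv_le[OF neumann_rep_diff[OF rep[of s] rep[of 0]] V0 a_pos] abs_Re_le_cmod order_trans
        by blast
      moreover have "2 * (?n * N) \<le> 1 / \<bar>h\<bar> * ?n\<^sup>2 + \<bar>h\<bar> * N\<^sup>2"
      proof -
        have "0 \<le> (?n - \<bar>h\<bar> * N)\<^sup>2 / \<bar>h\<bar>" by simp
        also have "\<dots> = 1 / \<bar>h\<bar> * ?n\<^sup>2 + \<bar>h\<bar> * N\<^sup>2 - 2 * (?n * N)"
          using hp by (simp add: power2_eq_square field_simps del: abs_mult_self_eq)
        finally show ?thesis by simp
      qed
      moreover have m: "\<bar>2 * lam * Im (L2_inner ?S (\<lambda>x. g s x - g 0 x) (\<lambda>x. log_nl (u s x) - log_nl (u 0 x)))\<bar> \<le> K * ?n\<^sup>2"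
        by (rule main[OF s]) (use \<open>T > 0\<close> in simp)
      ultimately show "\<bar>2 * lam * Im (L2_inner ?S (\<lambda>x. g s x - g 0 x) (\<lambda>x. log_nl (u s x) - log_nl (u 0 x)))
          - 2 * Re (L2_inner ?S (\<lambda>x. g s x - g 0 x) (V 0))\<bar> \<le> (K + 1 / \<bar>h\<bar>) * ?n\<^sup>2 + \<bar>h\<bar> * N\<^sup>2"
        unfolding distrib_right by linarith
    qed (use K0 in auto)
    also have "\<dots> = h\<^sup>2 * (N\<^sup>2 * exp (K * \<bar>h\<bar> + 1))"
      using hp by (simp add: L2_norm_def power2_eq_square algebra_simps)
    also have "\<dots> \<le> h\<^sup>2 * (N\<^sup>2 * exp (K * T + 1))"
      using K0 h by (intro mult_left_mono) (auto intro!: mult_left_mono)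
    finally show ?thesis .
  qed
  have "L2_norm ?S (\<lambda>x. p (t + h) x - p t x) \<le> (N * exp (K * T + 1)) * \<bar>h\<bar>" if th: "\<bar>t\<bar> + \<bar>h\<bar> < T" for t h
  proof -
    let ?f = "\<lambda>s. (L2_norm ?S (\<lambda>x. p (s + h) x - p s x))\<^sup>2"
    have "?f t \<le> (?f 0 + 0 * \<bar>t\<bar>) * exp (K * \<bar>t\<bar>)"
    proof (rule gronwall[where f = ?f, OF K0 _ gradient_difference_deriv])
      fix s assume "\<bar>s\<bar> \<le> \<bar>t\<bar>"
      then have "\<bar>s + h\<bar> < T" "\<bar>s\<bar> < T" using th by linarith+
      from main[OF this]
      show "\<bar>2 * lam * Im (L2_inner ?S (\<lambda>x. g (s + h) x - g s x) (\<lambda>x. log_nl (u (s + h) x) - log_nl (u s x)))\<bar> \<le> K * ?f s + 0"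
        by simp
    qed simp
    \<comment> \<open>The second exponential is enlarged to equal the first, so that the product is
      a perfect square.\<close>
    also have "\<dots> \<le> (h\<^sup>2 * (N\<^sup>2 * exp (K * T + 1))) * exp (K * T + 1)"
    proof (rule mult_mono)
      show "?f 0 + 0 * \<bar>t\<bar> \<le> h\<^sup>2 * (N\<^sup>2 * exp (K * T + 1))" using start[of h] th by simp
      have "K * \<bar>t\<bar> \<le> K * T" using th K0 by (intro mult_left_mono) auto
      then show "exp (K * \<bar>t\<bar>) \<le> exp (K * T + 1)" by simp
    qed auto
    also have "\<dots> = ((N * exp (K * T + 1)) * \<bar>h\<bar>)\<^sup>2"
      by (simp add: power2_eq_square algebra_simps)
    finally show ?thesis
      by (rule power2_le_imp_le) (use N0 in simp)
  qed
  then show ?thesis by (rule that)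
qed

text \<open>The pairing of \<open>u\<close> with \<open>deriv \<eta>\<close> is minus the integral
  of \<open>\<eta> p\<close>, so the Lipschitz bound on \<open>p\<close> makes it Lipschitz in time.
  Its time derivative is the pairing of \<open>V t\<close> with \<open>deriv \<eta>\<close>, which
  inherits the bound; no time derivative of \<open>p\<close> is involved.\<close>

lemma velocity_weak_deriv:
  assumes lip: "\<And>h. \<bar>h\<bar> < d \<Longrightarrow> L2_norm {-a<..<a} (\<lambda>x. p (t + h) x - p t x) \<le> C * \<bar>h\<bar>" and "d > 0"
  shows "\<exists>h. has_weak_deriv {-a<..<a} 1 (V t) h"
proof (rule bounded_imp_weak_deriv[OF _ V_L2])
  let ?S = "{-a<..<a}" and ?M = "lebesgue_on {-a<..<a}"
  fix \<eta> assume \<eta>: "test_fun ?S \<eta>"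
  define z where "z x = complex_of_real (deriv \<eta> x)" for x
  have z: "z \<in> L2 ?S" unfolding z_def[abs_def] by (rule L2_test_fun[OF test_fun_deriv[OF \<eta>]])
  have zi: "L2_inner ?S f z = (LINT x|?M. deriv \<eta> x *\<^sub>R f x)" for f
    by (simp add: L2_inner_def z_def scaleR_conv_of_real mult.commute)
  have "cmod (L2_inner ?S (V t) z) \<le> C * L2_norm ?S (\<lambda>x. complex_of_real (\<eta> x))"
  proof (rule vector_derivative_norm_le[OF time_C1D(3)[OF C1_V z] \<open>d > 0\<close>])
    fix h :: real assume h: "\<bar>h\<bar> < d"
    note dL = L2_diff[OF p_L2[of "t + h"] p_L2[of t]] and \<eta>L = L2_test_fun[OF \<eta>, of "-a" a]
    have "L2_inner ?S (u s) z = - (LINT x|?M. \<eta> x *\<^sub>R p s x)" for s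
      using weak1[of s] \<eta> unfolding zi has_weak_deriv_1_iff by blast
    then have "L2_inner ?S (u (t + h)) z - L2_inner ?S (u t) z = - (LINT x|?M. \<eta> x *\<^sub>R (p (t + h) x - p t x))"
      using integrable_test_fun_L2[OF \<eta> p_L2[of "t + h"]] integrable_test_fun_L2[OF \<eta> p_L2[of t]]
      by (simp add: scaleR_diff_right)
    then have "cmod (L2_inner ?S (u (t + h)) z - L2_inner ?S (u t) z)
        = cmod (LINT x|?M. complex_of_real (\<eta> x) * (p (t + h) x - p t x))"
      by (simp only: norm_minus_cancel scaleR_conv_of_real)
    also have "\<dots> \<le> L2_norm ?S (\<lambda>x. complex_of_real (\<eta> x)) * L2_norm ?S (\<lambda>x. p (t + h) x - p t x)"
      by (rule L2_mult_le[OF \<eta>L dL])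
    also have "\<dots> \<le> L2_norm ?S (\<lambda>x. complex_of_real (\<eta> x)) * (C * \<bar>h\<bar>)"
      by (rule mult_left_mono[OF lip[OF h] L2_norm_nonneg])
    finally show "cmod (L2_inner ?S (u (t + h)) z - L2_inner ?S (u t) z)
        \<le> C * L2_norm ?S (\<lambda>x. complex_of_real (\<eta> x)) * \<bar>h\<bar>"
      by (simp only: mult_ac)
  qed
  then show "cmod (LINT x|?M. deriv \<eta> x *\<^sub>R V t x) \<le> C * L2_norm ?S (\<lambda>x. complex_of_real (\<eta> x))"
    by (simp only: zi)
qed (use a_pos in simp)

lemma log_nl_weak_deriv:
  assumes "c > 0" "\<And>x. x \<in> {-a..a} \<Longrightarrow> c * \<bar>x\<bar> \<le> cmod (u t x)"
  shows "has_weak_deriv {-a<..<a} 1 (\<lambda>x. log_nl (u t x)) (\<lambda>x. dlog_nl (u t x) (p t x))"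
proof (rule has_weak_deriv_of_primitive)
  show "(\<lambda>x. dlog_nl (u t x) (p t x)) \<in> L2 {-a<..<a}"
    by (rule log_nl_primitive(1)[OF rep a_pos assms])
  show "log_nl (u t x) = log_nl (u t (- a)) + integral {-a..x} (\<lambda>x. dlog_nl (u t x) (p t x))"
    if "x \<in> {-a..a}" for x
    by (rule log_nl_primitive(2)[OF rep a_pos assms that])
qed (use a_pos in simp)

lemma H3_of_velocity_weak_deriv:
  assumes V: "has_weak_deriv {-a<..<a} 1 (V t) h"
    and "c > 0" "\<And>x. x \<in> {-a..a} \<Longrightarrow> c * \<bar>x\<bar> \<le> cmod (u t x)"
  shows "u t \<in> Sobolev_H 3 {-a<..<a}"
proof -
  let ?S = "{-a<..<a}"
  note l = log_nl_weak_deriv[OF assms(2,3)]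
  have "g t = (\<lambda>x. (- \<i>) * V t x + complex_of_real lam * log_nl (u t x))"
    by (simp add: V_def fun_eq_iff algebra_simps)
  then obtain k where "has_weak_deriv ?S 1 (g t) k"
    using has_weak_deriv_add[OF has_weak_deriv_scale[OF V, of "- \<i>"] has_weak_deriv_scale[OF l, of "complex_of_real lam"]]
    by metis
  from has_weak_deriv_compose[OF weak2[of t] this] have 3: "has_weak_deriv ?S 3 (u t) k"
    by (simp add: eval_nat_numeral)
  have "\<exists>k. has_weak_deriv ?S n (u t) k" if "n \<le> 3" for n
  proof -
    consider "n = 0" | "n = 1" | "n = 2" | "n = 3" using \<open>n \<le> 3\<close> by linarith
    then show ?thesis
      by cases (use has_weak_deriv_0[OF u_L2] weak1 weak2 3 in blast)+
  qed
  then show ?thesis using u_L2 by (auto simp: Sobolev_H_def)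
qed

lemma H3_locally:
  assumes odd: "\<And>x. x \<in> {-a..a} \<Longrightarrow> u 0 (- x) = - u 0 x"
    and nz: "\<And>x. x \<in> {-a..a} - {0} \<Longrightarrow> u 0 x \<noteq> 0" and d0: "p 0 0 \<noteq> 0"
    and H3: "has_weak_deriv {-a<..<a} 3 (u 0) g3"
  obtains c T where "c > 0" "T > 0"
    "\<And>t x. \<bar>t\<bar> < T \<Longrightarrow> x \<in> {-a..a} \<Longrightarrow> c * \<bar>x\<bar> \<le> cmod (u t x)"
    "\<And>t. \<bar>t\<bar> < T \<Longrightarrow> u t \<in> Sobolev_H 3 {-a<..<a}"
proof -
  let ?S = "{-a<..<a}"
  obtain c M T where cMT: "c > 0" "M > 0" "T > 0"
    and bounds: "\<And>t x. \<bar>t\<bar> < T \<Longrightarrow> x \<in> {-a..a} \<Longrightarrow> c * \<bar>x\<bar> \<le> cmod (u t x) \<and> cmod (p t x) \<le> M"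
    using lower_bound_persists[OF odd nz d0] by blast
  have zero: "u t 0 = 0" for t
    using odd_preserved[OF odd, of 0 t] a_pos by (simp add: eq_neg_iff_add_eq_0)
  \<comment> \<open>The third derivative of the initial datum enters here: it gives
    \<open>g 0\<close>, and with the nonlinearity also \<open>V 0\<close>, a derivative in
    \<open>L2\<close>.\<close>
  have "has_weak_deriv ?S 1 (g 0) g3"
    using has_weak_deriv_decompose[OF weak2[of 0], of g3] H3 by (simp add: eval_nat_numeral)
  moreover have "has_weak_deriv ?S 1 (\<lambda>x. log_nl (u 0 x)) (\<lambda>x. dlog_nl (u 0 x) (p 0 x))"
    using bounds[of 0] cMT by (intro log_nl_weak_deriv) auto
  ultimately have V0: "has_weak_deriv ?S 1 (V 0) (\<lambda>x. \<i> * g3 x - \<i> * complex_of_real lam * dlog_nl (u 0 x) (p 0 x))"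
    unfolding V_def[abs_def] by (intro has_weak_deriv_diff has_weak_deriv_scale)
  obtain C where C: "\<And>t h. \<bar>t\<bar> + \<bar>h\<bar> < T \<Longrightarrow> L2_norm ?S (\<lambda>x. p (t + h) x - p t x) \<le> C * \<bar>h\<bar>"
    using gradient_lipschitz[OF cMT bounds zero V0] by blast
  show ?thesis
  proof (rule that[OF cMT(1,3)])
    show "c * \<bar>x\<bar> \<le> cmod (u t x)" if "\<bar>t\<bar> < T" "x \<in> {-a..a}" for t x using bounds[OF that] ..
    show "u t \<in> Sobolev_H 3 ?S" if t: "\<bar>t\<bar> < T" for t
    proof -
      \<comment> \<open>\<open>T - |t|\<close> is the room for increments around \<open>t\<close>
        that the Lipschitz estimate covers.\<close>
      have "\<exists>h. has_weak_deriv ?S 1 (V t) h"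
        by (rule velocity_weak_deriv[of "T - \<bar>t\<bar>" t C]) (use C t in auto)
      then show ?thesis
        using H3_of_velocity_weak_deriv[OF _ cMT(1)] bounds[OF t] by blast
    qed
  qed
qed

end

text \<open>Needed because \<open>u 0\<close> and the initial datum agree on the interval only, not
  as functions on the line.\<close>

lemma has_weak_deriv_cong:
  assumes "has_weak_deriv \<Omega> k f g" "\<And>x. x \<in> \<Omega> \<Longrightarrow> f' x = f x"
  shows "has_weak_deriv \<Omega> k f' g"
proof -
  have "f' \<in> L2 \<Omega> \<longleftrightarrow> f \<in> L2 \<Omega>"
  proof -
    have "f' \<in> borel_measurable (lebesgue_on \<Omega>) \<longleftrightarrow> f \<in> borel_measurable (lebesgue_on \<Omega>)"
      by (rule measurable_cong) (simp add: assms(2))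
    moreover have "integrable (lebesgue_on \<Omega>) (\<lambda>x. (cmod (f' x))\<^sup>2) \<longleftrightarrow> integrable (lebesgue_on \<Omega>) (\<lambda>x. (cmod (f x))\<^sup>2)"
      by (rule Bochner_Integration.integrable_cong) (simp_all add: assms(2))
    ultimately show ?thesis by (simp add: L2_def)
  qed
  moreover have "(LINT x|lebesgue_on \<Omega>. \<eta> x *\<^sub>R f' x) = (LINT x|lebesgue_on \<Omega>. \<eta> x *\<^sub>R f x)" for \<eta> :: "real \<Rightarrow> real"
    by (rule Bochner_Integration.integral_cong) (use assms(2) in auto)
  ultimately show ?thesis using assms(1) by (simp add: has_weak_deriv_def)
qed

theorem theorem2p7:
  fixes lam a :: real and \<phi> :: "real \<Rightarrow> complex" and u :: "real \<Rightarrow> real \<Rightarrow> complex"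
  assumes "lam \<noteq> 0" and "a > 0"
    and "\<phi> \<in> D_odd a \<inter> Sobolev_H 3 {-a<..<a}"
    and "logNLS_solution lam a \<phi> u"
  shows "\<exists>T>0. \<forall>t\<in>{-T<..<T}. u t \<in> D_odd a \<inter> Sobolev_H 3 {-a<..<a}"
proof -
  let ?S = "{-a<..<a}"
  obtain p g where "neumann_flow a lam u p g"
    by (rule logNLS_solution_flow[OF assms(2,4)])
  then interpret neumann_flow a lam u p g .
  have init: "u 0 x = \<phi> x" if "x \<in> {-a..a}" for x
    using assms(4) that by (simp add: logNLS_solution_def)
  have DN: "u t \<in> D_Neu a" for t
    using assms(4) by (simp add: logNLS_solution_def C_D_Neu_def)
  have \<phi>: "\<And>x. x \<in> {-a..a} \<Longrightarrow> \<phi> (- x) = - \<phi> x" "\<And>x. x \<in> {-a..a} - {0} \<Longrightarrow> \<phi> x \<noteq> 0"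
    "vector_derivative \<phi> (at 0 within {-a..a}) \<noteq> 0"
    using assms(3) by (auto simp: D_odd_def)
  have pd: "(u t has_vector_derivative p t 0) (at 0 within {-a..a})" for t
    using neumann_repD(4)[OF rep[of t], of 0] a_pos by simp
  have vd: "vector_derivative (u t) (at 0 within {-a..a}) = p t 0" for t
    by (rule vector_derivative_within_closed_interval[OF _ _ pd]) (use a_pos in auto)
  have "(\<phi> has_vector_derivative p 0 0) (at 0 within {-a..a})"
    by (rule has_vector_derivative_transform[OF _ _ pd]) (use init a_pos in auto)
  then have "vector_derivative \<phi> (at 0 within {-a..a}) = p 0 0"
    using a_pos by (intro vector_derivative_within_closed_interval) auto
  then have d0: "p 0 0 \<noteq> 0" using \<phi>(3) by simp
  have odd0: "u 0 (- x) = - u 0 x" if "x \<in> {-a..a}" for x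
    using init[of x] init[of "- x"] \<phi>(1)[OF that] that by simp
  have nz0: "u 0 x \<noteq> 0" if "x \<in> {-a..a} - {0}" for x
    using init[of x] \<phi>(2)[OF that] that by simp
  obtain g3 where g3: "has_weak_deriv ?S 3 \<phi> g3"
    using assms(3) by (auto simp: Sobolev_H_def)
  have "has_weak_deriv ?S 3 (u 0) g3"
    by (rule has_weak_deriv_cong[OF g3]) (use init in auto)
  then obtain c T where cT: "c > 0" "T > 0"
    "\<And>t x. \<bar>t\<bar> < T \<Longrightarrow> x \<in> {-a..a} \<Longrightarrow> c * \<bar>x\<bar> \<le> cmod (u t x)"
    "\<And>t. \<bar>t\<bar> < T \<Longrightarrow> u t \<in> Sobolev_H 3 ?S"
    using H3_locally[OF odd0 nz0 d0] by blast
  have "u t \<in> D_odd a" if t: "\<bar>t\<bar> < T" for t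
  proof -
    have nz: "u t x \<noteq> 0" if "x \<in> {-a..a} - {0}" for x
      using cT(3)[OF t, of x] cT(1) that by (auto simp: mult_le_0_iff)
    \<comment> \<open>The bound \<open>c * |x|\<close> forces a nonzero slope at the zero: otherwise
      |u t y| would be at most \<open>c / 2 * y\<close> for small positive \<open>y\<close>.\<close>
    have "p t 0 \<noteq> 0"
    proof
      assume p0: "p t 0 = 0"
      have u0: "u t 0 = 0" using odd_preserved[OF odd0, of 0 t] a_pos by (simp add: eq_neg_iff_add_eq_0)
      have "c / 2 > 0" using cT(1) by simp
      then obtain d where d: "d > 0" "\<And>y. y \<in> {-a..a} \<Longrightarrow> norm (y - 0) < d \<Longrightarrow>
          norm (u t y - u t 0 - (y - 0) *\<^sub>R p t 0) \<le> c / 2 * norm (y - 0)"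
        using pd[of t] unfolding has_vector_derivative_def has_derivative_within_alt by blast
      define y where "y = min d a / 2"
      have y: "y > 0" "y < d" "y \<le> a" using d(1) a_pos by (auto simp: y_def min_def)
      then have "cmod (u t y) \<le> c / 2 * y" using d(2)[of y] p0 u0 by simp
      moreover have "c * y \<le> cmod (u t y)" using cT(3)[OF t, of y] y by simp
      moreover have "c * y > 0" using cT(1) y(1) by simp
      ultimately show False by simp
    qed
    then show ?thesis
      using DN odd_preserved[OF odd0] nz by (simp add: D_odd_def vd)
  qed
  then show ?thesis using cT(2,4) by (intro exI[of _ T]) auto
qed

end
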